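(* For input graphs of twin cover number $\tau$, $r$-\textsc{Grouped Dominating Set} can be solved in $O^*((2\tau(r+1))^{\tau})$ time. For the cases $r\in\{2,3\}$, it can be solved in $O^*((r+1)^{\tau})$ time.
   Context: Let $G=(V,E)$ be a finite undirected graph. An $r$-grouped dominating set with $k$ units in $G$ is a family $\mathcal{D}=\{D_1,\dots,D_k\}$ of mutually disjoint subsets of $V$ such that $|D_i|=r$ and the induced subgraph $G[D_i]$ is connected for each $i$, and $\bigcup_i D_i$ is a dominating set of $G$. The problem $r$-\textsc{Grouped Dominating Set} takes as input a graph $G$ and positive integers $r$ and $k$, and asks whether $G$ has an $r$-grouped dominating set with at most $k$ units. Two vertices $u,v$ are true twins if $N[u]=N[v]$ (closed neighborhoods); an edge $\{u,v\}$ is a twin edge if $u,v$ are true twins. A set $S\subseteq V$ is a twin cover if every edge $\{u,v\}\in E$ is a twin edge or has at least one endpoint in $S$. The twin cover number $\tau$ is the minimum size of a twin cover. The notation $O^*(\cdot)$ suppresses factors polynomial in the input size. *)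

theory Defs
  imports "Graph_Theory.Digraph_Component" "HOL-Computational_Algebra.Polynomial"
begin

section \<open>Twin covers and grouped dominating sets\<close>

text \<open>
  A finite simple undirected graph is a \<^locale>\<open>pair_graph\<close>: a finite, symmetric and loopless
  digraph without parallel arcs. An edge \<open>{u, v}\<close> is the pair of arcs \<open>(u, v)\<close>, \<open>(v, u)\<close>.
\<close>

definition closed_nbhd :: "'a pair_pre_digraph \<Rightarrow> 'a \<Rightarrow> 'a set" where
  "closed_nbhd G v = insert v {u. (v, u) \<in> parcs G}"

definition true_twins :: "'a pair_pre_digraph \<Rightarrow> 'a \<Rightarrow> 'a \<Rightarrow> bool" where
  "true_twins G u v \<longleftrightarrow> closed_nbhd G u = closed_nbhd G v"

definition twin_cover :: "'a pair_pre_digraph \<Rightarrow> 'a set \<Rightarrow> bool" where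
  "twin_cover G S \<longleftrightarrow> S \<subseteq> pverts G \<and>
     (\<forall>(u, v) \<in> parcs G. true_twins G u v \<or> u \<in> S \<or> v \<in> S)"

definition twin_cover_number :: "'a pair_pre_digraph \<Rightarrow> nat" where
  "twin_cover_number G = Min (card ` {S. twin_cover G S})"

definition dominating_set :: "'a pair_pre_digraph \<Rightarrow> 'a set \<Rightarrow> bool" where
  "dominating_set G D \<longleftrightarrow> D \<subseteq> pverts G \<and> (\<forall>v \<in> pverts G. \<exists>u \<in> D. v \<in> closed_nbhd G u)"

text \<open>
  The units form a set of sets. For \<open>r > 0\<close>, the only case used, disjoint units are distinct, so
  this agrees with indexed families.
\<close>

definition grouped_dominating_set ::
    "'a pair_pre_digraph \<Rightarrow> nat \<Rightarrow> nat \<Rightarrow> 'a set set \<Rightarrow> bool" where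
  "grouped_dominating_set G r k \<D> \<longleftrightarrow>
     finite \<D> \<and> card \<D> = k \<and> pairwise disjnt \<D> \<and>
     (\<forall>D \<in> \<D>. D \<subseteq> pverts G \<and> card D = r \<and> connected (with_proj G \<restriction> D)) \<and>
     dominating_set G (\<Union>\<D>)"


section \<open>Model of computation\<close>

text \<open>
  Programs of a first-order, call-by-value functional language whose only data are binary trees,
  as in the language F of N. D. Jones, \<open>Computability and Complexity\<close>. A program is a list of
  function bodies; \<open>Call f es\<close> evaluates body number \<open>f\<close> in the environment consisting of the
  argument values. Variables are de Bruijn indices into the environment. Function 0 is the entry
  point.

  The running time is the number of evaluated expression nodes. Each node does work bounded by a
  constant depending on the program only (trees are shared, never copied or compared), so this
  time agrees with Turing machine or random access machine time up to a polynomial.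
\<close>

datatype sexp = Null | Dot sexp sexp

fun sfst :: "sexp \<Rightarrow> sexp" where
  "sfst Null = Null"
| "sfst (Dot a b) = a"

fun ssnd :: "sexp \<Rightarrow> sexp" where
  "ssnd Null = Null"
| "ssnd (Dot a b) = b"

datatype expr =
    Var nat
  | ENull
  | EDot expr expr
  | EFst expr
  | ESnd expr
  | If expr expr expr
  | Let expr expr
  | Call nat "expr list"

type_synonym program = "expr list"

inductive eval :: "program \<Rightarrow> sexp list \<Rightarrow> expr \<Rightarrow> sexp \<Rightarrow> nat \<Rightarrow> bool"
  and evals :: "program \<Rightarrow> sexp list \<Rightarrow> expr list \<Rightarrow> sexp list \<Rightarrow> nat \<Rightarrow> bool"
  for P :: program where
  eval_Var: "i < length \<rho> \<Longrightarrow> eval P \<rho> (Var i) (\<rho> ! i) 1"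
| eval_ENull: "eval P \<rho> ENull Null 1"
| eval_EDot: "eval P \<rho> e1 v1 t1 \<Longrightarrow> eval P \<rho> e2 v2 t2 \<Longrightarrow>
    eval P \<rho> (EDot e1 e2) (Dot v1 v2) (t1 + t2 + 1)"
| eval_EFst: "eval P \<rho> e v t \<Longrightarrow> eval P \<rho> (EFst e) (sfst v) (t + 1)"
| eval_ESnd: "eval P \<rho> e v t \<Longrightarrow> eval P \<rho> (ESnd e) (ssnd v) (t + 1)"
| eval_If_Dot: "eval P \<rho> c (Dot a b) t1 \<Longrightarrow> eval P \<rho> e1 v t2 \<Longrightarrow>
    eval P \<rho> (If c e1 e2) v (t1 + t2 + 1)"
| eval_If_Null: "eval P \<rho> c Null t1 \<Longrightarrow> eval P \<rho> e2 v t2 \<Longrightarrow>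
    eval P \<rho> (If c e1 e2) v (t1 + t2 + 1)"
| eval_Let: "eval P \<rho> e1 v1 t1 \<Longrightarrow> eval P (v1 # \<rho>) e2 v2 t2 \<Longrightarrow>
    eval P \<rho> (Let e1 e2) v2 (t1 + t2 + 1)"
| eval_Call: "f < length P \<Longrightarrow> evals P \<rho> es vs t1 \<Longrightarrow> eval P vs (P ! f) v t2 \<Longrightarrow>
    eval P \<rho> (Call f es) v (t1 + t2 + 1)"
| evals_Nil: "evals P \<rho> [] [] 0"
| evals_Cons: "eval P \<rho> e v t1 \<Longrightarrow> evals P \<rho> es vs t2 \<Longrightarrow>
    evals P \<rho> (e # es) (v # vs) (t1 + t2)"

lemma eval_deterministic:
  "eval P \<rho> e v t \<Longrightarrow> eval P \<rho> e v' t' \<Longrightarrow> v' = v \<and> t' = t"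
  "evals P \<rho> es vs s \<Longrightarrow> evals P \<rho> es vs' s' \<Longrightarrow> vs' = vs \<and> s' = s"
proof (induction arbitrary: v' t' and vs' s' rule: eval_evals.inducts)
  case (eval_EDot \<rho> e1 v1 t1 e2 v2 t2)
  from eval_EDot.prems show ?case by cases (use eval_EDot.IH in blast)
next
  case (eval_EFst \<rho> e v t)
  from eval_EFst.prems show ?case by cases (use eval_EFst.IH in blast)
next
  case (eval_ESnd \<rho> e v t)
  from eval_ESnd.prems show ?case by cases (use eval_ESnd.IH in blast)
next
  case (eval_If_Dot \<rho> c a b t1 e1 v t2 e2)
  from eval_If_Dot.prems show ?case by cases (use eval_If_Dot.IH in blast)+
next
  case (eval_If_Null \<rho> c t1 e2 v t2 e1)
  from eval_If_Null.prems show ?case by cases (use eval_If_Null.IH in blast)+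
next
  case (eval_Let \<rho> e1 v1 t1 e2 v2 t2)
  from eval_Let.prems show ?case by cases (use eval_Let.IH in blast)
next
  case (eval_Call f \<rho> es vs t1 v t2)
  from eval_Call.prems show ?case by cases (use eval_Call.IH in blast)
next
  case (evals_Cons \<rho> e v t1 es vs t2)
  from evals_Cons.prems show ?case by cases (use evals_Cons.IH in blast)
qed (auto elim: eval.cases evals.cases)

definition runs :: "program \<Rightarrow> sexp \<Rightarrow> sexp \<Rightarrow> nat \<Rightarrow> bool" where
  "runs P x y t \<longleftrightarrow> eval P [x] (Call 0 [Var 0]) y t"

definition bool_sexp :: "bool \<Rightarrow> sexp" where
  "bool_sexp b = (if b then Dot Null Null else Null)"

definition list_sexp :: "sexp list \<Rightarrow> sexp" where
  "list_sexp xs = foldr Dot xs Null"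

text \<open>
  The decision problem with instances \<open>I\<close>, encoded by \<open>enc\<close>, and yes-instances given by \<open>Q\<close> can
  be solved in \<open>O\<^sup>*(f)\<close> time: one program answers every instance in time at most a polynomial in
  the input size, times \<open>f\<close>. Here \<^term>\<open>size (x :: sexp)\<close> is the number of \<open>Dot\<close> nodes.
\<close>

definition solvable_in_O_star ::
    "'i set \<Rightarrow> ('i \<Rightarrow> sexp) \<Rightarrow> ('i \<Rightarrow> bool) \<Rightarrow> ('i \<Rightarrow> nat) \<Rightarrow> bool" where
  "solvable_in_O_star I enc Q f \<longleftrightarrow>
     (\<exists>(P :: program) (p :: nat poly). \<forall>x \<in> I. \<exists>t.
        runs P (enc x) (bool_sexp (Q x)) t \<and> t \<le> poly p (size (enc x)) * f x)"


section \<open>The problem as a decision problem on encoded inputs\<close>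

text \<open>
  An instance is a triple \<open>(G, r, k)\<close>. As an input, the graph has vertices \<open>0, \<dots>, n - 1\<close> and is
  encoded by its adjacency matrix; \<open>r\<close> and \<open>k\<close> are encoded in binary, least significant bit first.
\<close>

type_synonym gds_instance = "nat pair_pre_digraph \<times> nat \<times> nat"

definition gds_instances :: "gds_instance set" where
  "gds_instances = {(G, r, k). pair_graph G \<and> (\<exists>n. pverts G = {..<n}) \<and> 0 < r \<and> 0 < k}"

definition gds_yes :: "gds_instance \<Rightarrow> bool" where
  "gds_yes = (\<lambda>(G, r, k). \<exists>j \<le> k. \<exists>\<D>. grouped_dominating_set G r j \<D>)"

fun nat_bits :: "nat \<Rightarrow> bool list" where
  "nat_bits 0 = []"
| "nat_bits (Suc n) = odd (Suc n) # nat_bits (Suc n div 2)"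

definition nat_sexp :: "nat \<Rightarrow> sexp" where
  "nat_sexp n = list_sexp (map bool_sexp (nat_bits n))"

definition graph_sexp :: "nat pair_pre_digraph \<Rightarrow> sexp" where
  "graph_sexp G = (let n = card (pverts G) in
     list_sexp (map (\<lambda>u. list_sexp (map (\<lambda>v. bool_sexp ((u, v) \<in> parcs G)) [0..<n])) [0..<n]))"

definition gds_encode :: "gds_instance \<Rightarrow> sexp" where
  "gds_encode = (\<lambda>(G, r, k). Dot (graph_sexp G) (Dot (nat_sexp r) (nat_sexp k)))"

end

theory Submission
  imports Defs
begin

text \<open>
  Removing a twin cover \<open>S\<close> leaves a disjoint union of cliques whose vertices are pairwise true
  twins. A dynamic program scans these cliques one after another and assembles the units. Of the
  vertices already used it remembers only a label for every \<open>s \<in> S\<close>: not used and not yet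
  dominated, not used but dominated, in a finished unit, in the unit under construction, or in a
  unit put aside, which is identified by one of its vertices in \<open>S\<close> together with its current
  size. A solution can be normalised so that no clique contains two units. A clique not dominated
  from \<open>S\<close> then contains exactly one unit, which need not be constructed: such units are
  counted at the end. There are at most \<open>(4 + \<tau> (r - 1))\<^sup>\<tau>\<close> label vectors. If \<open>r \<le> 3\<close>,
  then a unit that is put aside has at most two vertices, one of which lies outside \<open>S\<close>, so its
  name is determined by the labelled vertex; this leaves \<open>r + 1\<close> labels, apart from the at most
  three vertices of the unit under construction.

  A search that stores the visited states in a trie runs in time proportional to the number of
  reachable states. The same search finds a minimum twin cover: it branches on the endpoints of an
  uncovered edge and explores at most \<open>2 * 2 ^ b\<close> states for the budget \<open>b\<close>, which is increased
  up to \<open>\<tau>\<close>.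
\<close>

subsection \<open>Evaluation with time bounds\<close>

text \<open>The obstacle is that a state may not remember vertices outside \<open>S\<close>,
  although a unit can pass through several cliques. Forgetting is safe because all vertices of a
  clique have the same neighbours in \<open>S\<close>, and a connected set that meets both a clique
  and \<open>S\<close> contains a neighbour of that clique in \<open>S\<close>. If every piece of a
  unit absorbs all usable neighbours before it is put aside, a later vertex of the unit that is
  adjacent to a forgotten vertex is a twin of it, hence adjacent to a remembered vertex of the
  piece. So pieces can always be joined through \<open>S\<close>.

  The runs are nondeterministic, and the question is whether an accepting state is reachable.
  Soundness reads a solution off a colouring that records the history of a run; completeness steers
  one run along a normalised solution. The normalisation drops further units inside a clique: they
  dominate nothing that the first one does not.

  The base in the general bound comes from 4 + \<tau>(r - 1) \<le> 2\<tau>(r + 1) for \<tau> \<ge>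
  1, where the difference t(r + 3) - 4 with t = \<tau> is nonnegative. Both target bounds are at
  least 2^\<tau>, so the search for the cover is paid for as well.\<close>

definition evb :: "program \<Rightarrow> sexp list \<Rightarrow> expr \<Rightarrow> sexp \<Rightarrow> nat \<Rightarrow> bool" where
  "evb P \<rho> e v T \<longleftrightarrow> (\<exists>t\<le>T. eval P \<rho> e v t)"

lemma evb_mono: "evb P \<rho> e v T \<Longrightarrow> v = v' \<Longrightarrow> T \<le> T' \<Longrightarrow> evb P \<rho> e v' T'"
  unfolding evb_def by (meson le_trans)

lemma eval_pos: "eval P \<rho> e v t \<Longrightarrow> 0 < t"
  by (erule eval.cases) auto

lemma evb_pos: "evb P \<rho> e v T \<Longrightarrow> 0 < T"
  unfolding evb_def using eval_pos by fastforce

lemma evb_Var: "i < length \<rho> \<Longrightarrow> evb P \<rho> (Var i) (\<rho> ! i) 1"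
  unfolding evb_def by (meson eval_Var le_refl)

lemma evb_ENull: "evb P \<rho> ENull Null 1"
  unfolding evb_def by (meson eval_ENull le_refl)

lemma evb_EDot: "evb P \<rho> e1 v1 T1 \<Longrightarrow> evb P \<rho> e2 v2 T2 \<Longrightarrow> evb P \<rho> (EDot e1 e2) (Dot v1 v2) (T1 + T2 + 1)"
  unfolding evb_def by (meson add_le_mono eval_EDot le_refl)

lemma evb_EFst: "evb P \<rho> e v T \<Longrightarrow> evb P \<rho> (EFst e) (sfst v) (T + 1)"
  unfolding evb_def by (meson add_le_mono eval_EFst le_refl)

lemma evb_ESnd: "evb P \<rho> e v T \<Longrightarrow> evb P \<rho> (ESnd e) (ssnd v) (T + 1)"
  unfolding evb_def by (meson add_le_mono eval_ESnd le_refl)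

lemma evb_If_Dot:
  "evb P \<rho> c u T1 \<Longrightarrow> u \<noteq> Null \<Longrightarrow> evb P \<rho> e1 v T2 \<Longrightarrow> evb P \<rho> (If c e1 e2) v (T1 + T2 + 1)"
  unfolding evb_def by (metis add_le_mono eval_If_Dot le_refl sexp.exhaust)

lemma evb_If_Null:
  "evb P \<rho> c Null T1 \<Longrightarrow> evb P \<rho> e2 v T2 \<Longrightarrow> evb P \<rho> (If c e1 e2) v (T1 + T2 + 1)"
  unfolding evb_def by (meson add_le_mono eval_If_Null le_refl)

lemma evb_Call1:
  assumes "f < length P" "evb P \<rho> e1 v1 T1" "evb P [v1] (P ! f) v T"
  shows "evb P \<rho> (Call f [e1]) v (T1 + T + 1)"
proof -
  obtain t1 t where t: "eval P \<rho> e1 v1 t1" "eval P [v1] (P ! f) v t" "t1 \<le> T1" "t \<le> T"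
    using assms unfolding evb_def by blast
  have "evals P \<rho> [e1] [v1] (t1 + 0)"
    by (intro evals_Cons evals_Nil t)
  from eval_Call[OF assms(1) this t(2)] show ?thesis
    unfolding evb_def using t by (intro exI[of _ "t1 + 0 + t + 1"]) auto
qed

lemma evb_Call2:
  assumes "f < length P" "evb P \<rho> e1 v1 T1" "evb P \<rho> e2 v2 T2" "evb P [v1, v2] (P ! f) v T"
  shows "evb P \<rho> (Call f [e1, e2]) v (T1 + T2 + T + 1)"
proof -
  obtain t1 t2 t where t: "eval P \<rho> e1 v1 t1" "eval P \<rho> e2 v2 t2" "eval P [v1, v2] (P ! f) v t"
      "t1 \<le> T1" "t2 \<le> T2" "t \<le> T"
    using assms unfolding evb_def by blast
  have "evals P \<rho> [e1, e2] [v1, v2] (t1 + (t2 + 0))"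
    by (intro evals_Cons evals_Nil t)
  from eval_Call[OF assms(1) this t(3)] show ?thesis
    unfolding evb_def using t by (intro exI[of _ "t1 + (t2 + 0) + t + 1"]) auto
qed

lemma evb_Call3:
  assumes "f < length P" "evb P \<rho> e1 v1 T1" "evb P \<rho> e2 v2 T2" "evb P \<rho> e3 v3 T3"
    "evb P [v1, v2, v3] (P ! f) v T"
  shows "evb P \<rho> (Call f [e1, e2, e3]) v (T1 + T2 + T3 + T + 1)"
proof -
  obtain t1 t2 t3 t where t: "eval P \<rho> e1 v1 t1" "eval P \<rho> e2 v2 t2" "eval P \<rho> e3 v3 t3"
      "eval P [v1, v2, v3] (P ! f) v t"
      "t1 \<le> T1" "t2 \<le> T2" "t3 \<le> T3" "t \<le> T"
    using assms unfolding evb_def by blast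
  have "evals P \<rho> [e1, e2, e3] [v1, v2, v3] (t1 + (t2 + (t3 + 0)))"
    by (intro evals_Cons evals_Nil t)
  from eval_Call[OF assms(1) this t(4)] show ?thesis
    unfolding evb_def using t by (intro exI[of _ "t1 + (t2 + (t3 + 0)) + t + 1"]) auto
qed

fun quote_expr :: "sexp \<Rightarrow> expr" where
  "quote_expr Null = ENull"
| "quote_expr (Dot a b) = EDot (quote_expr a) (quote_expr b)"

lemma evb_quote_expr: "evb P \<rho> (quote_expr s) s (2 * size s + 1)"
proof (induction s)
  case (Dot a b)
  show ?case
    by (rule evb_mono, simp, rule evb_EDot, rule Dot, rule Dot) auto
qed (use evb_ENull in simp)

subsection \<open>Linking of programs\<close>

fun shift_calls :: "nat \<Rightarrow> expr \<Rightarrow> expr" where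
  "shift_calls k (Var i) = Var i"
| "shift_calls k ENull = ENull"
| "shift_calls k (EDot a b) = EDot (shift_calls k a) (shift_calls k b)"
| "shift_calls k (EFst a) = EFst (shift_calls k a)"
| "shift_calls k (ESnd a) = ESnd (shift_calls k a)"
| "shift_calls k (If a b c) = If (shift_calls k a) (shift_calls k b) (shift_calls k c)"
| "shift_calls k (Let a b) = Let (shift_calls k a) (shift_calls k b)"
| "shift_calls k (Call f es) = Call (k + f) (map (shift_calls k) es)"

lemmas eval_CallI = eval_Call

text \<open>Calls use absolute positions, so code placed behind a head \<open>H\<close> has its
  indices raised by \<open>length H\<close>. No other construct mentions positions, so value and
  time are unchanged.\<close>

lemma eval_shift_calls:
  assumes "Q = H @ map (shift_calls (length H)) P @ B"
  shows "eval P \<rho> e v t \<Longrightarrow> eval Q \<rho> (shift_calls (length H) e) v t"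
    and "evals P \<rho> es vs s \<Longrightarrow> evals Q \<rho> (map (shift_calls (length H)) es) vs s"
proof (induction rule: eval_evals.inducts)
  case (eval_Call f \<rho> es vs t1 v t2)
  have "Q ! (length H + f) = shift_calls (length H) (P ! f)" "length H + f < length Q"
    using eval_Call(1) by (auto simp: assms nth_append)
  then show ?case
    using eval_Call.IH eval_CallI by simp
qed (auto simp only: shift_calls.simps list.map intro: eval_evals.intros)

text \<open>Injectivity lets a comparison of trees decide equality of values, in the equality test
  as well as in the set of visited states.\<close>

class enc =
  fixes enc :: "'a \<Rightarrow> sexp"
  assumes enc_inject: "enc x = enc y \<longleftrightarrow> x = y"

definition sz :: "'a :: enc \<Rightarrow> nat" where
  "sz x = size (enc x)"

definition impl :: "program \<Rightarrow> nat \<Rightarrow> ('a :: enc \<Rightarrow> 'b :: enc) \<Rightarrow> 'a set \<Rightarrow> ('a \<Rightarrow> nat) \<Rightarrow> bool" where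
  "impl Q i f I T \<longleftrightarrow> i < length Q \<and> (\<forall>x\<in>I. evb Q [enc x] (Q ! i) (enc (f x)) (T x))"

lemma impl_lessD: "impl Q i f I T \<Longrightarrow> i < length Q"
  by (simp add: impl_def)

lemma implD: "impl Q i f I T \<Longrightarrow> x \<in> I \<Longrightarrow> evb Q [enc x] (Q ! i) (enc (f x)) (T x)"
  by (simp add: impl_def)

lemma impl_shift:
  assumes "impl P 0 f I T"
  shows "impl (H @ map (shift_calls (length H)) P @ B) (length H) f I T"
proof -
  let ?Q = "H @ map (shift_calls (length H)) P @ B"
  have 0: "0 < length P"
    using assms by (simp add: impl_def)
  then have "?Q ! length H = shift_calls (length H) (P ! 0)"
    by (simp add: nth_append)
  then have "evb ?Q [enc x] (?Q ! length H) (enc (f x)) (T x)" if "x \<in> I" for x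
    using implD[OF assms that] eval_shift_calls(1)[of ?Q H P B] unfolding evb_def by metis
  then show ?thesis
    using 0 by (simp add: impl_def)
qed

subsection \<open>Polynomial bounds\<close>

text \<open>The base is at least 2, so its powers dominate every constant and one exponent serves as
  a normal form for polynomial bounds.\<close>

definition pb :: "'a :: enc set \<Rightarrow> ('a \<Rightarrow> nat) \<Rightarrow> bool" where
  "pb I h \<longleftrightarrow> (\<exists>d. \<forall>x\<in>I. h x \<le> (sz x + 2) ^ d)"

lemma pb_mono: "pb I g \<Longrightarrow> (\<And>x. x \<in> I \<Longrightarrow> h x \<le> g x) \<Longrightarrow> pb I h"
  unfolding pb_def by (meson le_trans)

lemma pb_subset: "pb I g \<Longrightarrow> J \<subseteq> I \<Longrightarrow> pb J g"
  unfolding pb_def by blast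

lemma pb_const: "pb I (\<lambda>_. c)"
proof -
  have "c \<le> (sz x + 2) ^ c" for x :: 'a
    by (metis add_2_eq_Suc' less_exp less_imp_le_nat order_trans power_mono zero_le le_add2)
  then show ?thesis unfolding pb_def by blast
qed

lemma pb_sz: "pb I sz"
  unfolding pb_def by (intro exI[of _ 1]) auto

lemma pb_mult:
  assumes "pb I g" "pb I h"
  shows "pb I (\<lambda>x. g x * h x)"
proof -
  obtain a b where "\<forall>x\<in>I. g x \<le> (sz x + 2) ^ a" "\<forall>x\<in>I. h x \<le> (sz x + 2) ^ b"
    using assms unfolding pb_def by blast
  then show ?thesis
    unfolding pb_def by (intro exI[of _ "a + b"]) (auto simp: power_add intro: mult_le_mono)
qed

lemma pb_add:
  assumes "pb I g" "pb I h"
  shows "pb I (\<lambda>x. g x + h x)"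
proof -
  \<comment> \<open>A sum is at most twice the product of the incremented summands, which reduces
    sums to products.\<close>
  have "pb I (\<lambda>x. 2 * ((g x + 1) * (h x + 1)))" if "pb I (\<lambda>x. g x + 1)" "pb I (\<lambda>x. h x + 1)"
    by (intro pb_mult pb_const that)
  moreover have "pb I (\<lambda>x. f x + 1)" if f: "pb I f" for f
  proof -
    obtain a where a: "\<forall>x\<in>I. f x \<le> (sz x + 2) ^ a"
      using f unfolding pb_def by blast
    have "f x + 1 \<le> (sz x + 2) ^ Suc a" if "x \<in> I" for x
    proof -
      have "f x \<le> (sz x + 2) ^ a" "1 \<le> (sz x + 2) ^ a" using a that by auto
      then have "f x + 1 \<le> 2 * (sz x + 2) ^ a" by linarith
      also have "\<dots> \<le> (sz x + 2) ^ Suc a" by simp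
      finally show ?thesis .
    qed
    then show ?thesis unfolding pb_def by blast
  qed
  ultimately have "pb I (\<lambda>x. 2 * ((g x + 1) * (h x + 1)))"
    using assms by blast
  then show ?thesis by (rule pb_mono) (simp add: algebra_simps)
qed

lemma pb_power: "pb I g \<Longrightarrow> pb I (\<lambda>x. g x ^ n)"
  by (induction n) (auto intro: pb_const pb_mult)

lemma pb_comp:
  assumes h: "pb J h" and g: "pb I (\<lambda>x. sz (g x))" "\<And>x. x \<in> I \<Longrightarrow> g x \<in> J"
  shows "pb I (\<lambda>x. h (g x))"
proof -
  obtain a where a: "\<forall>x\<in>J. h x \<le> (sz x + 2) ^ a"
    using h unfolding pb_def by blast
  have "pb I (\<lambda>x. (sz (g x) + 2) ^ a)"
    by (intro pb_power pb_add pb_const g)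
  then show ?thesis by (rule pb_mono) (use a g in blast)
qed

subsection \<open>Functions computable in time \<open>T\<close> up to a polynomial factor\<close>

text \<open>The bound on the output size is what makes \<open>ot\<close> closed under composition.\<close>

definition ot :: "'a :: enc set \<Rightarrow> ('a \<Rightarrow> 'b :: enc) \<Rightarrow> ('a \<Rightarrow> nat) \<Rightarrow> bool" where
  "ot I f T \<longleftrightarrow> (\<exists>P A. pb I A \<and> impl P 0 f I (\<lambda>x. A x * T x)) \<and> pb I (\<lambda>x. sz (f x))"

text \<open>Polynomial factors are free in \<open>ot\<close>, so time 1 stands for polynomial
  time.\<close>

abbreviation pt :: "('a :: enc \<Rightarrow> 'b :: enc) \<Rightarrow> bool" where
  "pt f \<equiv> ot UNIV f (\<lambda>_. 1)"

lemma ot_size: "ot I f T \<Longrightarrow> pb I (\<lambda>x. sz (f x))"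
  by (simp add: ot_def)

text \<open>Every evaluation costs at least one node. Positivity of the time is what lets constant
  overheads be absorbed into a multiple of it.\<close>

lemma ot_pos: "ot I f T \<Longrightarrow> x \<in> I \<Longrightarrow> 0 < T x"
  unfolding ot_def impl_def using evb_pos by fastforce

lemma otI:
  assumes "pb I A" "pb I (\<lambda>x. sz (f x))" "P \<noteq> []"
    and "\<And>x. x \<in> I \<Longrightarrow> evb P [enc x] (P ! 0) (enc (f x)) (A x * T x)"
  shows "ot I f T"
  using assms unfolding ot_def impl_def by blast

text \<open>The workhorse for simplifying bounds: a polynomial \<open>B\<close> moves from the time
  into the hidden factor, while the domain shrinks and the function may be rewritten on it.\<close>

lemma ot_weaken:
  assumes "ot I f T" "J \<subseteq> I" "pb J B" "\<And>x. x \<in> J \<Longrightarrow> f' x = f x"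
    "\<And>x. x \<in> J \<Longrightarrow> T x \<le> B x * T' x"
  shows "ot J f' T'"
proof -
  obtain P A where A: "pb I A" "impl P 0 f I (\<lambda>x. A x * T x)" "pb I (\<lambda>x. sz (f x))"
    using assms(1) unfolding ot_def by blast
  show ?thesis
  proof (rule otI)
    show "pb J (\<lambda>x. A x * B x)" by (intro pb_mult pb_subset[OF A(1)] assms)
    show "pb J (\<lambda>x. sz (f' x))" by (rule pb_mono[OF pb_subset[OF A(3)]]) (use assms in auto)
    show "P \<noteq> []" using A by (auto simp: impl_def)
    fix x assume x: "x \<in> J"
    show "evb P [enc x] (P ! 0) (enc (f' x)) (A x * B x * T' x)"
      by (rule evb_mono[OF implD[OF A(2)]])
        (use assms x in \<open>auto simp: mult.assoc\<close>)
  qed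
qed

lemma ot_subset: "ot I f T \<Longrightarrow> J \<subseteq> I \<Longrightarrow> ot J f T"
  by (rule ot_weaken[OF _ _ pb_const[of _ 1]]) auto

text \<open>The order of the quantifiers breaks a circularity: the head \<open>H\<close> contains
  calls to the linked code, so the entry index \<open>i\<close> and the block \<open>R\<close> must
  be known from the length of \<open>H\<close> alone, before \<open>H\<close> is written
  down.\<close>

lemma ot_link1:
  assumes "ot I f T"
  obtains A where "pb I A"
    "\<And>m. \<exists>i R. \<forall>H B. length H = m \<longrightarrow> impl (H @ R @ B) i f I (\<lambda>x. A x * T x)"
proof -
  obtain P A where A: "pb I A" "impl P 0 f I (\<lambda>x. A x * T x)"
    using assms unfolding ot_def by blast
  show ?thesis
    by (rule that[OF A(1)]) (use impl_shift[OF A(2)] in metis)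
qed

lemma ot_link2:
  assumes "ot I f T" "ot I' f' T'"
  obtains A A' where "pb I A" "pb I' A'"
    "\<And>m. \<exists>i i' R. \<forall>H B. length H = m \<longrightarrow> impl (H @ R @ B) i f I (\<lambda>x. A x * T x)
       \<and> impl (H @ R @ B) i' f' I' (\<lambda>x. A' x * T' x)"
proof -
  obtain A where A: "pb I A"
    "\<And>m. \<exists>i R. \<forall>H B. length H = m \<longrightarrow> impl (H @ R @ B) i f I (\<lambda>x. A x * T x)"
    using ot_link1[OF assms(1)] by blast
  obtain A' where A': "pb I' A'"
    "\<And>m. \<exists>i R. \<forall>H B. length H = m \<longrightarrow> impl (H @ R @ B) i f' I' (\<lambda>x. A' x * T' x)"
    using ot_link1[OF assms(2)] by blast
  show ?thesis
  proof (rule that[OF A(1) A'(1)])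
    fix m
    obtain i R where R: "\<forall>H B. length H = m \<longrightarrow> impl (H @ R @ B) i f I (\<lambda>x. A x * T x)"
      using A(2) by blast
    obtain i' R' where R': "\<forall>H B. length H = m + length R \<longrightarrow>
        impl (H @ R' @ B) i' f' I' (\<lambda>x. A' x * T' x)"
      using A'(2) by blast
    show "\<exists>i i' R. \<forall>H B. length H = m \<longrightarrow> impl (H @ R @ B) i f I (\<lambda>x. A x * T x)
       \<and> impl (H @ R @ B) i' f' I' (\<lambda>x. A' x * T' x)"
      by (rule exI[of _ i], rule exI[of _ i'], rule exI[of _ "R @ R'"])
        (metis R R' append_assoc length_append)
  qed
qed

lemma ot_link3:
  assumes "ot I f T" "ot I' f' T'" "ot I'' f'' T''"
  obtains A A' A'' where "pb I A" "pb I' A'" "pb I'' A''"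
    "\<And>m. \<exists>i i' i'' R. \<forall>H B. length H = m \<longrightarrow> impl (H @ R @ B) i f I (\<lambda>x. A x * T x)
       \<and> impl (H @ R @ B) i' f' I' (\<lambda>x. A' x * T' x)
       \<and> impl (H @ R @ B) i'' f'' I'' (\<lambda>x. A'' x * T'' x)"
proof -
  obtain A A' where A: "pb I A" "pb I' A'"
    "\<And>m. \<exists>i i' R. \<forall>H B. length H = m \<longrightarrow> impl (H @ R @ B) i f I (\<lambda>x. A x * T x)
       \<and> impl (H @ R @ B) i' f' I' (\<lambda>x. A' x * T' x)"
    using ot_link2[OF assms(1,2)] by blast
  obtain A'' where A'': "pb I'' A''"
    "\<And>m. \<exists>i R. \<forall>H B. length H = m \<longrightarrow> impl (H @ R @ B) i f'' I'' (\<lambda>x. A'' x * T'' x)"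
    using ot_link1[OF assms(3)] by blast
  show ?thesis
  proof (rule that[OF A(1,2) A''(1)])
    fix m
    obtain i i' R where R: "\<forall>H B. length H = m \<longrightarrow> impl (H @ R @ B) i f I (\<lambda>x. A x * T x)
       \<and> impl (H @ R @ B) i' f' I' (\<lambda>x. A' x * T' x)"
      using A(3) by blast
    obtain i'' R' where R': "\<forall>H B. length H = m + length R \<longrightarrow>
        impl (H @ R' @ B) i'' f'' I'' (\<lambda>x. A'' x * T'' x)"
      using A''(2) by blast
    show "\<exists>i i' i'' R. \<forall>H B. length H = m \<longrightarrow> impl (H @ R @ B) i f I (\<lambda>x. A x * T x)
       \<and> impl (H @ R @ B) i' f' I' (\<lambda>x. A' x * T' x)
       \<and> impl (H @ R @ B) i'' f'' I'' (\<lambda>x. A'' x * T'' x)"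
      by (rule exI[of _ i], rule exI[of _ i'], rule exI[of _ i''], rule exI[of _ "R @ R'"])
        (metis R R' append_assoc length_append)
  qed
qed

lemma ot_comp:
  assumes f: "ot J f Tf" and g: "ot I g Tg" and dom: "\<And>x. x \<in> I \<Longrightarrow> g x \<in> J"
  shows "ot I (\<lambda>x. f (g x)) (\<lambda>x. Tf (g x) + Tg x)"
proof -
  obtain A B where pb: "pb J A" "pb I B"
    and "\<And>m. \<exists>i i' R. \<forall>H S. length H = m \<longrightarrow> impl (H @ R @ S) i f J (\<lambda>x. A x * Tf x)
       \<and> impl (H @ R @ S) i' g I (\<lambda>x. B x * Tg x)"
    using ot_link2[OF f g] by blast
  then obtain i j R where R: "\<forall>H S. length H = 1 \<longrightarrow> impl (H @ R @ S) i f J (\<lambda>x. A x * Tf x)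
       \<and> impl (H @ R @ S) j g I (\<lambda>x. B x * Tg x)"
    by blast
  define Q where "Q = [Call i [Call j [Var 0]]] @ R @ []"
  have i: "impl Q i f J (\<lambda>x. A x * Tf x)" "impl Q j g I (\<lambda>x. B x * Tg x)"
    using R unfolding Q_def by (metis One_nat_def length_Cons list.size(3))+
  have [simp]: "Q ! 0 = Call i [Call j [Var 0]]"
    by (simp add: Q_def)
  have pbA: "pb I (\<lambda>x. A (g x))"
    by (rule pb_comp[OF pb(1) ot_size[OF g] dom])
  show ?thesis
  proof (rule otI)
    show "pb I (\<lambda>x. A (g x) + B x + 3)"
      by (intro pb_add pb_const pbA pb)
    show "pb I (\<lambda>x. sz (f (g x)))"
      by (rule pb_comp[OF ot_size[OF f] ot_size[OF g] dom])
    show "Q \<noteq> []" by (simp add: Q_def)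
    fix x assume x: "x \<in> I"

    \<comment> \<open>The factor 3 times a positive time pays for the call and variable nodes of the
      driver.\<close>
    have "0 < Tg x" using ot_pos[OF g x] .
    then show "evb Q [enc x] (Q ! 0) (enc (f (g x))) ((A (g x) + B x + 3) * (Tf (g x) + Tg x))"
      apply simp
      apply (rule evb_mono)
        apply (rule evb_Call1[OF impl_lessD[OF i(1)] evb_Call1[OF impl_lessD[OF i(2)] evb_Var]])
          apply simp
         apply simp
         apply (rule implD[OF i(2) x])
        apply (rule implD[OF i(1) dom[OF x]])
       apply (auto simp: algebra_simps)
      done
  qed
qed

lemma ot_pair:
  assumes f: "ot I f Tf" and g: "ot I g Tg"
    and enc: "\<And>a b. enc (c a b) = Dot (enc a) (enc b)"
  shows "ot I (\<lambda>x. c (f x) (g x)) (\<lambda>x. Tf x + Tg x)"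
proof -
  obtain A B where pb: "pb I A" "pb I B"
    and "\<And>m. \<exists>i i' R. \<forall>H S. length H = m \<longrightarrow> impl (H @ R @ S) i f I (\<lambda>x. A x * Tf x)
       \<and> impl (H @ R @ S) i' g I (\<lambda>x. B x * Tg x)"
    using ot_link2[OF f g] by blast
  then obtain i j R where R: "\<forall>H S. length H = 1 \<longrightarrow> impl (H @ R @ S) i f I (\<lambda>x. A x * Tf x)
       \<and> impl (H @ R @ S) j g I (\<lambda>x. B x * Tg x)"
    by blast
  define Q where "Q = [EDot (Call i [Var 0]) (Call j [Var 0])] @ R @ []"
  have i: "impl Q i f I (\<lambda>x. A x * Tf x)" "impl Q j g I (\<lambda>x. B x * Tg x)"
    using R unfolding Q_def by (metis One_nat_def length_Cons list.size(3))+
  have [simp]: "Q ! 0 = EDot (Call i [Var 0]) (Call j [Var 0])"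
    by (simp add: Q_def)
  show ?thesis
  proof (rule otI)
    show "pb I (\<lambda>x. A x + B x + 5)"
      by (intro pb_add pb_const pb)
    have "pb I (\<lambda>x. sz (f x) + sz (g x) + 1)"
      by (intro pb_add pb_const ot_size[OF f] ot_size[OF g])
    then show "pb I (\<lambda>x. sz (c (f x) (g x)))"
      by (rule pb_mono) (simp add: sz_def enc)
    show "Q \<noteq> []" by (simp add: Q_def)
    fix x assume x: "x \<in> I"
    have "0 < Tg x" using ot_pos[OF g x] .
    then show "evb Q [enc x] (Q ! 0) (enc (c (f x) (g x))) ((A x + B x + 5) * (Tf x + Tg x))"
      apply simp
      apply (rule evb_mono)
        apply (rule evb_EDot[OF evb_Call1[OF impl_lessD[OF i(1)] evb_Var] evb_Call1[OF impl_lessD[OF i(2)] evb_Var]])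
           apply simp
          apply simp
          apply (rule implD[OF i(1) x])
         apply simp
        apply simp
        apply (rule implD[OF i(2) x])
       apply (auto simp: algebra_simps enc)
      done
  qed
qed

section \<open>Encodings of the basic data types\<close>

instantiation bool :: enc
begin

definition "enc (b :: bool) = bool_sexp b"

instance by standard (simp add: enc_bool_def bool_sexp_def)

end

text \<open>
  Numbers are encoded in unary, so the size \<open>sz n\<close> of a number is \<open>n\<close>. Only the inputs \<open>r\<close> and \<open>k\<close>
  come in binary.
\<close>

instantiation nat :: enc
begin

fun enc_nat :: "nat \<Rightarrow> sexp" where
  "enc_nat 0 = Null"
| "enc_nat (Suc n) = Dot Null (enc_nat n)"

instance
proof
  show "enc x = enc y \<longleftrightarrow> x = y" for x y :: nat
  proof (induction x arbitrary: y)
    case 0 show ?case by (cases y) auto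
  next
    case (Suc x) then show ?case by (cases y) auto
  qed
qed

end

instantiation list :: (enc) enc
begin

fun enc_list :: "'a list \<Rightarrow> sexp" where
  "enc_list [] = Null"
| "enc_list (x # xs) = Dot (enc x) (enc_list xs)"

instance
proof
  show "enc x = enc y \<longleftrightarrow> x = y" for x y :: "'a list"
  proof (induction x arbitrary: y)
    case Nil show ?case by (cases y) auto
  next
    case (Cons a x) then show ?case by (cases y) (auto simp: enc_inject)
  qed
qed

end

instantiation prod :: (enc, enc) enc
begin

fun enc_prod :: "'a \<times> 'b \<Rightarrow> sexp" where
  "enc_prod (a, b) = Dot (enc a) (enc b)"

instance by standard (auto simp: enc_inject)

end

lemma enc_list_conv: "enc xs = list_sexp (map enc xs)"
  by (induction xs) (auto simp: list_sexp_def)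

lemma sz_simps [simp]:
  "sz (n :: nat) = n"
  "sz ([] :: 'a :: enc list) = 0"
  "sz (x # xs) = sz x + sz xs + 1"
  "sz (a, b) = sz a + sz b + 1"
  by (auto simp: sz_def) (induction n; simp)

lemma sz_bool: "sz (b :: bool) \<le> 1"
  by (simp add: sz_def enc_bool_def bool_sexp_def)

lemma enc_eq_Null [simp]:
  "enc (b :: bool) = Null \<longleftrightarrow> \<not> b"
  "enc (n :: nat) = Null \<longleftrightarrow> n = 0"
  "enc (xs :: 'a :: enc list) = Null \<longleftrightarrow> xs = []"
  by (auto simp: enc_bool_def bool_sexp_def) (cases n; cases xs; simp)+

lemma sz_fst: "sz (fst p) \<le> sz p" and sz_snd: "sz (snd p) \<le> sz p"
  by (cases p; simp)+

lemma sz_mem: "x \<in> set xs \<Longrightarrow> sz x < sz xs"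
  by (induction xs) auto

lemma length_le_sz: "length xs \<le> sz xs"
  by (induction xs) auto

lemma sz_list_le: "(\<And>x. x \<in> set xs \<Longrightarrow> sz x \<le> b) \<Longrightarrow> sz xs \<le> length xs * (b + 1)"
  by (induction xs) (auto simp: algebra_simps add_mono)

text \<open>Each branch has to be correct, and is charged, only on the inputs that take it. This
  admits partial functions as branches and a branch that is expensive only when taken.\<close>

lemma ot_if:
  assumes c: "ot I c Tc" and f: "ot {x \<in> I. c x} f Tf" and g: "ot {x \<in> I. \<not> c x} g Tg"
  shows "ot I (\<lambda>x. if c x then f x else g x) (\<lambda>x. Tc x + (if c x then Tf x else Tg x))"
proof -
  let ?J = "{x \<in> I. c x}" and ?K = "{x \<in> I. \<not> c x}"
  obtain C A B where pb: "pb I C" "pb ?J A" "pb ?K B"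
    and "\<And>m. \<exists>i i' i'' R. \<forall>H S. length H = m \<longrightarrow> impl (H @ R @ S) i c I (\<lambda>x. C x * Tc x)
       \<and> impl (H @ R @ S) i' f ?J (\<lambda>x. A x * Tf x) \<and> impl (H @ R @ S) i'' g ?K (\<lambda>x. B x * Tg x)"
    using ot_link3[OF c f g] by blast
  then obtain h i j R where R: "\<forall>H S. length H = 1 \<longrightarrow> impl (H @ R @ S) h c I (\<lambda>x. C x * Tc x)
       \<and> impl (H @ R @ S) i f ?J (\<lambda>x. A x * Tf x) \<and> impl (H @ R @ S) j g ?K (\<lambda>x. B x * Tg x)"
    by blast
  define e where "e = If (Call h [Var 0]) (Call i [Var 0]) (Call j [Var 0])"
  define Q where "Q = [e] @ R @ []"
  have "length [e] = 1" by simp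
  then have i: "impl Q h c I (\<lambda>x. C x * Tc x)" "impl Q i f ?J (\<lambda>x. A x * Tf x)" "impl Q j g ?K (\<lambda>x. B x * Tg x)"
    using R unfolding Q_def by blast+
  have [simp]: "Q ! 0 = e"
    by (simp add: Q_def)
  have pbif: "pb I (\<lambda>x. if c x then a x else b x)" if ab: "pb ?J a" "pb ?K b" for a b
  proof -
    obtain d1 where d1: "\<forall>x\<in>?J. a x \<le> (sz x + 2) ^ d1" using ab unfolding pb_def by blast
    obtain d2 where d2: "\<forall>x\<in>?K. b x \<le> (sz x + 2) ^ d2" using ab unfolding pb_def by blast
    have "(if c x then a x else b x) \<le> (sz x + 2) ^ (max d1 d2)" if "x \<in> I" for x
    proof -
      have "(sz x + 2) ^ d1 \<le> (sz x + 2) ^ (max d1 d2)" "(sz x + 2) ^ d2 \<le> (sz x + 2) ^ (max d1 d2)"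
        by (auto intro!: power_increasing)
      then show ?thesis using d1 d2 that by (auto intro: le_trans)
    qed
    then show ?thesis unfolding pb_def by blast
  qed
  show ?thesis
  proof (rule otI)
    show "pb I (\<lambda>x. C x + (if c x then A x else B x) + 5)"
      by (intro pb_add pb_const pb pbif)
    show "pb I (\<lambda>x. sz (if c x then f x else g x))"
      using pbif[OF ot_size[OF f] ot_size[OF g]] by (simp add: if_distrib)
    show "Q \<noteq> []" by (simp add: Q_def)
    fix x assume x: "x \<in> I"
    have Tc: "0 < Tc x" using ot_pos[OF c x] .
    have num: "C x * Tc x + a * t + 5 \<le> (C x + a + 5) * (Tc x + t)" for a t
      using Tc by (simp add: algebra_simps)
    show "evb Q [enc x] (Q ! 0) (enc (if c x then f x else g x))
        ((C x + (if c x then A x else B x) + 5) * (Tc x + (if c x then Tf x else Tg x)))"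
    proof (cases "c x")
      case True
      then show ?thesis
        apply (simp add: e_def)
        apply (rule evb_mono)
          apply (rule evb_If_Dot[OF evb_Call1[OF impl_lessD[OF i(1)] evb_Var] _ evb_Call1[OF impl_lessD[OF i(2)] evb_Var]])
               apply simp
              apply simp
              apply (rule implD[OF i(1) x])
             apply simp
            apply simp
           apply simp
           apply (rule implD[OF i(2)])
           apply (simp add: x)
          apply simp
         apply (rule order_trans[OF _ num])
        apply simp
        done
    next
      case False
      have "enc (c x) = Null" using False by simp
      then have c0: "evb Q [enc x] (Q ! h) Null (C x * Tc x)"
        using implD[OF i(1) x] by (simp only:)
      have g: "evb Q [enc x] (Q ! j) (enc (g x)) (B x * Tg x)"
        by (rule implD[OF i(3)]) (use False x in simp)
      have "evb Q [enc x] e (enc (g x)) (1 + C x * Tc x + 1 + (1 + B x * Tg x + 1) + 1)"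
        unfolding e_def
        by (rule evb_If_Null[OF evb_Call1[OF impl_lessD[OF i(1)] evb_Var] evb_Call1[OF impl_lessD[OF i(3)] evb_Var]])
          (simp_all add: c0 g)
      then show ?thesis
        using False by (auto elim!: evb_mono intro: order_trans[OF _ num])
    qed
  qed
qed

text \<open>The time adds up the costs at the accumulators that actually occur, so cheap rounds are
  charged as cheap. The bound \<open>b\<close> on the accumulators is indispensable: a polynomial
  step function could otherwise square the size in every round.\<close>

lemma ot_foldr:
  assumes l: "ot I l Tl" and z: "ot I z Tz"
    and h: "ot J (\<lambda>p. h (fst p) (fst (snd p)) (snd (snd p))) Th"
    and dom: "\<And>x i. x \<in> I \<Longrightarrow> i < length (l x) \<Longrightarrow>
        (x, l x ! i, foldr (h x) (drop (Suc i) (l x)) (z x)) \<in> J"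
    and bound: "pb I b" "\<And>x i. x \<in> I \<Longrightarrow> i \<le> length (l x) \<Longrightarrow>
        sz (foldr (h x) (drop i (l x)) (z x)) \<le> b x"
  shows "ot I (\<lambda>x. foldr (h x) (l x) (z x)) (\<lambda>x. Tl x + Tz x +
    (\<Sum>i<length (l x). Th (x, l x ! i, foldr (h x) (drop (Suc i) (l x)) (z x))))"
proof -
  let ?h = "\<lambda>p. h (fst p) (fst (snd p)) (snd (snd p))"
  obtain L Z A where pb: "pb I L" "pb I Z" "pb J A"
    and "\<And>m. \<exists>i i' i'' R. \<forall>H S. length H = m \<longrightarrow> impl (H @ R @ S) i l I (\<lambda>x. L x * Tl x)
       \<and> impl (H @ R @ S) i' z I (\<lambda>x. Z x * Tz x) \<and> impl (H @ R @ S) i'' ?h J (\<lambda>x. A x * Th x)"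
    using ot_link3[OF l z h] by blast
  then obtain il iz ih R where R: "\<forall>H S. length H = 2 \<longrightarrow> impl (H @ R @ S) il l I (\<lambda>x. L x * Tl x)
       \<and> impl (H @ R @ S) iz z I (\<lambda>x. Z x * Tz x) \<and> impl (H @ R @ S) ih ?h J (\<lambda>x. A x * Th x)"
    by blast
  define e where "e = Call 1 [Call il [Var 0], Var 0]"
  define r where "r = If (Var 0)
     (Call ih [EDot (Var 1) (EDot (EFst (Var 0)) (Call 1 [ESnd (Var 0), Var 1]))])
     (Call iz [Var 1])"
  define Q where "Q = [e, r] @ R @ []"
  have "length [e, r] = 2" by simp
  then have i: "impl Q il l I (\<lambda>x. L x * Tl x)" "impl Q iz z I (\<lambda>x. Z x * Tz x)"
      "impl Q ih ?h J (\<lambda>x. A x * Th x)"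
    using R unfolding Q_def by blast+
  have Q [simp]: "Q ! 0 = e" "Q ! 1 = r" "Q ! Suc 0 = r" "Suc 0 < length Q"
    by (simp_all add: Q_def)
  obtain d where d: "\<And>p. p \<in> J \<Longrightarrow> A p \<le> (sz p + 2) ^ d"
    using pb(3) unfolding pb_def by blast
  define B where "B = (\<lambda>x. (sz x + sz (l x) + b x + 4) ^ d)"
  have pbB: "pb I B"
    unfolding B_def by (intro pb_power pb_add pb_const pb_sz bound ot_size[OF l])
  let ?s = "\<lambda>x i. foldr (h x) (drop i (l x)) (z x)"
  let ?T = "\<lambda>x i. Th (x, l x ! i, ?s x (Suc i))"
  \<comment> \<open>The hidden factor of a round is taken at the triple passed to it; the bounds on
    list elements and accumulators make one \<open>B x\<close> valid for all rounds.\<close>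
  have B: "A (x, l x ! i, ?s x (Suc i)) \<le> B x" if "x \<in> I" "i < length (l x)" for x i
  proof -
    have "sz (l x ! i) \<le> sz (l x)" using that sz_mem[of "l x ! i" "l x"] by simp
    moreover have "sz (?s x (Suc i)) \<le> b x" using that bound(2) by simp
    ultimately have "sz (x, l x ! i, ?s x (Suc i)) + 2 \<le> sz x + sz (l x) + b x + 4"
      by simp
    then show ?thesis
      unfolding B_def by (auto intro!: order_trans[OF d[OF dom[OF that]]] power_mono)
  qed
  \<comment> \<open>\<open>r\<close> receives the remaining suffix and the fixed \<open>x\<close>.
    The summands 4 and 20 pay for the nodes of its two branches.\<close>
  have rec: "evb Q [enc (drop i (l x)), enc x] r (enc (?s x i))
      ((Z x * Tz x + 4) + (\<Sum>j=i..<length (l x). B x * ?T x j + 20))"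
    if x: "x \<in> I" and le: "i \<le> length (l x)" for x i
    using le
  proof (induction "length (l x) - i" arbitrary: i)
    case 0
    then have [simp]: "i = length (l x)" by simp
    show ?case
      unfolding r_def
      apply (rule evb_mono)
        apply (rule evb_If_Null)
         apply (rule evb_mono[OF evb_Var _ le_refl])
          apply simp
         apply simp
        apply (rule evb_Call1[OF impl_lessD[OF i(2)] evb_Var])
         apply simp
        apply simp
        apply (rule implD[OF i(2) x])
       apply auto
      done
  next
    case (Suc k)
    then have il: "i < length (l x)" by simp
    have dr: "drop i (l x) = l x ! i # drop (Suc i) (l x)"
      using il by (simp add: Cons_nth_drop_Suc)
    have IH: "evb Q [enc (drop (Suc i) (l x)), enc x] r (enc (?s x (Suc i)))
      ((Z x * Tz x + 4) + (\<Sum>j=Suc i..<length (l x). B x * ?T x j + 20))"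
      by (rule Suc.hyps) (use Suc in auto)
    have sum: "(\<Sum>j=i..<length (l x). B x * ?T x j + 20)
        = (B x * ?T x i + 20) + (\<Sum>j=Suc i..<length (l x). B x * ?T x j + 20)"
      using il by (simp add: sum.atLeast_Suc_lessThan)
    let ?p = "(x, l x ! i, ?s x (Suc i))"
    have hp: "evb Q [enc ?p] (Q ! ih) (enc (?s x i)) (B x * ?T x i)"
      by (rule evb_mono[OF implD[OF i(3) dom[OF x il]]])
        (use B[OF x il] in \<open>auto simp: dr\<close>)
    have hp': "evb Q [Dot (enc x) (Dot (enc (l x ! i)) (enc (?s x (Suc i))))] (Q ! ih)
        (enc (?s x i)) (B x * ?T x i)"
      using hp by simp
    show ?case
      apply (subst r_def)
      apply (rule evb_mono)
        apply (rule evb_If_Dot[OF evb_Var])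
          apply simp
         apply (simp add: dr)
        apply (rule evb_Call1[OF impl_lessD[OF i(3)]])
         apply (rule evb_EDot[OF evb_Var evb_EDot[OF evb_EFst[OF evb_Var] evb_Call2[OF _ evb_ESnd[OF evb_Var] evb_Var]]])
             apply simp
            apply simp
           apply simp
          apply simp
         apply simp
        apply (simp add: dr del: foldr.simps)
        apply (rule IH)
       apply (simp add: dr del: foldr.simps)
       apply (rule hp')
      apply simp
      apply (simp add: sum)
      done
  qed
  show ?thesis
  proof (rule otI)
    show "pb I (\<lambda>x. L x + Z x + B x + 20 * sz (l x) + 20)"
      by (intro pb_add pb_mult pb_const pb pbB ot_size[OF l])
    show "pb I (\<lambda>x. sz (foldr (h x) (l x) (z x)))"
      by (rule pb_mono[OF bound(1)]) (use bound(2)[of _ 0] in auto)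
    show "Q \<noteq> []" by (simp add: Q_def)
    fix x assume x: "x \<in> I"
    have Tp: "0 < Tz x" "0 < Tl x" using ot_pos[OF z x] ot_pos[OF l x] by auto
    let ?S = "\<Sum>i<length (l x). ?T x i"
    have "(\<Sum>j=0..<length (l x). B x * ?T x j + 20) = B x * ?S + 20 * length (l x)"
      by (simp add: sum.distrib sum_distrib_left atLeast0LessThan)
    also have "\<dots> \<le> B x * ?S + 20 * sz (l x)"
      by (simp add: length_le_sz)
    finally have "L x * Tl x + (Z x * Tz x + 4 + (\<Sum>j=0..<length (l x). B x * ?T x j + 20)) + 4
        \<le> L x * Tl x + Z x * Tz x + (B x * ?S + 20 * sz (l x)) + 8"
      by linarith
    also have "\<dots> \<le> (L x + Z x + B x + 20 * sz (l x) + 20) * (Tl x + Tz x + ?S)"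
    proof -
      obtain a b where "Tz x = Suc a" "Tl x = Suc b"
        using Tp by (metis gr0_implies_Suc)
      then show ?thesis by (simp add: algebra_simps)
    qed
    finally have le: "L x * Tl x + (Z x * Tz x + 4 + (\<Sum>j=0..<length (l x). B x * ?T x j + 20)) + 4
        \<le> (L x + Z x + B x + 20 * sz (l x) + 20) * (Tl x + Tz x + ?S)" .
    have l: "evb Q [enc x] (Call il [Var 0]) (enc (l x)) (1 + L x * Tl x + 1)"
      by (rule evb_Call1[OF impl_lessD[OF i(1)] evb_Var]) (use implD[OF i(1) x] in simp_all)
    have r: "evb Q [enc (l x), enc x] r (enc (foldr (h x) (l x) (z x)))
        (Z x * Tz x + 4 + (\<Sum>j=0..<length (l x). B x * ?T x j + 20))"
      using rec[OF x, of 0] by (simp only: drop_0 le0 simp_thms)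
    have "evb Q [enc x] e (enc (foldr (h x) (l x) (z x))) ((1 + L x * Tl x + 1) + 1 +
        (Z x * Tz x + 4 + (\<Sum>j=0..<length (l x). B x * ?T x j + 20)) + 1)"
      unfolding e_def by (rule evb_Call2[OF _ l evb_Var]) (simp_all only: r nth_Cons_0 One_nat_def Q length_Cons zero_less_Suc)
    then show "evb Q [enc x] (Q ! 0) (enc (foldr (h x) (l x) (z x)))
        ((L x + Z x + B x + 20 * sz (l x) + 20) * (Tl x + Tz x + ?S))"
      unfolding Q by (rule evb_mono[OF _ refl]) (rule order_trans[OF _ le], simp)
  qed
qed

subsection \<open>Polynomial time functions\<close>

lemma ptI:
  assumes "\<And>x. evb (e # P) [enc x] e (enc (f x)) (A x)" "pb UNIV A" "pb UNIV (\<lambda>x. sz (f x))"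
  shows "pt f"
  by (rule otI[where P = "e # P"]) (use assms in simp_all)

lemma pt_lift:
  assumes "pt f" "pt g"
  shows "pt (\<lambda>x. f (g x))"
  by (rule ot_weaken[OF ot_comp[OF assms] _ pb_const[of _ 2]]) auto

lemma pt_id: "pt (\<lambda>x. x)"
proof (rule ptI)
  show "evb [Var 0] [enc x] (Var 0) (enc x) 1" for x :: 'a
    using evb_Var[of 0 "[enc x]"] by simp
qed (rule pb_const pb_sz)+

lemma pt_const: "pt (\<lambda>x. c)"
  by (rule ptI[OF evb_quote_expr pb_const pb_const])

lemma pt_pair: "pt f \<Longrightarrow> pt g \<Longrightarrow> pt (\<lambda>x. (f x, g x))"
  by (rule ot_weaken[OF ot_pair[where c = Pair] _ pb_const[of _ 2]]) auto

lemma pt_Cons: "pt f \<Longrightarrow> pt g \<Longrightarrow> pt (\<lambda>x. f x # g x)"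
  by (rule ot_weaken[OF ot_pair[where c = Cons] _ pb_const[of _ 2]]) auto

lemma pt_lift2:
  assumes "pt (\<lambda>p. f (fst p) (snd p))" "pt g" "pt h"
  shows "pt (\<lambda>x. f (g x) (h x))"
  using pt_lift[OF assms(1) pt_pair[OF assms(2,3)]] by simp

lemma pt_fst:
  fixes f :: "'a :: enc \<Rightarrow> 'b :: enc \<times> 'c :: enc"
  assumes "pt f"
  shows "pt (\<lambda>x. fst (f x))"
proof -
  have "evb [EFst (Var 0)] [enc x] (EFst (Var 0)) (enc (fst x)) 2" for x :: "'b \<times> 'c"
    by (rule evb_mono[OF evb_EFst[OF evb_Var]]) (cases x; simp)+
  then have 0: "pt (fst :: 'b \<times> 'c \<Rightarrow> 'b)"
    by (rule ptI) (auto intro: pb_const pb_mono[OF pb_sz] sz_fst)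
  show ?thesis by (rule pt_lift[OF 0 assms])
qed

lemma pt_snd:
  fixes f :: "'a :: enc \<Rightarrow> 'b :: enc \<times> 'c :: enc"
  assumes "pt f"
  shows "pt (\<lambda>x. snd (f x))"
proof -
  have "evb [ESnd (Var 0)] [enc x] (ESnd (Var 0)) (enc (snd x)) 2" for x :: "'b \<times> 'c"
    by (rule evb_mono[OF evb_ESnd[OF evb_Var]]) (cases x; simp)+
  then have 0: "pt (snd :: 'b \<times> 'c \<Rightarrow> 'c)"
    by (rule ptI) (auto intro: pb_const pb_mono[OF pb_sz] sz_snd)
  show ?thesis by (rule pt_lift[OF 0 assms])
qed

lemma pt_if:
  assumes "pt c" "pt f" "pt g"
  shows "pt (\<lambda>x. if c x then f x else g x)"
  by (rule ot_weaken[OF ot_if[OF assms(1) ot_subset[OF assms(2)] ot_subset[OF assms(3)]] _ pb_const[of _ 2]])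
    auto

lemma pt_not: "pt f \<Longrightarrow> pt (\<lambda>x. \<not> f x)"
  by (rule ot_weaken[OF pt_if[OF _ pt_const[of False] pt_const[of True]] _ pb_const[of _ 1]]) auto

lemma pt_conj:
  assumes "pt f" "pt g"
  shows "pt (\<lambda>x. f x \<and> g x)"
  by (rule ot_weaken[OF pt_if[OF assms pt_const[of False]] _ pb_const[of _ 1]]) auto

lemma pt_disj:
  assumes "pt f" "pt g"
  shows "pt (\<lambda>x. f x \<or> g x)"
  by (rule ot_weaken[OF pt_if[OF assms(1) pt_const[of True] assms(2)] _ pb_const[of _ 1]]) auto

lemma pt_Suc:
  assumes "pt f"
  shows "pt (\<lambda>x. Suc (f x))"
proof -
  have "evb [EDot ENull (Var 0)] [enc n] (EDot ENull (Var 0)) (enc (Suc n)) 3" for n :: nat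
    by (rule evb_mono[OF evb_EDot[OF evb_ENull evb_Var]]) simp_all
  then have 0: "pt Suc"
    by (rule ptI[OF _ pb_const]) (use pb_add[OF pb_sz[where 'a = nat] pb_const[of UNIV 1]] in simp)
  show ?thesis by (rule pt_lift[OF 0 assms])
qed

lemma pt_pred:
  assumes "pt f"
  shows "pt (\<lambda>x. f x - Suc 0)"
proof -
  have "evb [ESnd (Var 0)] [enc n] (ESnd (Var 0)) (enc (n - Suc 0)) 2" for n :: nat
    by (rule evb_mono[OF evb_ESnd[OF evb_Var]]) (cases n; simp)+
  then have 0: "pt (\<lambda>n. n - Suc 0)"
    by (rule ptI) (auto intro: pb_const pb_mono[OF pb_sz])
  show ?thesis by (rule pt_lift[OF 0 assms])
qed

lemma pt_tl:
  assumes "pt f"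
  shows "pt (\<lambda>x. tl (f x))"
proof -
  have "evb [ESnd (Var 0)] [enc n] (ESnd (Var 0)) (enc (tl n)) 2" for n :: "'b list"
    by (rule evb_mono[OF evb_ESnd[OF evb_Var]]) (cases n; simp)+
  moreover have "sz (tl xs) \<le> sz xs" for xs :: "'b list" by (cases xs) auto
  ultimately have 0: "pt (tl :: 'b list \<Rightarrow> _)"
    by - (rule ptI; auto intro: pb_const pb_mono[OF pb_sz])
  show ?thesis by (rule pt_lift[OF 0 assms])
qed

lemma pt_null:
  assumes "pt f"
  shows "pt (\<lambda>x. f x = [])"
proof -
  define e where "e = If (Var 0) ENull (EDot ENull ENull)"
  have "evb [e] [enc xs] e (enc (xs = [])) 10" for xs :: "'b list"
  proof (cases "xs = []")
    case True
    show ?thesis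
      unfolding e_def using True
      by (intro evb_mono[OF evb_If_Null[OF evb_mono[OF evb_Var _ le_refl] evb_EDot[OF evb_ENull evb_ENull]]])
        (auto simp: enc_bool_def bool_sexp_def)
  next
    case False
    show ?thesis
      unfolding e_def using False
      by (intro evb_mono[OF evb_If_Dot[OF evb_Var _ evb_ENull]]) (auto simp: enc_bool_def bool_sexp_def)
  qed
  then have 0: "pt (\<lambda>xs :: 'b list. xs = [])"
    by (rule ptI) (auto intro: pb_const pb_mono[OF pb_const sz_bool])
  show ?thesis by (rule pt_lift[OF 0 assms])
qed

text \<open>The value of \<open>hd []\<close> is unspecified, so no program can be shown to compute
  it; the default makes the function total.\<close>

definition hdd :: "'a \<Rightarrow> 'a list \<Rightarrow> 'a" where
  "hdd d xs = (if xs = [] then d else hd xs)"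

lemma pt_hdd:
  assumes "pt d" "pt f"
  shows "pt (\<lambda>x. hdd (d x) (f x))"
proof -
  have sz_hd: "xs \<noteq> [] \<Longrightarrow> sz (hd xs) \<le> sz xs" for xs :: "'b list"
    by (cases xs) auto
  have "evb [EFst (Var 0)] [enc xs] (EFst (Var 0)) (enc (hd xs)) 2" if "xs \<noteq> []" for xs :: "'b list"
    by (rule evb_mono[OF evb_EFst[OF evb_Var]]) (use that in \<open>cases xs; simp\<close>)+
  then have 0: "ot {xs. xs \<noteq> []} (hd :: 'b list \<Rightarrow> _) (\<lambda>_. 1)"
    by (intro otI[where P = "[EFst (Var 0)]" and A = "\<lambda>_. 2"] pb_const pb_mono[OF pb_sz sz_hd]) auto
  have 1: "ot {x. f x \<noteq> []} (\<lambda>x. hd (f x)) (\<lambda>_. 1)"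
    by (rule ot_weaken[OF ot_comp[OF 0 ot_subset[OF assms(2), where J = "{x. f x \<noteq> []}"]] _ pb_const[of _ 2]]) auto
  have "ot UNIV (\<lambda>x. if f x = [] then d x else hd (f x)) (\<lambda>x. 1 + (if f x = [] then 1 else 1))"
    by (rule ot_if[OF pt_null[OF assms(2)]]) (use 1 ot_subset[OF assms(1)] in simp_all)
  then have "pt (\<lambda>x. if f x = [] then d x else hd (f x))"
    by (rule ot_weaken[OF _ _ pb_const[of _ 2]]) auto
  then show ?thesis by (simp add: hdd_def)
qed

text \<open>The model has no comparison of trees, so two trees are compared by simultaneous descent.
  It stops as soon as either of them ends, hence the bound depends on \<open>a\<close> only.\<close>

lemma evb_eq:
  assumes "P = [e, r]"
    and r: "r = If (Var 0) (If (Var 1) (If (Call 1 [EFst (Var 0), EFst (Var 1)])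
      (Call 1 [ESnd (Var 0), ESnd (Var 1)]) ENull) ENull) (If (Var 1) ENull (EDot ENull ENull))"
  shows "evb P [a, b] r (bool_sexp (a = b)) (40 * size a + 10)"
proof (induction a arbitrary: b)
  case Null
  show ?case
  proof (cases b)
    case [simp]: Null
    show ?thesis
      unfolding r by (rule evb_mono[OF evb_If_Null[OF evb_mono[OF evb_Var _ le_refl]
            evb_If_Null[OF evb_mono[OF evb_Var _ le_refl] evb_EDot[OF evb_ENull evb_ENull]]]])
        (auto simp: bool_sexp_def)
  next
    case [simp]: (Dot b1 b2)
    show ?thesis
      unfolding r by (rule evb_mono[OF evb_If_Null[OF evb_mono[OF evb_Var _ le_refl]
            evb_If_Dot[OF evb_mono[OF evb_Var _ le_refl] _ evb_ENull]]])
        (auto simp: bool_sexp_def)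
  qed
next
  case (Dot a1 a2)
  let ?\<rho> = "[Dot a1 a2, b]"
  have v0: "evb P ?\<rho> (Var 0) (Dot a1 a2) 1" and v1: "evb P ?\<rho> (Var 1) b 1"
    using evb_Var[of 0 ?\<rho> P] evb_Var[of 1 ?\<rho> P] by simp_all
  show ?case
  proof (cases b)
    case b [simp]: Null
    have v1: "evb P ?\<rho> (Var 1) Null 1" using v1 by simp
    show ?thesis
      unfolding r by (rule evb_mono[OF evb_If_Dot[OF v0 _ evb_If_Null[OF v1 evb_ENull]]])
        (auto simp: bool_sexp_def)
  next
    case b: (Dot b1 b2)
    have P: "Suc 0 < length P" "P ! Suc 0 = r" by (auto simp: assms(1))
    have c1: "evb P ?\<rho> (Call 1 [EFst (Var 0), EFst (Var 1)]) (bool_sexp (a1 = b1))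
        (2 + 2 + (40 * size a1 + 10) + 1)"
    proof -
      have "evb P [sfst (Dot a1 a2), sfst b] (P ! 1) (bool_sexp (a1 = b1)) (40 * size a1 + 10)"
        using Dot(1)[of b1] by (simp add: P b)
      from evb_Call2[OF _ evb_EFst[OF v0] evb_EFst[OF v1] this] show ?thesis
        using P(1) by simp
    qed
    have c2: "evb P ?\<rho> (Call 1 [ESnd (Var 0), ESnd (Var 1)]) (bool_sexp (a2 = b2))
        (2 + 2 + (40 * size a2 + 10) + 1)"
    proof -
      have "evb P [ssnd (Dot a1 a2), ssnd b] (P ! 1) (bool_sexp (a2 = b2)) (40 * size a2 + 10)"
        using Dot(2)[of b2] by (simp add: P b)
      from evb_Call2[OF _ evb_ESnd[OF v0] evb_ESnd[OF v1] this] show ?thesis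
        using P(1) by simp
    qed
    show ?thesis
    proof (cases "a1 = b1")
      case True
      have c1': "evb P ?\<rho> (Call 1 [EFst (Var 0), EFst (Var 1)]) (Dot Null Null)
        (2 + 2 + (40 * size a1 + 10) + 1)"
        using c1 True by (simp add: bool_sexp_def)
      show ?thesis
        apply (subst r)
        apply (rule evb_mono[OF evb_If_Dot[OF v0 _ evb_If_Dot[OF v1 _ evb_If_Dot[OF c1' _ c2]]]])
        using True b by (auto simp: bool_sexp_def)
    next
      case False
      have c1': "evb P ?\<rho> (Call 1 [EFst (Var 0), EFst (Var 1)]) Null
        (2 + 2 + (40 * size a1 + 10) + 1)"
        using c1 False by (simp add: bool_sexp_def)
      show ?thesis
        apply (subst r)
        apply (rule evb_mono[OF evb_If_Dot[OF v0 _ evb_If_Dot[OF v1 _ evb_If_Null[OF c1' evb_ENull]]]])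
        using False b by (auto simp: bool_sexp_def)
    qed
  qed
qed

lemma pt_eq:
  assumes "pt f" "pt g"
  shows "pt (\<lambda>x. f x = g x)"
proof -
  define r where "r = If (Var 0) (If (Var 1) (If (Call 1 [EFst (Var 0), EFst (Var 1)])
      (Call 1 [ESnd (Var 0), ESnd (Var 1)]) ENull) ENull) (If (Var 1) ENull (EDot ENull ENull))"
  define e where "e = Call 1 [EFst (Var 0), ESnd (Var 0)]"
  have "evb [e, r] [enc p] e (enc (fst p = snd p)) (40 * sz p + 16)" for p :: "'b \<times> 'b"
  proof -
    obtain a b where p: "p = (a, b)" by (cases p)
    have v: "evb [e, r] [enc p] (Var 0) (Dot (enc a) (enc b)) 1"
      using evb_Var[of 0 "[enc p]" "[e, r]"] by (simp add: p)
    have "evb [e, r] [enc a, enc b] r (enc (a = b)) (40 * sz a + 10)"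
      using evb_eq[OF refl r_def, of e "enc a" "enc b"] by (simp add: enc_bool_def enc_inject sz_def)
    then have "evb [e, r] [sfst (Dot (enc a) (enc b)), ssnd (Dot (enc a) (enc b))] ([e, r] ! 1) (enc (a = b)) (40 * sz a + 10)"
      by simp
    from evb_Call2[OF _ evb_EFst[OF v] evb_ESnd[OF v] this]
    have "evb [e, r] [enc p] e (enc (a = b)) (2 + 2 + (40 * sz a + 10) + 1)"
      by (simp add: e_def)
    then show ?thesis by (rule evb_mono) (auto simp: p)
  qed
  then have "pt (\<lambda>p. fst p = (snd p :: 'b))"
    by (rule ptI) (intro pb_add pb_mult pb_const pb_sz, rule pb_mono[OF pb_const sz_bool])
  from pt_lift2[OF this assms] show ?thesis .
qed

declare One_nat_def [simp del]

lemma sz_append: "sz (xs @ ys) = sz xs + sz ys"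
  by (induction xs) auto

lemma sz_drop: "sz (drop i xs) \<le> sz xs"
  using sz_append[of "take i xs" "drop i xs"] by simp

lemma pt_foldr:
  assumes l: "pt l" and h: "pt (\<lambda>p. h (fst p) (fst (snd p)) (snd (snd p)))" and z: "pt z"
    and bound: "pb UNIV b" "\<And>x i. sz (foldr (h x) (drop i (l x)) (z x)) \<le> b x"
  shows "pt (\<lambda>x. foldr (h x) (l x) (z x))"
  by (rule ot_weaken[OF ot_foldr[OF l z h _ bound] _ pb_add[OF pb_const[of _ 2] ot_size[OF l]]])
    (auto simp: length_le_sz)

lemma pb_sz_elem:
  assumes f: "pt (\<lambda>p. f (fst p) (snd p))" and l: "pt l"
  obtains b where "pb UNIV b" "\<And>x y. y \<in> set (l x) \<Longrightarrow> sz (f x y) \<le> b x"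
proof -
  obtain d where d: "\<And>p. sz (f (fst p) (snd p)) \<le> (sz p + 2) ^ d"
    using ot_size[OF f] unfolding pb_def by blast
  have "sz (f x y) \<le> (sz x + sz (l x) + 3) ^ d" if "y \<in> set (l x)" for x y
  proof -
    have "sz (f x y) \<le> (sz (x, y) + 2) ^ d" using d[of "(x, y)"] by simp
    also have "\<dots> \<le> (sz x + sz (l x) + 3) ^ d"
      using sz_mem[OF that] by (intro power_mono) auto
    finally show ?thesis .
  qed
  moreover have "pb UNIV (\<lambda>x. (sz x + sz (l x) + 3) ^ d)"
    by (intro pb_power pb_add pb_sz pb_const ot_size[OF l])
  ultimately show ?thesis using that by blast
qed

lemma pt_map:
  assumes l: "pt l" and f: "pt (\<lambda>p. f (fst p) (snd p))"
  shows "pt (\<lambda>x. map (f x) (l x))"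
proof -
  obtain b where b: "pb UNIV b" "\<And>x y. y \<in> set (l x) \<Longrightarrow> sz (f x y) \<le> b x"
    using pb_sz_elem[OF f l] by blast
  have map: "foldr (\<lambda>y s. f x y # s) ys [] = map (f x) ys" for x ys
    by (induction ys) auto
  have "sz (map (f x) (drop i (l x))) \<le> sz (l x) * (b x + 1)" for x i
  proof -
    have "sz (map (f x) (drop i (l x))) \<le> length (map (f x) (drop i (l x))) * (b x + 1)"
      by (rule sz_list_le) (use b(2) in_set_dropD in fastforce)
    also have "\<dots> \<le> sz (l x) * (b x + 1)"
      using length_le_sz[of "l x"] by (intro mult_le_mono) auto
    finally show ?thesis .
  qed
  moreover have "pb UNIV (\<lambda>x. sz (l x) * (b x + 1))"
    by (intro pb_mult pb_add pb_const b ot_size[OF l])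
  moreover have "pt (\<lambda>p. f (fst p) (fst (snd p)) # snd (snd p))"
    by (intro pt_Cons pt_lift2[OF f] pt_fst pt_snd pt_id)
  ultimately have "pt (\<lambda>x. foldr (\<lambda>y s. f x y # s) (l x) [])"
    by (intro pt_foldr[OF l _ pt_const]) (auto simp: map)
  then show ?thesis by (simp add: map)
qed

lemma pt_filter:
  assumes l: "pt l" and f: "pt (\<lambda>p. f (fst p) (snd p))"
  shows "pt (\<lambda>x. filter (f x) (l x))"
proof -
  have filter: "foldr (\<lambda>y s. if f x y then y # s else s) ys [] = filter (f x) ys" for x ys
    by (induction ys) auto
  have "sz (filter (f x) ys) \<le> sz ys" for x ys
    by (induction ys) auto
  then have "sz (filter (f x) (drop i (l x))) \<le> sz (l x)" for x i
    using sz_drop le_trans by blast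
  moreover have "pt (\<lambda>p. if f (fst p) (fst (snd p)) then fst (snd p) # snd (snd p) else snd (snd p))"
    by (intro pt_if pt_Cons pt_lift2[OF f] pt_fst pt_snd pt_id)
  ultimately have "pt (\<lambda>x. foldr (\<lambda>y s. if f x y then y # s else s) (l x) [])"
    by (intro pt_foldr[OF l _ pt_const ot_size[OF l]]) (auto simp: filter)
  then show ?thesis by (simp add: filter)
qed

lemma pt_list_ex:
  assumes l: "pt l" and f: "pt (\<lambda>p. f (fst p) (snd p))"
  shows "pt (\<lambda>x. list_ex (f x) (l x))"
proof -
  have "pt (\<lambda>x. \<not> filter (f x) (l x) = [])"
    by (intro pt_not pt_null pt_filter assms)
  then show ?thesis by (simp add: list_ex_iff filter_empty_conv)
qed

lemma pt_list_all:
  assumes l: "pt l" and f: "pt (\<lambda>p. f (fst p) (snd p))"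
  shows "pt (\<lambda>x. list_all (f x) (l x))"
proof -
  have "pt (\<lambda>x. \<not> list_ex (\<lambda>y. \<not> f x y) (l x))"
    by (intro pt_not pt_list_ex assms)
  then show ?thesis by (simp add: list_ex_iff list_all_iff)
qed

lemma pt_append:
  assumes f: "pt f" and g: "pt g"
  shows "pt (\<lambda>x. f x @ g x)"
proof -
  have app: "foldr (\<lambda>y s. y # s) xs ys = xs @ ys" for xs ys :: "'b list"
    by (induction xs) auto
  have "pt (\<lambda>x. foldr (\<lambda>y s. y # s) (f x) (g x))"
    by (rule pt_foldr[OF f _ g pb_add[OF ot_size[OF f] ot_size[OF g]]])
      (auto simp: app sz_append sz_drop intro!: pt_Cons pt_fst pt_snd pt_id)
  then show ?thesis by (simp add: app)
qed

lemma pt_concat: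
  assumes f: "pt f"
  shows "pt (\<lambda>x. concat (f x))"
proof -
  have con: "foldr (\<lambda>y s. y @ s) xss [] = concat xss" for xss :: "'b list list"
    by (induction xss) auto
  have "sz (concat xss) \<le> sz xss" for xss :: "'b list list"
    by (induction xss) (auto simp: sz_append)
  then have "sz (concat (drop i (f x))) \<le> sz (f x)" for i x
    using sz_drop le_trans by blast
  then have "pt (\<lambda>x. foldr (\<lambda>y s. y @ s) (f x) [])"
    by (intro pt_foldr[OF f _ pt_const ot_size[OF f]])
      (auto simp: con intro!: pt_append pt_fst pt_snd pt_id)
  then show ?thesis by (simp add: con)
qed

lemma pt_length:
  assumes f: "pt f"
  shows "pt (\<lambda>x. length (f x))"
proof -
  have len: "foldr (\<lambda>y s. Suc s) xs 0 = length xs" for xs :: "'b list"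
    by (induction xs) auto
  have "pt (\<lambda>x. foldr (\<lambda>y s. Suc s) (f x) 0)"
    by (rule pt_foldr[OF f _ pt_const ot_size[OF f]])
      (auto simp: len intro!: pt_Suc pt_snd pt_id intro: le_trans[OF _ length_le_sz] le_diff_conv)
  then show ?thesis by (simp add: len)
qed

text \<open>A unary number and the list of that many zeros are the same tree, so the identity
  converts a number into a list over which \<open>foldr\<close> can iterate.\<close>

lemma pt_replicate_0:
  assumes f: "pt f"
  shows "pt (\<lambda>x. replicate (f x) (0 :: nat))"
proof -
  have enc: "enc (replicate n (0 :: nat)) = enc n" for n
    by (induction n) auto
  have sz: "sz (replicate n (0 :: nat)) = n" for n
    by (induction n) auto
  have 0: "pt (\<lambda>n. replicate n (0 :: nat))"
  proof (rule ptI)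
    show "evb [Var 0] [enc n] (Var 0) (enc (replicate n (0 :: nat))) 1" for n :: nat
      using evb_Var[of 0 "[enc n]"] by (simp add: enc)
    show "pb UNIV (\<lambda>n. sz (replicate n (0 :: nat)))"
      by (rule pb_mono[OF pb_sz]) (simp add: sz)
  qed (rule pb_const)
  show ?thesis by (rule pt_lift[OF 0 f])
qed

lemma pt_add:
  assumes f: "pt f" and g: "pt g"
  shows "pt (\<lambda>x. f x + (g x :: nat))"
proof -
  have add: "foldr (\<lambda>_. Suc) xs n = length xs + n" for xs :: "nat list" and n
    by (induction xs) auto
  have "pt (\<lambda>x. foldr (\<lambda>_. Suc) (replicate (f x) (0 :: nat)) (g x))"
    by (rule pt_foldr[OF pt_replicate_0[OF f] _ g pb_add[OF ot_size[OF f] ot_size[OF g]]])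
      (auto simp: add intro!: pt_Suc pt_snd pt_id)
  then show ?thesis by (simp add: add)
qed

lemma pt_diff:
  assumes f: "pt f" and g: "pt g"
  shows "pt (\<lambda>x. f x - (g x :: nat))"
proof -
  have diff: "foldr (\<lambda>_ s. s - Suc 0) xs n = n - length xs" for xs :: "nat list" and n
    by (induction xs) auto
  have "pt (\<lambda>x. foldr (\<lambda>_ s. s - Suc 0) (replicate (g x) (0 :: nat)) (f x))"
    by (rule pt_foldr[OF pt_replicate_0[OF g] _ f ot_size[OF f]])
      (auto simp: diff simp del: foldr_replicate intro!: pt_pred pt_snd pt_id)
  then show ?thesis by (simp add: diff del: foldr_replicate)
qed

lemma pt_le: "pt f \<Longrightarrow> pt g \<Longrightarrow> pt (\<lambda>x. f x \<le> (g x :: nat))"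
  using pt_eq[OF pt_diff pt_const[of 0], of f g] by simp

lemma pt_less: "pt f \<Longrightarrow> pt g \<Longrightarrow> pt (\<lambda>x. f x < (g x :: nat))"
  using pt_not[OF pt_le, of g f] by (simp add: not_le)

lemma pt_min: "pt f \<Longrightarrow> pt g \<Longrightarrow> pt (\<lambda>x. min (f x) (g x :: nat))"
  unfolding min_def by (intro pt_if pt_le)

lemma pt_drop:
  assumes f: "pt f" and g: "pt g"
  shows "pt (\<lambda>x. drop (f x) (g x))"
proof -
  have dr: "foldr (\<lambda>_. tl) xs ys = drop (length xs) ys" for xs :: "nat list" and ys :: "'b list"
    by (induction xs) (auto simp: drop_Suc tl_drop)
  have "pt (\<lambda>x. foldr (\<lambda>_. tl) (replicate (f x) (0 :: nat)) (g x))"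
    by (rule pt_foldr[OF pt_replicate_0[OF f] _ g ot_size[OF g]])
      (auto simp: dr sz_drop simp del: foldr_replicate intro!: pt_tl pt_snd pt_id)
  then show ?thesis by (simp add: dr del: foldr_replicate)
qed

lemma pt_nth_default:
  assumes "pt d" "pt f" "pt g"
  shows "pt (\<lambda>x. nth_default (d x) (f x) (g x))"
proof -
  have "nth_default c xs i = hdd c (drop i xs)" for c :: 'b and xs i
    by (auto simp: hdd_def nth_default_def hd_drop_conv_nth)
  then show ?thesis
    using pt_hdd[OF assms(1) pt_drop[OF assms(3,2)]] by simp
qed

lemma pt_upt:
  assumes f: "pt f"
  shows "pt (\<lambda>x. [0..<f x])"
proof -
  \<comment> \<open>The counter list carries no positions, so each round shifts the list built so
    far and prepends 0.\<close>
  have upt: "foldr (\<lambda>_ s. 0 # map Suc s) xs [] = [0..<length xs]" for xs :: "nat list"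
    by (induction xs) (auto simp: map_Suc_upt upt_conv_Cons simp del: upt_Suc)
  have "sz [0..<n] \<le> n * (n + 1)" for n
    using sz_list_le[of "[0..<n]" n] by auto
  then have "sz [0..<n - i] \<le> n * (n + 1)" for n i
    by (rule le_trans) (intro mult_le_mono; simp)
  moreover have "pb UNIV (\<lambda>x. f x * (f x + 1))"
    using ot_size[OF f] by (intro pb_mult pb_add pb_const) auto
  ultimately have "pt (\<lambda>x. foldr (\<lambda>_ s. 0 # map Suc s) (replicate (f x) (0 :: nat)) [])"
    by (intro pt_foldr[OF pt_replicate_0[OF f] _ pt_const])
      (auto simp: upt simp del: foldr_replicate intro!: pt_Cons pt_map pt_Suc pt_const pt_snd pt_id)
  then show ?thesis by (simp add: upt del: foldr_replicate)
qed

declare One_nat_def [simp]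

lemmas pt_intros = pt_const pt_id pt_pair pt_Cons pt_if pt_not pt_conj pt_disj pt_fst pt_snd
  pt_eq pt_Suc pt_pred pt_tl pt_hdd pt_map pt_filter pt_list_ex pt_list_all pt_append pt_concat
  pt_length pt_add pt_diff pt_le pt_less pt_min pt_nth_default pt_upt

subsection \<open>Exhaustive search with a set of visited states\<close>

text \<open>
  A set of trees is stored in a binary tree used as a trie. The key of a tree is its preorder
  traversal, generalised to stacks of trees.
\<close>

function code :: "sexp list \<Rightarrow> bool list" where
  "code [] = []"
| "code (Null # s) = False # code s"
| "code (Dot a b # s) = True # code (a # b # s)"
  by pat_completeness auto
termination
  by (relation "measure (\<lambda>s. sum_list (map (\<lambda>x. 2 * size x + 1) s))") auto

text \<open>Branches that were never created need no test, because the components of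
  \<open>Null\<close> are again \<open>Null\<close>.\<close>

fun tget :: "sexp \<Rightarrow> bool list \<Rightarrow> sexp" where
  "tget T [] = T"
| "tget T (b # p) = tget (if b then ssnd T else sfst T) p"

fun tput :: "sexp \<Rightarrow> bool list \<Rightarrow> sexp" where
  "tput T [] = Dot Null Null"
| "tput T (b # p) = (if b then Dot (sfst T) (tput (ssnd T) p) else Dot (tput (sfst T) p) (ssnd T))"

text \<open>Preorder traversals of equally many trees parse uniquely. Hence no key ends inside
  another one, and overwriting the end of a path in the trie destroys no other entry.\<close>

lemma code_prefix_free: "code s @ r = code s' @ r' \<Longrightarrow> length s = length s' \<Longrightarrow> s = s'"
proof (induction s arbitrary: s' rule: code.induct)
  case 1
  then show ?case by simp
next
  case (2 s)
  then obtain x u where "s' = x # u" by (cases s') auto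
  with 2 show ?case by (cases x) auto
next
  case (3 a b s)
  then obtain x u where s': "s' = x # u" by (cases s') auto
  with 3 obtain a' b' where x: "x = Dot a' b'" by (cases x) auto
  have "a # b # s = a' # b' # u"
    by (rule "3.IH") (use 3 s' x in auto)
  then show ?case using s' x by simp
qed

lemma length_code: "length (code s) = sum_list (map (\<lambda>x. 2 * size x + 1) s)"
  by (induction s rule: code.induct) auto

lemma tget_Null: "tget Null p = Null"
  by (induction p) auto

lemma tget_tput_same: "tget (tput T p) p = Dot Null Null"
  by (induction p arbitrary: T) auto

lemma tget_tput_other:
  "(\<And>r. q \<noteq> p @ r) \<Longrightarrow> (\<And>r. p \<noteq> q @ r) \<Longrightarrow> tget (tput T p) q = tget T q"
proof (induction p arbitrary: T q)
  case (Cons b p)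
  then obtain c q' where [simp]: "q = c # q'" by (cases q) auto
  show ?case
  proof (cases "b = c")
    case True
    then have "tget (tput S p) q' = tget S q'" for S
      using Cons.prems by (intro Cons.IH) auto
    then show ?thesis using True by auto
  qed auto
qed auto

lemma tget_tput: "tget (tput T (code [x])) (code [y]) \<noteq> Null \<longleftrightarrow> x = y \<or> tget T (code [y]) \<noteq> Null"
proof (cases "x = y")
  case False
  then have "code [y] \<noteq> code [x] @ r" "code [x] \<noteq> code [y] @ r" for r
    using code_prefix_free[of "[y]" "[]" "[x]" r] code_prefix_free[of "[x]" "[]" "[y]" r] by auto
  then show ?thesis using False by (simp add: tget_tput_other)
qed (simp add: tget_tput_same)

text \<open>The key is never built: the second argument is the stack of trees, and every call
  performs one unfolding of \<open>code\<close> on it. The positions 2, 3 and 4 for lookup,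
  insertion and append are those in the program of \<open>ot_search\<close>.\<close>

definition get_body :: expr where
  "get_body = If (Var 1)
     (If (EFst (Var 1))
       (Call 2 [ESnd (Var 0), EDot (EFst (EFst (Var 1))) (EDot (ESnd (EFst (Var 1))) (ESnd (Var 1)))])
       (Call 2 [EFst (Var 0), ESnd (Var 1)]))
     (Var 0)"

definition put_body :: expr where
  "put_body = If (Var 1)
     (If (EFst (Var 1))
       (EDot (EFst (Var 0))
         (Call 3 [ESnd (Var 0), EDot (EFst (EFst (Var 1))) (EDot (ESnd (EFst (Var 1))) (ESnd (Var 1)))]))
       (EDot (Call 3 [EFst (Var 0), ESnd (Var 1)]) (ESnd (Var 0))))
     (EDot ENull ENull)"

definition app_body :: expr where
  "app_body = If (Var 0) (EDot (EFst (Var 0)) (Call 4 [ESnd (Var 0), Var 1])) (Var 1)"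

lemma evb_Var0: "evb P (x # \<rho>) (Var 0) x 1" and evb_Var1: "evb P (x # y # \<rho>) (Var 1) y 1"
  and evb_Var2: "evb P (x # y # z # \<rho>) (Var 2) z 1"
  using evb_Var[of 0 "x # \<rho>"] evb_Var[of 1 "x # y # \<rho>"] evb_Var[of 2 "x # y # z # \<rho>"] by simp_all

lemma evb_get_body:
  assumes P: "2 < length P" "P ! 2 = get_body"
  shows "evb P [T, list_sexp s] get_body (tget T (code s)) (30 * length (code s) + 10)"
proof (induction s arbitrary: T rule: code.induct)
  case 1
  show ?case
    unfolding get_body_def list_sexp_def
    by (rule evb_mono[OF evb_If_Null[OF _ evb_Var0]]) (use evb_Var1 in auto)
next
  case (2 s)
  have v1: "evb P [T, Dot Null (list_sexp s)] (Var 1) (Dot Null (list_sexp s)) 1"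
    by (rule evb_Var1)
  have IH: "evb P [sfst T, ssnd (Dot Null (list_sexp s))] (P ! 2) (tget (sfst T) (code s)) (30 * length (code s) + 10)"
    using 2 P by simp
  have n: "evb P [T, Dot Null (list_sexp s)] (EFst (Var 1)) Null 2"
    by (rule evb_mono[OF evb_EFst[OF v1]]) auto
  have l: "list_sexp (Null # s) = Dot Null (list_sexp s)" by (simp add: list_sexp_def)
  show ?case
    apply (subst get_body_def)
    apply (subst l)
    apply (rule evb_mono[OF evb_If_Dot[OF v1 _ evb_If_Null[OF n
              evb_Call2[OF P(1) evb_EFst[OF evb_Var0] evb_ESnd[OF v1] IH]]]])
      apply auto
    done
next
  case (3 a b s)
  let ?x = "Dot (Dot a b) (list_sexp s)"
  have v1: "evb P [T, ?x] (Var 1) ?x 1"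
    by (rule evb_Var1)
  have l: "list_sexp (Dot a b # s) = ?x" "list_sexp (a # b # s) = Dot a (Dot b (list_sexp s))"
    by (simp_all add: list_sexp_def)
  have IH: "evb P [ssnd T, Dot (sfst (sfst ?x)) (Dot (ssnd (sfst ?x)) (ssnd ?x))] (P ! 2)
      (tget (ssnd T) (code (a # b # s))) (30 * length (code (a # b # s)) + 10)"
    using 3 P l by simp
  show ?case
    apply (subst get_body_def)
    apply (subst l)
    apply (rule evb_mono[OF evb_If_Dot[OF v1 _ evb_If_Dot[OF evb_EFst[OF v1] _
              evb_Call2[OF P(1) evb_ESnd[OF evb_Var0]
                evb_EDot[OF evb_EFst[OF evb_EFst[OF v1]] evb_EDot[OF evb_ESnd[OF evb_EFst[OF v1]] evb_ESnd[OF v1]]] IH]]]])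
       apply auto
    done
qed

lemma evb_put_body:
  assumes P: "3 < length P" "P ! 3 = put_body"
  shows "evb P [T, list_sexp s] put_body (tput T (code s)) (30 * length (code s) + 10)"
proof (induction s arbitrary: T rule: code.induct)
  case 1
  show ?case
    unfolding put_body_def list_sexp_def
    by (rule evb_mono[OF evb_If_Null[OF _ evb_EDot[OF evb_ENull evb_ENull]]]) (use evb_Var1 in auto)
next
  case (2 s)
  have v1: "evb P [T, Dot Null (list_sexp s)] (Var 1) (Dot Null (list_sexp s)) 1"
    by (rule evb_Var1)
  have IH: "evb P [sfst T, ssnd (Dot Null (list_sexp s))] (P ! 3) (tput (sfst T) (code s)) (30 * length (code s) + 10)"
    using 2 P by simp
  have n: "evb P [T, Dot Null (list_sexp s)] (EFst (Var 1)) Null 2"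
    by (rule evb_mono[OF evb_EFst[OF v1]]) auto
  have l: "list_sexp (Null # s) = Dot Null (list_sexp s)" by (simp add: list_sexp_def)
  show ?case
    apply (subst put_body_def)
    apply (subst l)
    apply (rule evb_mono[OF evb_If_Dot[OF v1 _ evb_If_Null[OF n
              evb_EDot[OF evb_Call2[OF P(1) evb_EFst[OF evb_Var0] evb_ESnd[OF v1] IH] evb_ESnd[OF evb_Var0]]]]])
      apply auto
    done
next
  case (3 a b s)
  let ?x = "Dot (Dot a b) (list_sexp s)"
  have v1: "evb P [T, ?x] (Var 1) ?x 1"
    by (rule evb_Var1)
  have l: "list_sexp (Dot a b # s) = ?x" "list_sexp (a # b # s) = Dot a (Dot b (list_sexp s))"
    by (simp_all add: list_sexp_def)
  have IH: "evb P [ssnd T, Dot (sfst (sfst ?x)) (Dot (ssnd (sfst ?x)) (ssnd ?x))] (P ! 3)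
      (tput (ssnd T) (code (a # b # s))) (30 * length (code (a # b # s)) + 10)"
    using 3 P l by simp
  show ?case
    apply (subst put_body_def)
    apply (subst l)
    apply (rule evb_mono[OF evb_If_Dot[OF v1 _ evb_If_Dot[OF evb_EFst[OF v1] _
              evb_EDot[OF evb_EFst[OF evb_Var0] evb_Call2[OF P(1) evb_ESnd[OF evb_Var0]
                evb_EDot[OF evb_EFst[OF evb_EFst[OF v1]] evb_EDot[OF evb_ESnd[OF evb_EFst[OF v1]] evb_ESnd[OF v1]]] IH]]]]])
       apply auto
    done
qed

lemma evb_app_body:
  assumes P: "4 < length P" "P ! 4 = app_body"
  shows "evb P [enc xs, enc ys] app_body (enc (xs @ ys)) (20 * length xs + 10)"
proof (induction xs)
  case Nil
  show ?case
    unfolding app_body_def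
    by (rule evb_mono[OF evb_If_Null[OF _ evb_Var1]]) (use evb_Var0 in auto)
next
  case (Cons x xs)
  have v0: "evb P [enc (x # xs), enc ys] (Var 0) (Dot (enc x) (enc xs)) 1"
    using evb_Var0[of P "enc (x # xs)"] by simp
  have IH: "evb P [ssnd (Dot (enc x) (enc xs)), enc ys] (P ! 4) (enc (xs @ ys)) (20 * length xs + 10)"
    using Cons P by simp
  show ?case
    apply (subst app_body_def)
    apply (rule evb_mono[OF evb_If_Dot[OF v0 _
              evb_EDot[OF evb_EFst[OF v0] evb_Call2[OF P(1) evb_ESnd[OF v0] evb_Var1 IH]]]])
      apply auto
    done
qed

definition reach :: "('s \<Rightarrow> 's list) \<Rightarrow> 's \<Rightarrow> 's \<Rightarrow> bool" where
  "reach succ = (\<lambda>s s'. s' \<in> set (succ s))\<^sup>*\<^sup>*"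

text \<open>The list plays the role of an option. Which accepting state is returned depends on the
  order of exploration, hence a relation instead of a function.\<close>

definition search_result :: "('s \<Rightarrow> 's list) \<Rightarrow> ('s \<Rightarrow> bool) \<Rightarrow> 's \<Rightarrow> 's list \<Rightarrow> bool" where
  "search_result succ fin s0 res \<longleftrightarrow>
     res = [] \<and> (\<forall>s. reach succ s0 s \<longrightarrow> \<not> fin s) \<or> (\<exists>s. res = [s] \<and> reach succ s0 s \<and> fin s)"

text \<open>The variables are the worklist, the trie of visited states and the context
  \<open>e\<close>. The worklist may contain duplicates; a state is tested against the trie only
  when it is taken out.\<close>

definition loop_body :: "nat \<Rightarrow> nat \<Rightarrow> expr" where
  "loop_body js jf = If (Var 0)
     (If (Call 2 [Var 1, EDot (EFst (Var 0)) ENull])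
       (Call 1 [ESnd (Var 0), Var 1, Var 2])
       (If (Call jf [EDot (Var 2) (EFst (Var 0))])
         (EDot (EFst (Var 0)) ENull)
         (Call 1 [Call 4 [Call js [EDot (Var 2) (EFst (Var 0))], ESnd (Var 0)],
            Call 3 [Var 1, EDot (EFst (Var 0)) ENull], Var 2])))
     ENull"

lemma pb_pair:
  assumes "pb UNIV g" "pb I b"
  obtains c where "pb I c" "\<And>x y. x \<in> I \<Longrightarrow> sz y \<le> b x \<Longrightarrow> g (x, y) \<le> c x"
proof -
  obtain d where d: "\<And>p. g p \<le> (sz p + 2) ^ d"
    using assms unfolding pb_def by blast
  have "g (x, y) \<le> (sz x + b x + 3) ^ d" if "sz y \<le> b x" for x y
  proof -
    have "(sz (x, y) + 2) ^ d \<le> (sz x + b x + 3) ^ d"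
      using that by (intro power_mono) auto
    then show ?thesis using d[of "(x, y)"] by simp
  qed
  moreover have "pb I (\<lambda>x. (sz x + b x + 3) ^ d)"
    by (intro pb_power pb_add pb_const pb_sz assms)
  ultimately show ?thesis using that by blast
qed

text \<open>The measure \<open>length W + card (R - Z) * (B + 1)\<close> bounds the remaining
  rounds: a visited state on the worklist costs one, and a new state leaves \<open>R - Z\<close>,
  which pays for its at most \<open>B\<close> successors. \<open>Z\<close> is the set stored in the
  trie \<open>V\<close>; its successors lie in \<open>Z\<close> or on the worklist, and none of its
  members is accepting.\<close>

lemma evb_loop_body:
  fixes succ :: "'s :: enc \<Rightarrow> 's list" and e :: "'e :: enc"
  assumes P: "4 < length P" "P ! 1 = loop_body js jf" "P ! 2 = get_body" "P ! 3 = put_body"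
      "P ! 4 = app_body" "js < length P" "jf < length P"
    and js: "\<And>s. s \<in> R \<Longrightarrow> evb P [enc (e, s)] (P ! js) (enc (succ s)) S"
    and jf: "\<And>s. s \<in> R \<Longrightarrow> evb P [enc (e, s)] (P ! jf) (enc (fin s)) F"
    and R: "finite R" "\<And>s. s \<in> R \<Longrightarrow> set (succ s) \<subseteq> R"
    and b: "\<And>s. s \<in> R \<Longrightarrow> sz s \<le> b" "\<And>s. s \<in> R \<Longrightarrow> length (succ s) \<le> B"
    and Z: "Z \<subseteq> R" "\<And>x. tget V (code [enc x]) \<noteq> Null \<longleftrightarrow> x \<in> Z"
      "\<And>s. s \<in> Z \<Longrightarrow> set (succ s) \<subseteq> Z \<union> set W \<and> \<not> fin s"
    and W: "set W \<subseteq> R" "\<And>s. s \<in> set W \<Longrightarrow> reach succ s0 s" "s0 \<in> Z \<union> set W"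
    and K: "K = 200 * b + 20 * B + F + S + 200"
  shows "\<exists>res. search_result succ fin s0 res \<and> evb P [enc W, V, enc e] (loop_body js jf) (enc res)
      ((length W + card (R - Z) * (B + 1) + 1) * K)"
  using Z W
proof (induction "length W + card (R - Z) * (B + 1)" arbitrary: W V Z rule: less_induct)
  case less
  note Z = less.prems(1-3) and W = less.prems(4-6)
  show ?case
  proof (cases W)
    case [simp]: Nil
    \<comment> \<open>With an empty worklist \<open>Z\<close> contains \<open>s0\<close> and is
      closed under successors, so nothing reachable was missed.\<close>
    have "s \<in> Z" if "reach succ s0 s" for s
      using that unfolding reach_def by induction (use Z(3) W(3) in auto)
    then have "search_result succ fin s0 []"
      using Z(3) unfolding search_result_def by blast
    moreover have "evb P [enc W, V, enc e] (loop_body js jf) (enc ([] :: 's list)) 3"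
      unfolding loop_body_def
      by (rule evb_mono[OF evb_If_Null[OF _ evb_ENull]]) (use evb_Var0 in auto)
    ultimately show ?thesis
      by (intro exI[of _ "[]"]) (auto elim!: evb_mono simp: K)
  next
    case [simp]: (Cons s W')
    let ?\<rho> = "[enc W, V, enc e]"
    have v0: "evb P ?\<rho> (Var 0) (Dot (enc s) (enc W')) 1" and v1: "evb P ?\<rho> (Var 1) V 1"
      and v2: "evb P ?\<rho> (Var 2) (enc e) 1"
      using evb_Var0[of P "enc W"] by (auto simp: evb_Var1 evb_Var2 simp del: One_nat_def)
    have s: "s \<in> R" "reach succ s0 s" using W by auto
    have sb: "size (enc s) \<le> b" using b(1)[OF s(1)] by (simp add: sz_def)
    have key: "evb P ?\<rho> (EDot (EFst (Var 0)) ENull) (list_sexp [enc s]) 4"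
      by (rule evb_mono[OF evb_EDot[OF evb_EFst[OF v0] evb_ENull]]) (auto simp: list_sexp_def)
    have get: "evb P ?\<rho> (Call 2 [Var 1, EDot (EFst (Var 0)) ENull]) (tget V (code [enc s])) (60 * b + 50)"
      by (rule evb_mono[OF evb_Call2[OF _ v1 key, of 2]])
        (use P sb evb_get_body[of P V "[enc s]"] in \<open>auto simp: length_code\<close>)
    show ?thesis
    proof (cases "s \<in> Z")
      case True
      then have nn: "tget V (code [enc s]) \<noteq> Null" using Z(2) by blast
      have "\<exists>res. search_result succ fin s0 res \<and> evb P [enc W', V, enc e] (loop_body js jf) (enc res)
          ((length W' + card (R - Z) * (B + 1) + 1) * K)"
        by (rule less.hyps) (use Z W True in auto)
      then obtain res where res: "search_result succ fin s0 res"
        "evb P [enc W', V, enc e] (loop_body js jf) (enc res) ((length W' + card (R - Z) * (B + 1) + 1) * K)"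
        by blast
      have r: "evb P [ssnd (Dot (enc s) (enc W')), V, enc e] (P ! 1) (enc res)
          ((length W' + card (R - Z) * (B + 1) + 1) * K)"
        using res(2) P by simp
      have l: "1 < length P" using P by simp
      have "evb P ?\<rho> (loop_body js jf) (enc res) ((length W + card (R - Z) * (B + 1) + 1) * K)"
        apply (subst loop_body_def)
        apply (rule evb_mono[OF evb_If_Dot[OF v0 _ evb_If_Dot[OF get nn evb_Call3[OF l evb_ESnd[OF v0] v1 v2 r]]]])
          apply simp
         apply simp
        apply (simp add: add_mult_distrib)
        apply (simp add: K)
        done
      then show ?thesis using res(1) by blast
    next
      case False
      then have n: "tget V (code [enc s]) = Null" using Z(2) by blast
      have es: "evb P ?\<rho> (EDot (Var 2) (EFst (Var 0))) (enc (e, s)) 4"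
        by (rule evb_mono[OF evb_EDot[OF v2 evb_EFst[OF v0]]]) auto
      have f: "evb P ?\<rho> (Call jf [EDot (Var 2) (EFst (Var 0))]) (enc (fin s)) (F + 5)"
        by (rule evb_mono[OF evb_Call1[OF P(7) es jf[OF s(1)]]]) auto
      show ?thesis
      proof (cases "fin s")
        case True
        then have res: "search_result succ fin s0 [s]"
          using s unfolding search_result_def by blast
        have nn: "enc (fin s) \<noteq> Null" using True by simp
        have "evb P ?\<rho> (loop_body js jf) (enc [s]) ((length W + card (R - Z) * (B + 1) + 1) * K)"
          apply (subst loop_body_def)
          apply (rule evb_mono[OF evb_If_Dot[OF v0 _ evb_If_Null[OF get[unfolded n] evb_If_Dot[OF f nn key]]]])
            apply simp
           apply (simp add: list_sexp_def)
          apply (simp add: add_mult_distrib)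
          apply (simp add: K)
          done
        then show ?thesis using res by blast
      next
        case nf: False
        have fn: "evb P ?\<rho> (Call jf [EDot (Var 2) (EFst (Var 0))]) Null (F + 5)"
          using f nf by (simp add: enc_bool_def bool_sexp_def)
        let ?V = "tput V (code [enc s])" and ?Z = "insert s Z" and ?W = "succ s @ W'"
        \<comment> \<open>Marking \<open>s\<close> as visited releases \<open>B + 1\<close> units of
          the measure, enough for its successors.\<close>
        have card: "card (R - Z) = Suc (card (R - ?Z))"
          using s(1) False R(1) by (metis Diff_insert Diff_iff card.remove finite_Diff)
        have len: "length (succ s) \<le> B" using b(2)[OF s(1)] .
        have "\<exists>res. search_result succ fin s0 res \<and> evb P [enc ?W, ?V, enc e] (loop_body js jf) (enc res)
          ((length ?W + card (R - ?Z) * (B + 1) + 1) * K)"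
        proof (rule less.hyps)
          show "length ?W + card (R - ?Z) * (B + 1) < length W + card (R - Z) * (B + 1)"
            using len by (simp add: card)
          show "tget ?V (code [enc x]) \<noteq> Null \<longleftrightarrow> x \<in> ?Z" for x
            by (simp add: tget_tput enc_inject Z(2) del: code.simps) auto
          show "reach succ s0 x" if "x \<in> set ?W" for x
            using that W(2) s(2) unfolding reach_def by (auto intro: rtranclp.rtrancl_into_rtrancl)
          show "set (succ x) \<subseteq> ?Z \<union> set ?W \<and> \<not> fin x" if "x \<in> ?Z" for x
            using that Z(3) nf by fastforce
        qed (use Z W R(2)[OF s(1)] s in auto)
        then obtain res where res: "search_result succ fin s0 res"
          "evb P [enc ?W, ?V, enc e] (loop_body js jf) (enc res)
            ((length ?W + card (R - ?Z) * (B + 1) + 1) * K)" (is "evb _ _ _ _ ?T")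
          by blast
        have sc: "evb P ?\<rho> (Call js [EDot (Var 2) (EFst (Var 0))]) (enc (succ s)) (S + 5)"
          by (rule evb_mono[OF evb_Call1[OF P(6) es js[OF s(1)]]]) auto
        have app: "evb P ?\<rho> (Call 4 [Call js [EDot (Var 2) (EFst (Var 0))], ESnd (Var 0)]) (enc ?W)
            (S + 20 * B + 20)"
          apply (rule evb_mono[OF evb_Call2[OF P(1) sc evb_ESnd[OF v0]]])
            apply (simp only: P ssnd.simps)
            apply (rule evb_app_body[OF P(1,5)])
           apply simp
          using len apply simp
          done
        have put: "evb P ?\<rho> (Call 3 [Var 1, EDot (EFst (Var 0)) ENull]) ?V (60 * b + 50)"
          by (rule evb_mono[OF evb_Call2[OF _ v1 key, of 3]])
            (use P sb evb_put_body[of P V "[enc s]"] in \<open>auto simp: length_code\<close>)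
        define T where "T = ?T"
        have r: "evb P [enc ?W, ?V, enc e] (P ! 1) (enc res) T"
          using res(2) P by (simp add: T_def)
        have l: "1 < length P" using P by simp
        have "T \<le> (length W + card (R - Z) * (B + 1)) * K"
          unfolding T_def using len by (intro mult_le_mono) (auto simp: card)
        then have T: "T + K \<le> (length W + card (R - Z) * (B + 1) + 1) * K"
          by (simp add: add_mult_distrib)
        have "evb P ?\<rho> (loop_body js jf) (enc res) ((length W + card (R - Z) * (B + 1) + 1) * K)"
          apply (subst loop_body_def)
          apply (rule evb_mono[OF evb_If_Dot[OF v0 _ evb_If_Null[OF get[unfolded n] evb_If_Null[OF fn
                    evb_Call3[OF l app put v2 r]]]]])
            apply simp
           apply simp
          apply (rule order_trans[OF _ T])
          apply (simp add: K)
          done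
        then show ?thesis using res(1) by blast
      qed
    qed
  qed
qed

text \<open>The set \<open>R e\<close> belongs to the analysis and not to the program: every finite
  set that contains the start and is closed under successors bounds the time, provided its members
  have polynomial size.\<close>

lemma ot_search:
  fixes init :: "'e :: enc \<Rightarrow> 's :: enc"
  assumes init: "pt init" and succ: "pt (\<lambda>p. succ (fst p) (snd p))" and fin: "pt (\<lambda>p. fin (fst p) (snd p))"
    and R: "\<And>e. e \<in> I \<Longrightarrow> finite (R e)" "\<And>e. e \<in> I \<Longrightarrow> init e \<in> R e"
      "\<And>e s. e \<in> I \<Longrightarrow> s \<in> R e \<Longrightarrow> set (succ e s) \<subseteq> R e"
    and b: "pb I b" "\<And>e s. e \<in> I \<Longrightarrow> s \<in> R e \<Longrightarrow> sz s \<le> b e"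
  obtains f where "ot I f (\<lambda>e. card (R e))"
    "\<And>e. e \<in> I \<Longrightarrow> search_result (succ e) (fin e) (init e) (f e)"
proof -
  let ?succ = "\<lambda>p. succ (fst p) (snd p)" and ?fin = "\<lambda>p. fin (fst p) (snd p)"
  obtain Ai As Af where A: "pb UNIV Ai" "pb UNIV As" "pb UNIV Af"
    and "\<And>m. \<exists>i i' i'' Q. \<forall>H S. length H = m \<longrightarrow> impl (H @ Q @ S) i init UNIV (\<lambda>x. Ai x * 1)
       \<and> impl (H @ Q @ S) i' ?succ UNIV (\<lambda>x. As x * 1) \<and> impl (H @ Q @ S) i'' ?fin UNIV (\<lambda>x. Af x * 1)"
    using ot_link3[OF init succ fin] by blast
  then obtain ji js jf Q where Q: "\<forall>H S. length H = 5 \<longrightarrow> impl (H @ Q @ S) ji init UNIV (\<lambda>x. Ai x * 1)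
       \<and> impl (H @ Q @ S) js ?succ UNIV (\<lambda>x. As x * 1) \<and> impl (H @ Q @ S) jf ?fin UNIV (\<lambda>x. Af x * 1)"
    by blast
  define m where "m = Call 1 [EDot (Call ji [Var 0]) ENull, ENull, Var 0]"
  define P where "P = [m, loop_body js jf, get_body, put_body, app_body] @ Q @ []"
  have "length [m, loop_body js jf, get_body, put_body, app_body] = 5" by simp
  then have j: "impl P ji init UNIV (\<lambda>x. Ai x * 1)" "impl P js ?succ UNIV (\<lambda>x. As x * 1)"
      "impl P jf ?fin UNIV (\<lambda>x. Af x * 1)"
    using Q unfolding P_def by blast+
  have P: "4 < length P" "P ! 1 = loop_body js jf" "P ! 2 = get_body" "P ! 3 = put_body"
      "P ! 4 = app_body" "P ! 0 = m"
    by (simp_all add: P_def)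
  obtain S where S: "pb I S" "\<And>e s. e \<in> I \<Longrightarrow> sz s \<le> b e \<Longrightarrow> As (e, s) \<le> S e"
    using pb_pair[OF A(2) b(1)] by blast
  obtain F where F: "pb I F" "\<And>e s. e \<in> I \<Longrightarrow> sz s \<le> b e \<Longrightarrow> Af (e, s) \<le> F e"
    using pb_pair[OF A(3) b(1)] by blast
  obtain B where B: "pb I B" "\<And>e s. e \<in> I \<Longrightarrow> sz s \<le> b e \<Longrightarrow> sz (?succ (e, s)) \<le> B e"
    using pb_pair[OF ot_size[OF succ] b(1)] by blast
  define K where "K = (\<lambda>e. 200 * b e + 20 * B e + F e + S e + 200)"
  have pbK: "pb I K"
    unfolding K_def by (intro pb_add pb_mult pb_const b B F S)
  have ex: "\<exists>res. search_result (succ e) (fin e) (init e) res \<and> evb P [enc [init e], Null, enc e]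
      (loop_body js jf) (enc res) ((length [init e] + card (R e - {}) * (B e + 1) + 1) * K e)"
    if e: "e \<in> I" for e
  proof (rule evb_loop_body[OF P(1-5)])
    show "js < length P" "jf < length P" using j by (auto simp: impl_def)
    show "evb P [enc (e, s)] (P ! js) (enc (succ e s)) (S e)" if "s \<in> R e" for s
      using evb_mono[OF implD[OF j(2)] _ ] S(2)[OF e b(2)[OF e that]] by fastforce
    show "evb P [enc (e, s)] (P ! jf) (enc (fin e s)) (F e)" if "s \<in> R e" for s
      using evb_mono[OF implD[OF j(3)] _ ] F(2)[OF e b(2)[OF e that]] by fastforce
    show "length (succ e s) \<le> B e" if "s \<in> R e" for s
      using B(2)[OF e b(2)[OF e that]] length_le_sz le_trans by fastforce
  qed (use R b e in \<open>auto simp: K_def tget_Null reach_def\<close>)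
  \<comment> \<open>The result is given operationally only. Including the evaluation in the choice
    guarantees that \<open>f\<close> names what the program really outputs.\<close>
  define f where "f = (\<lambda>e. SOME res. search_result (succ e) (fin e) (init e) res \<and>
      evb P [enc [init e], Null, enc e] (loop_body js jf) (enc res)
        ((length [init e] + card (R e - {}) * (B e + 1) + 1) * K e))"
  have f: "search_result (succ e) (fin e) (init e) (f e)"
    "evb P [enc [init e], Null, enc e] (loop_body js jf) (enc (f e))
        ((length [init e] + card (R e - {}) * (B e + 1) + 1) * K e)" if "e \<in> I" for e
    using someI_ex[OF ex[OF that]] unfolding f_def by auto
  have "ot I f (\<lambda>e. card (R e))"
  proof (rule otI)
    show "pb I (\<lambda>e. (B e + 3) * K e + Ai e + 20)"
      by (intro pb_add pb_mult pb_const pbK B pb_subset[OF A(1)]) auto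
    show "P \<noteq> []" by (simp add: P_def)
    show "pb I (\<lambda>e. sz (f e))"
    proof (rule pb_mono[OF pb_add[OF b(1) pb_const[of _ 1]]])
      fix e assume e: "e \<in> I"
      have "s \<in> R e" if "reach (succ e) (init e) s" for s
        using that unfolding reach_def by induction (use R(2,3)[OF e] in auto)
      then show "sz (f e) \<le> b e + 1"
        using f(1)[OF e] b(2)[OF e] unfolding search_result_def by auto
    qed
    fix e assume e: "e \<in> I"
    have pos: "1 \<le> card (R e)"
      using R(1,2)[OF e] by (metis One_nat_def Suc_leI card_gt_0_iff empty_iff)
    have i: "evb P [enc e] (Call ji [Var 0]) (enc (init e)) (Ai e + 2)"
      by (rule evb_mono[OF evb_Call1[OF impl_lessD[OF j(1)] evb_Var0 implD[OF j(1)]]]) auto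
    have w: "evb P [enc e] (EDot (Call ji [Var 0]) ENull) (enc [init e]) (Ai e + 4)"
      by (rule evb_mono[OF evb_EDot[OF i evb_ENull]]) auto
    have l: "1 < length P" using P by simp
    have r: "evb P [enc [init e], Null, enc e] (P ! 1) (enc (f e))
        ((length [init e] + card (R e - {}) * (B e + 1) + 1) * K e)"
      using f(2)[OF e] P by simp
    have "evb P [enc e] m (enc (f e)) ((Ai e + 4) + 1 + 1 +
        ((length [init e] + card (R e - {}) * (B e + 1) + 1) * K e) + 1)"
      unfolding m_def by (rule evb_Call3[OF l w evb_ENull evb_Var0 r])
    moreover have "(Ai e + 4) + 1 + 1 + ((length [init e] + card (R e - {}) * (B e + 1) + 1) * K e) + 1
        \<le> ((B e + 3) * K e + Ai e + 20) * card (R e)"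
    proof -
      obtain c where "card (R e) = Suc c" using pos by (metis Suc_le_D One_nat_def)
      then show ?thesis by (simp add: algebra_simps)
    qed
    ultimately show "evb P [enc e] (P ! 0) (enc (f e)) (((B e + 3) * K e + Ai e + 20) * card (R e))"
      unfolding P by (rule evb_mono[OF _ refl])
  qed
  then show ?thesis using that f(1) by blast
qed

subsection \<open>The dynamic program\<close>

definition adj :: "bool list list \<Rightarrow> nat \<Rightarrow> nat \<Rightarrow> bool" where
  "adj M u v = nth_default False (nth_default [] M u) v"

type_synonym val = "nat \<times> nat"

text \<open>
  The labels: unused and undominated, unused but dominated, in a finished unit, in the current
  unit. A label \<open>(Suc s, c)\<close> stands for the unit put aside with \<open>c\<close> vertices that contains \<open>s\<close>.
\<close>

abbreviation (input) vU :: val where "vU \<equiv> (0, 0)"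
abbreviation (input) vD :: val where "vD \<equiv> (0, 1)"
abbreviation (input) vX :: val where "vX \<equiv> (0, 2)"
abbreviation (input) vC :: val where "vC \<equiv> (0, 3)"

definition val :: "val list \<Rightarrow> nat \<Rightarrow> val" where
  "val fl v = nth_default vU fl v"

definition free :: "val list \<Rightarrow> nat \<Rightarrow> bool" where
  "free fl s \<longleftrightarrow> val fl s = vU \<or> val fl s = vD"

text \<open>Of the current unit only its start \<open>g\<close> and the vertices labelled
  \<open>vC\<close> can be consulted. Vertices outside \<open>S\<close> that came with an absorbed
  unit have no label; their neighbours were dealt with when that unit was put aside.\<close>

definition touch :: "bool list list \<Rightarrow> nat \<Rightarrow> val list \<Rightarrow> nat \<Rightarrow> bool" where
  "touch M g fl s \<longleftrightarrow> adj M g s \<or> list_ex (\<lambda>v. val fl v = vC \<and> adj M v s) [0..<length fl]"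

definition memb :: "nat \<Rightarrow> nat list \<Rightarrow> bool" where
  "memb v S \<longleftrightarrow> list_ex (\<lambda>s. s = v) S"

definition upd :: "val list \<Rightarrow> nat \<Rightarrow> val \<Rightarrow> val list" where
  "upd fl s w = map (\<lambda>v. if v = s then w else val fl v) [0..<length fl]"

definition relab :: "val list \<Rightarrow> val \<Rightarrow> val \<Rightarrow> val list" where
  "relab fl w w' = map (\<lambda>x. if x = w then w' else x) fl"

text \<open>Domination is credited already when a unit is put aside, while its start vertex is still
  known. This is no premature promise, since an accepting state has no unit put aside.\<close>

definition settle :: "bool list list \<Rightarrow> nat list \<Rightarrow> nat \<Rightarrow> val list \<Rightarrow> val \<Rightarrow> val list" where
  "settle M S g fl w = map (\<lambda>v. if val fl v = vC then w
     else if val fl v = vU \<and> memb v S \<and> touch M g fl v then vD else val fl v) [0..<length fl]"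

text \<open>Consulting \<open>h\<close> alone suffices: the unit lies in one clique, whose vertices
  share their neighbours in \<open>S\<close>.\<close>

definition settle_own :: "bool list list \<Rightarrow> nat list \<Rightarrow> nat \<Rightarrow> val list \<Rightarrow> val list" where
  "settle_own M S h fl = map (\<lambda>v. if val fl v = vU \<and> memb v S \<and> adj M h v then vD else val fl v)
     [0..<length fl]"

type_synonym mstate = "nat \<times> nat \<times> nat \<times> nat \<times> nat \<times> nat \<times> val list"

text \<open>
  In a state \<open>(i, k, c, g, q, h, fl)\<close> the first \<open>i\<close> vertices of \<open>L\<close> have been scanned and \<open>k\<close>
  units are finished. The current unit has \<open>c\<close> vertices (none if \<open>c = 0\<close>) and was started at
  \<open>g\<close>; a unit inside the present clique has \<open>q\<close> vertices so far, the first one being \<open>h\<close>.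
  No vertex outside \<open>S\<close> of a unit put aside is remembered. Therefore such a vertex never joins an
  existing unit: it starts a new one, which then absorbs units put aside.

  The moves are: skip the next vertex of \<open>L\<close>; start a unit there, or in \<open>S\<close>; add a vertex of
  \<open>S\<close>; absorb a unit put aside; finish the current unit; put it aside; add the next vertex of
  \<open>L\<close> to the unit inside the clique; finish that unit.
\<close>

definition msucc :: "bool list list \<Rightarrow> nat list \<Rightarrow> nat list \<Rightarrow> nat \<Rightarrow> nat \<Rightarrow> mstate \<Rightarrow> mstate list" where
  "msucc M S L r kk = (\<lambda>(i, k, c, g, q, h, fl).
     (if i < length L then [(Suc i, k, c, g, q, h, fl)] else []) @
     (if i < length L \<and> c = 0 then [(Suc i, k, 1, nth_default 0 L i, q, h, fl)] else []) @
     (if c = 0 then map (\<lambda>s. (i, k, 1, s, q, h, upd fl s vC)) (filter (\<lambda>s. free fl s) S) else []) @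
     (if 0 < c \<and> c < r then map (\<lambda>s. (i, k, Suc c, g, q, h, upd fl s vC))
        (filter (\<lambda>s. free fl s \<and> touch M g fl s) S) else []) @
     (if 0 < c then map (\<lambda>s. (i, k, c + snd (val fl s), g, q, h, relab fl (val fl s) vC))
        (filter (\<lambda>s. 0 < fst (val fl s) \<and> c + snd (val fl s) \<le> r \<and> touch M g fl s) S) else []) @
     (if c = r \<and> k < kk then [(i, Suc k, 0, 0, q, h, settle M S g fl vX)] else []) @
     (if 0 < c \<and> c < r \<and> \<not> memb g S then map (\<lambda>s. (i, k, 0, 0, q, h, settle M S g fl (Suc s, c)))
        (filter (\<lambda>s. val fl s = vC) S) else []) @
     (if i < length L \<and> q < r \<and> (q = 0 \<or> adj M h (nth_default 0 L i))
        then [(Suc i, k, c, g, Suc q, if q = 0 then nth_default 0 L i else h, fl)] else []) @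
     (if q = r \<and> k < kk then [(i, Suc k, c, g, 0, 0, settle_own M S h fl)] else []))"

text \<open>Only finished vertices of \<open>S\<close> count here. A finished unit that meets both
  \<open>S\<close> and a clique has a vertex of \<open>S\<close> adjacent to the entire clique, so a
  finished unit that meets an exposed clique lies inside it.\<close>

definition exposed :: "bool list list \<Rightarrow> nat list \<Rightarrow> nat list \<Rightarrow> val list \<Rightarrow> nat list" where
  "exposed M S L fl = filter (\<lambda>v. \<not> list_ex (\<lambda>s. val fl s = vX \<and> adj M s v) S) L"

text \<open>
  A clique that is not dominated from \<open>S\<close> needs a unit of its own, which in turn dominates the
  neighbours of the clique in \<open>S\<close>. These cliques are counted by their least vertices.
\<close>

definition mfinal :: "bool list list \<Rightarrow> nat list \<Rightarrow> nat list \<Rightarrow> nat \<Rightarrow> nat \<Rightarrow> mstate \<Rightarrow> bool" where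
  "mfinal M S L r kk = (\<lambda>(i, k, c, g, q, h, fl).
     c = 0 \<and> list_all (\<lambda>s. fst (val fl s) = 0) S \<and>
     k + length (filter (\<lambda>v. \<not> list_ex (\<lambda>u. u < v \<and> adj M u v) L) (exposed M S L fl)) \<le> kk \<and>
     list_all (\<lambda>v. r \<le> length (filter (\<lambda>u. u = v \<or> adj M v u) L)) (exposed M S L fl) \<and>
     list_all (\<lambda>s. val fl s \<noteq> vU \<or> list_ex (\<lambda>v. adj M v s) (exposed M S L fl)) S)"

definition minit :: "nat \<Rightarrow> mstate" where
  "minit n = (0, 0, 0, 0, 0, 0, replicate n vU)"

text \<open>
  The history of a run as a colouring of all vertices; the states retain only its trace on \<open>S\<close>.
\<close>

datatype colour = Free | Own | Cur | Done nat | Pend val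

definition cls :: "(nat \<Rightarrow> colour) \<Rightarrow> colour \<Rightarrow> nat set" where
  "cls col c = {v. col v = c}"

definition recol :: "colour \<Rightarrow> colour \<Rightarrow> (nat \<Rightarrow> colour) \<Rightarrow> nat \<Rightarrow> colour" where
  "recol a b col v = (if col v = a then b else col v)"

text \<open>\<open>Free\<close> matches two labels because the colouring does not record domination.
  \<open>Own\<close> matches none: that unit avoids \<open>S\<close>, and only vertices of
  \<open>S\<close> are compared.\<close>

fun cmatch :: "colour \<Rightarrow> val \<Rightarrow> bool" where
  "cmatch Free w \<longleftrightarrow> w = vU \<or> w = vD"
| "cmatch Own w \<longleftrightarrow> False"
| "cmatch Cur w \<longleftrightarrow> w = vC"
| "cmatch (Done j) w \<longleftrightarrow> w = vX"
| "cmatch (Pend p) w \<longleftrightarrow> w = p \<and> 0 < fst p"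

lemma cls_upd:
  "cls (col(v := c)) c = insert v (cls col c)"
  "col v = Free \<Longrightarrow> c' \<noteq> c \<Longrightarrow> c' \<noteq> Free \<Longrightarrow> cls (col(v := c)) c' = cls col c'"
  by (auto simp: cls_def)

lemma cls_recol:
  "a \<noteq> b \<Longrightarrow> cls (recol a b col) b = cls col a \<union> cls col b"
  "a \<noteq> b \<Longrightarrow> cls (recol a b col) a = {}"
  "c \<noteq> a \<Longrightarrow> c \<noteq> b \<Longrightarrow> cls (recol a b col) c = cls col c"
  by (auto simp: cls_def recol_def)

lemma val_upd: "s < length fl \<Longrightarrow> val (upd fl s w) v = (if v = s then w else val fl v)"
  and val_relab: "w \<noteq> vU \<Longrightarrow> val (relab fl w w') v = (if val fl v = w then w' else val fl v)"
  and val_settle: "val (settle M S g fl w) v = (if val fl v = vC then w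
     else if v < length fl \<and> val fl v = vU \<and> v \<in> set S \<and> touch M g fl v then vD else val fl v)"
  and val_settle_own: "val (settle_own M S h fl) v =
     (if v < length fl \<and> val fl v = vU \<and> v \<in> set S \<and> adj M h v then vD else val fl v)"
  by (auto simp: val_def upd_def relab_def settle_def settle_own_def memb_def list_ex_iff nth_default_def)

lemma length_labels [simp]: "length (upd fl s w) = length fl" "length (relab fl w w') = length fl"
  "length (settle M S g fl w) = length fl" "length (settle_own M S h fl) = length fl"
  by (auto simp: upd_def relab_def settle_def settle_own_def)

section \<open>Connected vertex sets\<close>

definition conn :: "(nat \<Rightarrow> nat \<Rightarrow> bool) \<Rightarrow> nat set \<Rightarrow> bool" where
  "conn A X \<longleftrightarrow> X \<noteq> {} \<and> (\<forall>u\<in>X. \<forall>v\<in>X. (\<lambda>a b. a \<in> X \<and> b \<in> X \<and> A a b)\<^sup>*\<^sup>* u v)"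

lemma conn_single: "conn A {v}"
  by (auto simp: conn_def)

text \<open>The cut argument: a walk from inside \<open>Y\<close> to outside must leave
  \<open>Y\<close> along some edge. It finds the edge by which an incomplete unit can still grow, or
  by which a unit leaves a clique.\<close>

lemma conn_crossing:
  assumes "conn A X" "u \<in> X" "u \<in> Y" "v \<in> X" "v \<notin> Y"
  obtains a b where "a \<in> X" "b \<in> X" "a \<in> Y" "b \<notin> Y" "A a b"
proof -
  have "(\<lambda>a b. a \<in> X \<and> b \<in> X \<and> A a b)\<^sup>*\<^sup>* u v"
    using assms by (auto simp: conn_def)
  then have "v \<notin> Y \<Longrightarrow> \<exists>a b. a \<in> X \<and> b \<in> X \<and> a \<in> Y \<and> b \<notin> Y \<and> A a b"
    by induction (use assms in blast)+
  then show ?thesis using that assms by blast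
qed

lemma conn_Un:
  assumes X: "conn A X" and Y: "conn A Y" and a: "a \<in> X" "b \<in> Y" "A a b" "A b a"
  shows "conn A (X \<union> Y)"
proof -
  let ?R = "\<lambda>Z a b. a \<in> Z \<and> b \<in> Z \<and> A a b"
  have mono: "(?R Z)\<^sup>*\<^sup>* u v \<Longrightarrow> Z \<subseteq> X \<union> Y \<Longrightarrow> (?R (X \<union> Y))\<^sup>*\<^sup>* u v" for Z u v
    by (erule rtranclp_mono[THEN predicate2D, rotated]) auto
  have X': "(?R (X \<union> Y))\<^sup>*\<^sup>* u v" if "u \<in> X" "v \<in> X" for u v
    using mono[of X u v] X that by (auto simp: conn_def)
  have Y': "(?R (X \<union> Y))\<^sup>*\<^sup>* u v" if "u \<in> Y" "v \<in> Y" for u v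
    using mono[of Y u v] Y that by (auto simp: conn_def)
  have ab: "(?R (X \<union> Y))\<^sup>*\<^sup>* a b" "(?R (X \<union> Y))\<^sup>*\<^sup>* b a"
    using a by auto
  have "(?R (X \<union> Y))\<^sup>*\<^sup>* u v" if "u \<in> X \<union> Y" "v \<in> X \<union> Y" for u v
  proof -
    have "(?R (X \<union> Y))\<^sup>*\<^sup>* u a" "(?R (X \<union> Y))\<^sup>*\<^sup>* a v"
      using that X'[OF _ a(1)] X'[OF a(1)] rtranclp_trans[OF Y'[OF _ a(2)] ab(2)]
        rtranclp_trans[OF ab(1) Y'[OF a(2)]] by blast+
    then show ?thesis by (rule rtranclp_trans)
  qed
  moreover have "X \<union> Y \<noteq> {}" using a by blast
  ultimately show ?thesis unfolding conn_def by blast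
qed

lemma conn_insert: "conn A X \<Longrightarrow> a \<in> X \<Longrightarrow> A a b \<Longrightarrow> A b a \<Longrightarrow> conn A (insert b X)"
  using conn_Un[OF _ conn_single[of A b], of X a b] by simp

lemma conn_star:
  assumes "\<And>v. v \<in> X \<Longrightarrow> v = h \<or> A h v \<and> A v h" "h \<in> X"
  shows "conn A X"
proof -
  let ?R = "\<lambda>a b. a \<in> X \<and> b \<in> X \<and> A a b"
  have "?R\<^sup>*\<^sup>* u h \<and> ?R\<^sup>*\<^sup>* h u" if "u \<in> X" for u
  proof (cases "u = h")
    case False
    then have "?R u h" "?R h u" using assms that by blast+
    then show ?thesis by blast
  qed simp
  then have "?R\<^sup>*\<^sup>* u v" if "u \<in> X" "v \<in> X" for u v
    using that by (blast intro: rtranclp_trans)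
  then show ?thesis
    using assms(2) unfolding conn_def by blast
qed

text \<open>\<open>twin\<close> says that \<open>S\<close> is a twin cover, in the form of an
  exchange of neighbours; \<open>contig\<close> says that each clique outside \<open>S\<close>
  occupies an interval of \<open>L\<close>.\<close>

locale machine =
  fixes M :: "bool list list" and S L :: "nat list" and r kk :: nat and n
  assumes n: "n = length M"
    and sym: "adj M u v \<Longrightarrow> adj M v u"
    and irrefl: "\<not> adj M v v"
    and adj_less: "adj M u v \<Longrightarrow> u < n"
    and S: "set S \<subseteq> {..<n}"
    and L: "distinct L" "set L = {..<n} - set S"
    and r: "0 < r"
    and twin: "u \<notin> set S \<Longrightarrow> v \<notin> set S \<Longrightarrow> adj M u v \<Longrightarrow> w \<noteq> v \<Longrightarrow> adj M u w \<Longrightarrow> adj M v w"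
    and contig: "a < b \<Longrightarrow> b < c \<Longrightarrow> c < length L \<Longrightarrow> adj M (L ! a) (L ! c) \<Longrightarrow> adj M (L ! a) (L ! b)"
begin

section \<open>Colourings as an invariant of the runs\<close>

abbreviation "A \<equiv> adj M"

definition "unit X c \<longleftrightarrow> conn A X \<and> card X = c"

text \<open>The vertex of \<open>S\<close> guarantees that the unit is visible in the labels and
  makes its name unique. The vertex outside \<open>S\<close> forces at least two vertices, which
  keeps the number of labels small when \<open>r \<le> 3\<close>.\<close>

definition "pend_ok col w \<longleftrightarrow> unit (cls col (Pend w)) (snd w) \<and> snd w < r \<and>
  (\<exists>s\<in>set S. col s = Pend w \<and> fst w = Suc s) \<and> (\<exists>v. v \<notin> set S \<and> col v = Pend w)"

text \<open>A vertex labelled \<open>vD\<close> owes this to a neighbour in a finished, current or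
  pending unit. \<open>Own\<close> is excluded as a witness because an accepting state may abandon
  an incomplete unit inside a clique, whereas current and pending units must be gone by
  then.\<close>

definition inv :: "(nat \<Rightarrow> colour) \<Rightarrow> mstate \<Rightarrow> bool" where
  "inv col = (\<lambda>(i, k, c, g, q, h, fl).
     (i \<le> length L \<and> k \<le> kk \<and> c \<le> r \<and> q \<le> r \<and> g \<le> n \<and> h \<le> n \<and> length fl = n) \<and>
     (\<forall>v. col v \<noteq> Free \<longrightarrow> v \<in> set S \<union> set (take i L)) \<and>
     (\<forall>j v. col v = Done j \<longrightarrow> j < k) \<and>
     (\<forall>j<k. unit (cls col (Done j)) r) \<and>
     (\<forall>s\<in>set S. cmatch (col s) (val fl s)) \<and>
     (\<forall>v. v \<notin> set S \<longrightarrow> val fl v = vU) \<and>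
     (\<forall>v w. col v = Pend w \<longrightarrow> pend_ok col w) \<and>
     (0 < c \<longrightarrow> col g = Cur \<and> unit (cls col Cur) c) \<and>
     (c = 0 \<longrightarrow> cls col Cur = {}) \<and>
     (\<forall>s. val fl s = vD \<longrightarrow> (\<exists>v. A v s \<and> col v \<noteq> Free \<and> col v \<noteq> Own)) \<and>
     (0 < q \<longrightarrow> col h = Own) \<and> card (cls col Own) = q \<and>
     (\<forall>v. col v = Own \<longrightarrow> v \<notin> set S \<and> (v = h \<or> A h v)))"

lemma finite_cls:
  assumes "inv col (i, k, c, g, q, h, fl)" "a \<noteq> Free"
  shows "finite (cls col a)"
proof (rule finite_subset)
  show "cls col a \<subseteq> set S \<union> set L"
    using assms set_take_subset[of i L] unfolding inv_def cls_def by blast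
qed auto

lemma L_nth: "i < length L \<Longrightarrow> L ! i \<notin> set S \<and> L ! i \<notin> set (take i L) \<and> L ! i < n"
proof -
  assume i: "i < length L"
  then have "L ! i \<in> {..<n} - set S" using L nth_mem[of i L] by simp
  moreover have "L ! j \<noteq> L ! i" if "j < i" for j
    using that i L(1) by (simp add: nth_eq_iff_index_eq)
  then have "L ! i \<notin> set (take i L)"
    using i by (auto simp: in_set_conv_nth)
  ultimately show ?thesis by simp
qed

lemma take_Suc_L: "i < length L \<Longrightarrow> set (take (Suc i) L) = insert (L ! i) (set (take i L))"
  by (simp add: take_Suc_conv_app_nth)

lemma inv_init: "inv (\<lambda>_. Free) (minit n)"
  by (auto simp: inv_def minit_def cls_def val_def nth_default_def)

lemma inv_skip:
  "inv col (i, k, c, g, q, h, fl) \<Longrightarrow> i < length L \<Longrightarrow> inv col (Suc i, k, c, g, q, h, fl)"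
  by (auto simp: inv_def take_Suc_L)

lemma inv_L_free:
  assumes "inv col (i, k, c, g, q, h, fl)" "i < length L"
  shows "col (L ! i) = Free"
  using assms L_nth[OF assms(2)] unfolding inv_def by auto

lemma inv_S_free:
  assumes "inv col (i, k, c, g, q, h, fl)" "s \<in> set S"
  shows "free fl s \<longleftrightarrow> col s = Free"
proof -
  have "cmatch (col s) (val fl s)" using assms unfolding inv_def by auto
  then show ?thesis unfolding free_def by (cases "col s") auto
qed

lemma inv_vC:
  assumes "inv col (i, k, c, g, q, h, fl)"
  shows "val fl s = vC \<longleftrightarrow> s \<in> set S \<and> col s = Cur"
proof (cases "s \<in> set S")
  case True
  then have "cmatch (col s) (val fl s)" using assms unfolding inv_def by auto
  then show ?thesis using True by (cases "col s") auto
qed (use assms in \<open>auto simp: inv_def\<close>)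

lemma inv_vX:
  assumes "inv col (i, k, c, g, q, h, fl)"
  shows "val fl s = vX \<longleftrightarrow> s \<in> set S \<and> (\<exists>j. col s = Done j)"
proof (cases "s \<in> set S")
  case True
  then have "cmatch (col s) (val fl s)" using assms unfolding inv_def by auto
  then show ?thesis using True by (cases "col s") auto
qed (use assms in \<open>auto simp: inv_def\<close>)

lemma inv_Pend:
  assumes "inv col (i, k, c, g, q, h, fl)"
  shows "0 < fst (val fl s) \<longleftrightarrow> s \<in> set S \<and> (\<exists>w. col s = Pend w)"
    and "s \<in> set S \<Longrightarrow> col s = Pend w \<Longrightarrow> val fl s = w"
proof -
  have c: "cmatch (col s) (val fl s)" if "s \<in> set S" using assms that unfolding inv_def by auto
  show "0 < fst (val fl s) \<longleftrightarrow> s \<in> set S \<and> (\<exists>w. col s = Pend w)"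
  proof (cases "s \<in> set S")
    case True
    with c[OF True] show ?thesis by (cases "col s") auto
  next
    case False
    then have "val fl s = vU" using assms by (auto simp: inv_def)
    then show ?thesis using False by simp
  qed
  show "val fl s = w" if "s \<in> set S" "col s = Pend w"
    using c[OF that(1)] that(2) by simp
qed

lemma inv_touch:
  assumes "inv col (i, k, c, g, q, h, fl)"
  shows "touch M g fl s \<longleftrightarrow> A g s \<or> (\<exists>v\<in>set S. col v = Cur \<and> A v s)"
proof -
  have "length fl = n" using assms by (auto simp: inv_def)
  moreover have "v < n" if "v \<in> set S" for v using S that by auto
  ultimately have "(\<exists>v\<in>set [0..<length fl]. val fl v = vC \<and> A v s) \<longleftrightarrow> (\<exists>v\<in>set S. col v = Cur \<and> A v s)"
    using inv_vC[OF assms] by (metis add_0 atLeast_upt lessThan_iff)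
  then show ?thesis
    unfolding touch_def list_ex_iff by simp
qed

lemma invI:
  assumes "i \<le> length L" "k \<le> kk" "c \<le> r" "q \<le> r" "g \<le> n" "h \<le> n" "length fl = n"
    and "\<And>v. col v \<noteq> Free \<Longrightarrow> v \<in> set S \<union> set (take i L)"
    and "\<And>j v. col v = Done j \<Longrightarrow> j < k"
    and "\<And>j. j < k \<Longrightarrow> unit (cls col (Done j)) r"
    and "\<And>s. s \<in> set S \<Longrightarrow> cmatch (col s) (val fl s)"
    and "\<And>v. v \<notin> set S \<Longrightarrow> val fl v = vU"
    and "\<And>v w. col v = Pend w \<Longrightarrow> pend_ok col w"
    and "0 < c \<Longrightarrow> col g = Cur" "0 < c \<Longrightarrow> unit (cls col Cur) c"
    and "c = 0 \<Longrightarrow> cls col Cur = {}"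
    and "\<And>s. val fl s = vD \<Longrightarrow> \<exists>v. A v s \<and> col v \<noteq> Free \<and> col v \<noteq> Own"
    and "0 < q \<Longrightarrow> col h = Own" "card (cls col Own) = q"
    and "\<And>v. col v = Own \<Longrightarrow> v \<notin> set S \<and> (v = h \<or> A h v)"
  shows "inv col (i, k, c, g, q, h, fl)"
  using assms unfolding inv_def prod.case by (intro conjI allI impI ballI) simp_all

lemma invD:
  assumes "inv col (i, k, c, g, q, h, fl)"
  shows "i \<le> length L" "k \<le> kk" "c \<le> r" "q \<le> r" "g \<le> n" "h \<le> n" "length fl = n"
    and "\<And>v. col v \<noteq> Free \<Longrightarrow> v \<in> set S \<union> set (take i L)"
    and "\<And>j v. col v = Done j \<Longrightarrow> j < k"
    and "\<And>j. j < k \<Longrightarrow> unit (cls col (Done j)) r"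
    and "\<And>s. s \<in> set S \<Longrightarrow> cmatch (col s) (val fl s)"
    and "\<And>v. v \<notin> set S \<Longrightarrow> val fl v = vU"
    and "\<And>v w. col v = Pend w \<Longrightarrow> pend_ok col w"
    and "0 < c \<Longrightarrow> col g = Cur" "0 < c \<Longrightarrow> unit (cls col Cur) c"
    and "c = 0 \<Longrightarrow> cls col Cur = {}"
    and "\<And>s. val fl s = vD \<Longrightarrow> \<exists>v. A v s \<and> col v \<noteq> Free \<and> col v \<noteq> Own"
    and "0 < q \<Longrightarrow> col h = Own" "card (cls col Own) = q"
    and "\<And>v. col v = Own \<Longrightarrow> v \<notin> set S \<and> (v = h \<or> A h v)"
  using assms unfolding inv_def prod.case by blast+

lemma pend_ok_cong: "cls col' (Pend w) = cls col (Pend w) \<Longrightarrow> pend_ok col w \<Longrightarrow> pend_ok col' w"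
  unfolding pend_ok_def unit_def by (auto simp: cls_def set_eq_iff)

lemma pend_ok_upd: "col v = Free \<Longrightarrow> c \<noteq> Pend w \<Longrightarrow> pend_ok col w \<Longrightarrow> pend_ok (col(v := c)) w"
  by (rule pend_ok_cong) (auto simp: cls_def)

lemma unit_single: "unit {v} (Suc 0)"
  by (simp add: unit_def conn_single)

lemma inv_startL:
  assumes inv: "inv col (i, k, 0, g, q, h, fl)" and i: "i < length L"
  shows "inv (col(L ! i := Cur)) (Suc i, k, 1, L ! i, q, h, fl)"
proof -
  note c = L_nth[OF i] and free = inv_L_free[OF inv i] and D = invD[OF inv]
  show ?thesis
  proof (rule invI)
    show "pend_ok (col(L ! i := Cur)) w" if "(col(L ! i := Cur)) v = Pend w" for v w
      using that D(13)[of v w] free by (intro pend_ok_upd) (auto split: if_splits)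
    show "unit (cls (col(L ! i := Cur)) (Done j)) r" if "j < k" for j
      using D(10)[OF that] free by (simp add: cls_upd)
    show "\<exists>v. A v s \<and> (col(L ! i := Cur)) v \<noteq> Free \<and> (col(L ! i := Cur)) v \<noteq> Own" if "val fl s = vD" for s
      using D(17)[OF that] free by (metis fun_upd_other)
    show "cmatch ((col(L ! i := Cur)) s) (val fl s)" if "s \<in> set S" for s
      using D(11)[OF that] c that by auto
    show "v \<in> set S \<union> set (take (Suc i) L)" if "(col(L ! i := Cur)) v \<noteq> Free" for v
      using that D(8)[of v] i by (auto simp: take_Suc_L split: if_splits)
    show "card (cls (col(L ! i := Cur)) Own) = q" using D(19) free by (simp add: cls_upd)
    show "v \<notin> set S \<and> (v = h \<or> A h v)" if "(col(L ! i := Cur)) v = Own" for v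
      using that D(20)[of v] by (auto split: if_splits)
    show "j < k" if "(col(L ! i := Cur)) v = Done j" for j v
      using that D(9)[of v j] by (auto split: if_splits)
  qed (use D(1-7,12,16,18) c free i r unit_single in \<open>auto simp: cls_upd\<close>)
qed

text \<open>One statement for two moves: with \<open>c = 0\<close> a unit starts at
  \<open>s\<close>, otherwise \<open>s\<close> joins the current unit along the edge that
  \<open>touch\<close> provides.\<close>

lemma inv_upd_Cur:
  assumes inv: "inv col (i, k, c, g, q, h, fl)" and s: "s \<in> set S" "col s = Free"
    and g': "c = 0 \<and> g' = s \<or> 0 < c \<and> c < r \<and> g' = g \<and> touch M g fl s"
  shows "inv (col(s := Cur)) (i, k, Suc c, g', q, h, upd fl s vC)"
proof -
  note D = invD[OF inv]
  let ?col = "col(s := Cur)"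
  have sn: "s < length fl" using S s D(7) by auto
  note v = val_upd[OF sn]
  show ?thesis
  proof (rule invI)
    show "pend_ok ?col w" if "?col v = Pend w" for v w
      using that D(13)[of v w] s(2) by (intro pend_ok_upd) (auto split: if_splits)
    show "unit (cls ?col (Done j)) r" if "j < k" for j
      using D(10)[OF that] s by (simp add: cls_upd)
    show "\<exists>v. A v t \<and> ?col v \<noteq> Free \<and> ?col v \<noteq> Own" if "val (upd fl s vC) t = vD" for t
    proof -
      have "val fl t = vD" using that by (simp add: v split: if_splits)
      then obtain u where u: "A u t" "col u \<noteq> Free" "col u \<noteq> Own" using D(17)[of t] by blast
      then have "?col u \<noteq> Free \<and> ?col u \<noteq> Own" by simp
      then show ?thesis using u by blast
    qed
    show "cmatch (?col t) (val (upd fl s vC) t)" if "t \<in> set S" for t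
      using D(11)[OF that] that by (auto simp: v)
    show "v \<in> set S \<union> set (take i L)" if "?col v \<noteq> Free" for v
      using that D(8)[of v] s by (auto split: if_splits)
    show "card (cls ?col Own) = q" using D(19) s by (simp add: cls_upd)
    show "v \<notin> set S \<and> (v = h \<or> A h v)" if "?col v = Own" for v
      using that D(20)[of v] by (auto split: if_splits)
    show "j < k" if "?col v = Done j" for j v
      using that D(9)[of v j] by (auto split: if_splits)
    show "Suc c \<le> r" using g' r by auto
    show "?col g' = Cur" using g' D(14) by auto
    show "unit (cls ?col Cur) (Suc c)"
    proof (cases "c = 0")
      case True
      then show ?thesis using D(16) by (simp add: cls_upd unit_single)
    next
      case False
      then have c: "0 < c" "touch M g fl s" using g' by auto
      then have "(A g s \<and> col g = Cur) \<or> (\<exists>v\<in>set S. col v = Cur \<and> A v s)"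
        using D(14) inv_touch[OF inv] by blast
      then obtain v where v: "v \<in> cls col Cur" "A v s"
        unfolding cls_def by blast
      have "s \<notin> cls col Cur" using s by (simp add: cls_def)
      have "conn A (insert s (cls col Cur))"
        by (rule conn_insert[OF _ v sym[OF v(2)]]) (use D(15)[OF c(1)] in \<open>simp add: unit_def\<close>)
      then show ?thesis
        using D(15)[OF c(1)] finite_cls[OF inv, of Cur] \<open>s \<notin> cls col Cur\<close>
        by (simp add: cls_upd unit_def)
    qed
    show "0 < q \<Longrightarrow> ?col h = Own" using D(18) s by auto
    show "g' \<le> n" using g' D(5) sn D(7) by auto
    show "\<And>u. u \<notin> set S \<Longrightarrow> val (upd fl s vC) u = vU" using D(12) s by (auto simp: v)
  qed (use D(1-7) in auto)
qed

text \<open>The touched vertex \<open>s\<close> supplies the joining edge between two connected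
  sets. Vertices of the absorbed unit outside \<open>S\<close> move too, although this shows only in
  the colouring.\<close>

lemma inv_absorb:
  assumes inv: "inv col (i, k, c, g, q, h, fl)" and s: "s \<in> set S" "0 < fst (val fl s)"
    and c: "0 < c" "c + snd (val fl s) \<le> r" "touch M g fl s"
  shows "inv (recol (Pend (val fl s)) Cur col) (i, k, c + snd (val fl s), g, q, h, relab fl (val fl s) vC)"
proof -
  note D = invD[OF inv]
  let ?w = "val fl s"
  let ?col = "recol (Pend ?w) Cur col" and ?fl = "relab fl ?w vC"
  have cs: "col s = Pend ?w" using inv_Pend[OF inv, of s] s by auto
  obtain a b where w: "?w = (Suc a, b)" using s(2) by (cases ?w; cases "fst ?w") auto
  note po = D(13)[OF cs]
  have v: "val ?fl u = (if val fl u = ?w then vC else val fl u)" for u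
    by (rule val_relab) (use s in auto)
  show ?thesis
  proof (rule invI)
    show "pend_ok ?col w" if "?col v = Pend w" for v w
      using that D(13)[of v w] by (intro pend_ok_cong[OF cls_recol(3)]) (auto simp: recol_def split: if_splits)
    show "unit (cls ?col (Done j)) r" if "j < k" for j
      using D(10)[OF that] s by (simp add: cls_recol)
    show "\<exists>v. A v t \<and> ?col v \<noteq> Free \<and> ?col v \<noteq> Own" if "val ?fl t = vD" for t
      using D(17)[of t] that by (auto simp: v recol_def split: if_splits)
    show "cmatch (?col t) (val ?fl t)" if "t \<in> set S" for t
      using D(11)[OF that] inv_Pend[OF inv, of t] that s by (cases "col t") (auto simp: v v[unfolded w] recol_def w)
    show "v \<in> set S \<union> set (take i L)" if "?col v \<noteq> Free" for v
      using that D(8)[of v] s by (auto simp: recol_def split: if_splits)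
    show "card (cls ?col Own) = q" using D(19) s by (simp add: cls_recol)
    show "v \<notin> set S \<and> (v = h \<or> A h v)" if "?col v = Own" for v
      using that D(20)[of v] by (auto simp: recol_def split: if_splits)
    show "j < k" if "?col v = Done j" for j v
      using that D(9)[of v j] by (auto simp: recol_def split: if_splits)
    show "?col g = Cur" using D(14) c by (auto simp: recol_def)
    show "unit (cls ?col Cur) (c + snd ?w)"
    proof -
      obtain v where v: "v \<in> cls col Cur" "A v s"
        using D(14) inv_touch[OF inv] c by (auto simp: cls_def)
      have dis: "cls col (Pend ?w) \<inter> cls col Cur = {}" by (auto simp: cls_def)
      have s': "s \<in> cls col (Pend ?w)" using cs by (simp add: cls_def)
      show ?thesis
        using po D(15)[OF c(1)] conn_Un[of A "cls col (Pend ?w)" "cls col Cur" s v] v sym s'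
          card_Un_disjoint[OF _ _ dis] finite_cls[OF inv]
        by (auto simp: cls_recol unit_def pend_ok_def)
    qed
    show "0 < q \<Longrightarrow> ?col h = Own" using D(18) s by (auto simp: recol_def)
    show "\<And>u. u \<notin> set S \<Longrightarrow> val ?fl u = vU" using D(12) s by (auto simp: v v[unfolded w] w)
  qed (use D(1-7) c in auto)
qed

lemma inv_settle_val:
  assumes inv: "inv col (i, k, c, g, q, h, fl)"
  shows "val (settle M S g fl w) v = (if v \<in> set S \<and> col v = Cur then w
     else if v \<in> set S \<and> val fl v = vU \<and> touch M g fl v then vD else val fl v)"
  using S invD(7)[OF inv] by (auto simp: val_settle inv_vC[OF inv])

lemma inv_done:
  assumes inv: "inv col (i, k, r, g, q, h, fl)" and k: "k < kk"
  shows "inv (recol Cur (Done k) col) (i, Suc k, 0, 0, q, h, settle M S g fl vX)"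
proof -
  note D = invD[OF inv]
  let ?col = "recol Cur (Done k) col" and ?fl = "settle M S g fl vX"
  note v = inv_settle_val[OF inv]
  have no: "cls col (Done k) = {}" using D(9) by (auto simp: cls_def)
  show ?thesis
  proof (rule invI)
    show "pend_ok ?col w" if "?col v = Pend w" for v w
      using that D(13)[of v w] by (intro pend_ok_cong[OF cls_recol(3)]) (auto simp: recol_def split: if_splits)
    show "unit (cls ?col (Done j)) r" if "j < Suc k" for j
      using D(10)[of j] D(15) r that no by (cases "j = k") (simp_all add: cls_recol)
    show "\<exists>v. A v t \<and> ?col v \<noteq> Free \<and> ?col v \<noteq> Own" if "val ?fl t = vD" for t
    proof (cases "val fl t = vD")
      case True
      then show ?thesis using D(17)[of t] by (auto simp: recol_def)
    next
      case False
      then have "touch M g fl t" using that by (auto simp: v split: if_splits)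
      then show ?thesis
        using inv_touch[OF inv] D(14) r unfolding recol_def
        by (metis colour.distinct(3,5,9,11,17))
    qed
    show "cmatch (?col t) (val ?fl t)" if "t \<in> set S" for t
      using D(11)[OF that] that by (cases "col t") (auto simp: v recol_def)
    show "v \<in> set S \<union> set (take i L)" if "?col v \<noteq> Free" for v
      using that D(8)[of v] by (auto simp: recol_def split: if_splits)
    show "card (cls ?col Own) = q" using D(19) by (simp add: cls_recol)
    show "v \<notin> set S \<and> (v = h \<or> A h v)" if "?col v = Own" for v
      using that D(20)[of v] by (auto simp: recol_def split: if_splits)
    show "j < Suc k" if "?col v = Done j" for j v
      using that D(9)[of v j] by (auto simp: recol_def split: if_splits)
    show "cls ?col Cur = {}" by (simp add: cls_recol)
    show "0 < q \<Longrightarrow> ?col h = Own" using D(18) by (auto simp: recol_def)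
    show "\<And>u. u \<notin> set S \<Longrightarrow> val ?fl u = vU" using D(12) by (auto simp: v)
  qed (use D(1-7) k in auto)
qed

lemma inv_pend:
  assumes inv: "inv col (i, k, c, g, q, h, fl)" and c: "0 < c" "c < r"
    and g: "g \<notin> set S" and s: "s \<in> set S" "col s = Cur"
  shows "inv (recol Cur (Pend (Suc s, c)) col) (i, k, 0, 0, q, h, settle M S g fl (Suc s, c))"
proof -
  note D = invD[OF inv]
  let ?w = "(Suc s, c)"
  let ?col = "recol Cur (Pend ?w) col" and ?fl = "settle M S g fl ?w"
  note v = inv_settle_val[OF inv]
  \<comment> \<open>The name is fresh: a pending unit of this name would contain \<open>s\<close>,
    which belongs to the current unit.\<close>
  have no: "cls col (Pend ?w) = {}"
    using D(13)[of _ ?w] s by (auto simp: cls_def pend_ok_def)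
  show ?thesis
  proof (rule invI)
    have "pend_ok ?col ?w"
      unfolding pend_ok_def using D(15)[OF c(1)] D(14)[OF c(1)] c g s no
      by (auto simp: cls_recol recol_def intro!: bexI[of _ s] exI[of _ g])
    then show "pend_ok ?col w" if "?col v = Pend w" for v w
      using that D(13)[of v w] pend_ok_cong[OF cls_recol(3)[of "Pend w" Cur "Pend ?w" col]]
      by (cases "w = ?w") (auto simp: recol_def split: if_splits)
    show "unit (cls ?col (Done j)) r" if "j < k" for j
      using D(10)[of j] that by (simp add: cls_recol)
    show "\<exists>v. A v t \<and> ?col v \<noteq> Free \<and> ?col v \<noteq> Own" if "val ?fl t = vD" for t
    proof (cases "val fl t = vD")
      case True
      then show ?thesis using D(17)[of t] by (auto simp: recol_def)
    next
      case False
      then have "touch M g fl t" using that by (auto simp: v split: if_splits)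
      then show ?thesis
        using inv_touch[OF inv] D(14) c unfolding recol_def by fastforce
    qed
    show "cmatch (?col t) (val ?fl t)" if "t \<in> set S" for t
      using D(11)[OF that] that by (cases "col t") (auto simp: v recol_def)
    show "v \<in> set S \<union> set (take i L)" if "?col v \<noteq> Free" for v
      using that D(8)[of v] by (auto simp: recol_def split: if_splits)
    show "card (cls ?col Own) = q" using D(19) by (simp add: cls_recol)
    show "v \<notin> set S \<and> (v = h \<or> A h v)" if "?col v = Own" for v
      using that D(20)[of v] by (auto simp: recol_def split: if_splits)
    show "j < k" if "?col v = Done j" for j v
      using that D(9)[of v j] by (auto simp: recol_def split: if_splits)
    show "cls ?col Cur = {}" by (simp add: cls_recol)
    show "0 < q \<Longrightarrow> ?col h = Own" using D(18) by (auto simp: recol_def)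
    show "\<And>u. u \<notin> set S \<Longrightarrow> val ?fl u = vU" using D(12) by (auto simp: v)
  qed (use D(1-7) in auto)
qed

lemma inv_own_add:
  assumes inv: "inv col (i, k, c, g, q, h, fl)" and i: "i < length L" "q < r" "q = 0 \<or> A h (L ! i)"
  shows "inv (col(L ! i := Own)) (Suc i, k, c, g, Suc q, if q = 0 then L ! i else h, fl)"
proof -
  note c = L_nth[OF i(1)] and free = inv_L_free[OF inv i(1)] and D = invD[OF inv]
  let ?col = "col(L ! i := Own)"
  show ?thesis
  proof (rule invI)
    show "pend_ok ?col w" if "?col v = Pend w" for v w
      using that D(13)[of v w] free by (intro pend_ok_upd) (auto split: if_splits)
    show "unit (cls ?col (Done j)) r" if "j < k" for j
      using D(10)[OF that] free by (simp add: cls_upd)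
    show "\<exists>v. A v s \<and> ?col v \<noteq> Free \<and> ?col v \<noteq> Own" if "val fl s = vD" for s
      using D(17)[OF that] free by (metis fun_upd_other)
    show "cmatch (?col s) (val fl s)" if "s \<in> set S" for s
      using D(11)[OF that] c that by auto
    show "v \<in> set S \<union> set (take (Suc i) L)" if "?col v \<noteq> Free" for v
      using that D(8)[of v] i by (auto simp: take_Suc_L split: if_splits)
    have "L ! i \<notin> cls col Own" using free by (simp add: cls_def)
    then show "card (cls ?col Own) = Suc q"
      using D(19) finite_cls[OF inv, of Own] by (simp add: cls_upd)
    show "v \<notin> set S \<and> (v = (if q = 0 then L ! i else h) \<or> A (if q = 0 then L ! i else h) v)"
      if "?col v = Own" for v
    proof (cases "q = 0")
      case True
      then have "cls col Own = {}" using D(19) finite_cls[OF inv, of Own] by auto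
      then show ?thesis using that True c by (auto simp: cls_def split: if_splits)
    next
      case False
      then show ?thesis using that D(20)[of v] c i by (auto split: if_splits)
    qed
    show "j < k" if "?col v = Done j" for j v
      using that D(9)[of v j] by (auto split: if_splits)
  qed (use D(1-7,12,14,15,16,18) c free i r in \<open>auto simp: cls_upd split: if_splits\<close>)
qed

lemma inv_own_done:
  assumes inv: "inv col (i, k, c, g, r, h, fl)" and k: "k < kk"
  shows "inv (recol Own (Done k) col) (i, Suc k, c, g, 0, 0, settle_own M S h fl)"
proof -
  note D = invD[OF inv]
  let ?col = "recol Own (Done k) col" and ?fl = "settle_own M S h fl"
  have v: "val ?fl v = (if v \<in> set S \<and> val fl v = vU \<and> A h v then vD else val fl v)" for v
    using S D(7) by (auto simp: val_settle_own)
  have no: "cls col (Done k) = {}" using D(9) by (auto simp: cls_def)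
  have "conn A (cls col Own)"
    by (rule conn_star[of _ h]) (use D(18,20) r sym in \<open>auto simp: cls_def\<close>)
  then have u: "unit (cls col Own) r" using D(19) by (simp add: unit_def)
  show ?thesis
  proof (rule invI)
    show "pend_ok ?col w" if "?col v = Pend w" for v w
      using that D(13)[of v w] by (intro pend_ok_cong[OF cls_recol(3)]) (auto simp: recol_def split: if_splits)
    show "unit (cls ?col (Done j)) r" if "j < Suc k" for j
      using D(10)[of j] u that no by (cases "j = k") (simp_all add: cls_recol)
    show "\<exists>v. A v t \<and> ?col v \<noteq> Free \<and> ?col v \<noteq> Own" if "val ?fl t = vD" for t
    proof (cases "val fl t = vD")
      case True
      then show ?thesis using D(17)[of t] by (auto simp: recol_def)
    next
      case False
      then have "A h t" using that by (auto simp: v split: if_splits)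
      then show ?thesis
        using D(18) r unfolding recol_def by fastforce
    qed
    show "cmatch (?col t) (val ?fl t)" if "t \<in> set S" for t
      using D(11)[OF that] that by (cases "col t") (auto simp: v recol_def)
    show "v \<in> set S \<union> set (take i L)" if "?col v \<noteq> Free" for v
      using that D(8)[of v] by (auto simp: recol_def split: if_splits)
    show "card (cls ?col Own) = 0" by (simp add: cls_recol)
    show "v \<notin> set S \<and> (v = 0 \<or> A 0 v)" if "?col v = Own" for v
      using that by (auto simp: recol_def split: if_splits)
    show "j < Suc k" if "?col v = Done j" for j v
      using that D(9)[of v j] by (auto simp: recol_def split: if_splits)
    show "\<And>u. u \<notin> set S \<Longrightarrow> val ?fl u = vU" using D(12) by (auto simp: v)
    show "c = 0 \<Longrightarrow> cls ?col Cur = {}" "0 < c \<Longrightarrow> unit (cls ?col Cur) c" "0 < c \<Longrightarrow> ?col g = Cur"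
      using D(14,15,16) by (auto simp: cls_recol recol_def)
  qed (use D(1-7) k r in auto)
qed

end

context machine
begin

lemma inv_step:
  assumes inv: "inv col st" and st': "st' \<in> set (msucc M S L r kk st)"
  shows "\<exists>col'. inv col' st'"
proof -
  obtain i k c g q h fl where st: "st = (i, k, c, g, q, h, fl)" by (cases st) auto
  note inv = inv[unfolded st]
  have Lnth: "nth_default 0 L i = L ! i" if "i < length L" using that by (simp add: nth_default_def)
  have memb: "memb v S \<longleftrightarrow> v \<in> set S" for v by (auto simp: memb_def list_ex_iff)
  have mem_if: "x \<in> set (if P then xs else []) \<longleftrightarrow> P \<and> x \<in> set xs" for x P and xs :: "mstate list"
    by simp
  show ?thesis
    using st' unfolding st msucc_def memb prod.case
    apply (simp only: set_append Un_iff mem_if set_map image_iff set_filter list.set singleton_iff)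
    apply (elim disjE conjE bexE; (elim CollectE conjE)?)
    subgoal using inv_skip[OF inv] by blast
    subgoal using inv Lnth by (metis inv_startL)
    subgoal for s using inv_upd_Cur[OF inv, of s s] inv_S_free[OF inv, of s] by auto
    subgoal for s using inv_upd_Cur[OF inv, of s g] inv_S_free[OF inv, of s] by metis
    subgoal for s using inv_absorb[OF inv, of s] by blast
    subgoal using inv_done inv by blast
    subgoal for s using inv_pend[OF inv, of s] inv_vC[OF inv, of s] by blast
    subgoal using inv_own_add[OF inv] Lnth by metis
    subgoal using inv_own_add[OF inv] Lnth by metis
    subgoal using inv_own_done[of col i k c g h fl] inv by blast
    done
qed

lemma inv_reach:
  assumes "reach (msucc M S L r kk) (minit n) st"
  shows "\<exists>col. inv col st"
  using assms unfolding reach_def by induction (use inv_init inv_step in blast)+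

section \<open>Soundness: accepting states yield solutions\<close>

definition gds :: "nat set set \<Rightarrow> bool" where
  "gds \<D> \<longleftrightarrow> finite \<D> \<and> card \<D> \<le> kk \<and> pairwise disjnt \<D> \<and>
     (\<forall>D\<in>\<D>. D \<subseteq> {..<n} \<and> unit D r) \<and> (\<forall>v<n. \<exists>u\<in>\<Union>\<D>. v = u \<or> A u v)"

definition clq :: "nat \<Rightarrow> nat set" where
  "clq v = {u \<in> set L. u = v \<or> A v u}"

text \<open>Twin exchange: \<open>x\<close> is adjacent to \<open>v\<close>, so it inherits the
  neighbour \<open>y\<close> of \<open>v\<close>.\<close>

lemma clq_adj:
  assumes "v \<in> set L" "x \<in> clq v" "y \<in> clq v" "x \<noteq> y"
  shows "A x y"
proof -
  have *: "v \<notin> set S" "x \<notin> set S" "y \<notin> set S" using assms L by (auto simp: clq_def)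
  show ?thesis
  proof (cases "x = v")
    case False
    then have "A v x" using assms by (simp add: clq_def)
    show ?thesis
    proof (cases "y = v")
      case False
      then have "A v y" using assms by (simp add: clq_def)
      then show ?thesis using twin[OF *(1,2) \<open>A v x\<close>, of y] assms(4) by simp
    qed (use \<open>A v x\<close> sym in simp)
  qed (use assms in \<open>auto simp: clq_def\<close>)
qed

lemma clq_twin:
  assumes "v \<in> set L" "u \<in> clq v" "s \<in> set S" "A v s"
  shows "A u s"
proof (cases "u = v")
  case False
  then show ?thesis
    using assms L twin[of v u s] by (auto simp: clq_def)
qed (use assms in simp)

lemma clq_sym: "v \<in> set L \<Longrightarrow> u \<in> clq v \<Longrightarrow> v \<in> clq u"
  using sym by (auto simp: clq_def)

text \<open>By the twin property, being equal or adjacent is an equivalence on the vertices outside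
  \<open>S\<close>; its classes are the cliques.\<close>

lemma clq_eq:
  assumes "v \<in> set L" "u \<in> clq v"
  shows "clq u = clq v"
proof -
  have "clq y \<subseteq> clq x" if "x \<in> set L" "y \<in> clq x" for x y
  proof
    fix z assume z: "z \<in> clq y"
    have "y \<in> set L" using that by (simp add: clq_def)
    then have "x = z \<or> A x z"
      using clq_adj[of y x z] clq_sym[OF that] z by blast
    then show "z \<in> clq x" using z by (auto simp: clq_def)
  qed
  then show ?thesis
    using assms clq_sym[OF assms] by (metis (no_types, lifting) clq_def mem_Collect_eq subset_antisym)
qed

lemma unit_clq:
  assumes "v \<in> set L" "X \<subseteq> clq v" "card X = c" "0 < c"
  shows "unit X c"
proof -
  obtain h where h: "h \<in> X" using assms(3,4) by fastforce
  have "conn A X"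
    by (rule conn_star[OF _ h]) (use assms h clq_adj[OF assms(1)] in blast)
  then show ?thesis using assms by (simp add: unit_def)
qed

lemma mfinal_iff:
  "mfinal M S L r kk (i, k, c, g, q, h, fl) \<longleftrightarrow> c = 0 \<and> (\<forall>s\<in>set S. fst (val fl s) = 0) \<and>
     k + card {v \<in> set (exposed M S L fl). \<forall>u\<in>set L. u < v \<longrightarrow> \<not> A u v} \<le> kk \<and>
     (\<forall>v\<in>set (exposed M S L fl). r \<le> card (clq v)) \<and>
     (\<forall>s\<in>set S. val fl s = vU \<longrightarrow> (\<exists>v\<in>set (exposed M S L fl). A v s))"
proof -
  have d: "distinct (exposed M S L fl)" using L by (simp add: exposed_def)
  have "length (filter (\<lambda>v. \<not> list_ex (\<lambda>u. u < v \<and> A u v) L) (exposed M S L fl)) =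
      card {v \<in> set (exposed M S L fl). \<forall>u\<in>set L. u < v \<longrightarrow> \<not> A u v}"
    by (subst distinct_card[OF distinct_filter[OF d], symmetric]) (simp add: list_ex_iff)
  moreover have "length (filter (\<lambda>u. u = v \<or> A v u) L) = card (clq v)" for v
    by (subst distinct_card[OF distinct_filter[OF L(1)], symmetric]) (simp add: clq_def)
  ultimately show ?thesis
    unfolding mfinal_def by (auto simp: list_all_iff list_ex_iff)
qed

lemma exposed_iff: "v \<in> set (exposed M S L fl) \<longleftrightarrow> v \<in> set L \<and> (\<forall>s\<in>set S. val fl s = vX \<longrightarrow> \<not> A s v)"
  by (auto simp: exposed_def list_ex_iff)

text \<open>Being exposed depends on the neighbours in \<open>S\<close> only, so it is a property of
  whole cliques.\<close>

lemma exposed_clq: "v \<in> set (exposed M S L fl) \<Longrightarrow> u \<in> clq v \<Longrightarrow> u \<in> set (exposed M S L fl)"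
proof -
  assume v: "v \<in> set (exposed M S L fl)" and u: "u \<in> clq v"
  then have "v \<in> set L" "u \<in> set L" by (auto simp: exposed_iff clq_def)
  then show ?thesis
    using v clq_twin[OF _ clq_sym[OF _ u]] sym unfolding exposed_iff by blast
qed

text \<open>The solution consists of the finished units and, for each exposed clique without a
  finished vertex, an arbitrary set of \<open>r\<close> of its vertices. The accepting test counts
  one unit per exposed clique, which is enough for both kinds.\<close>

lemma soundness:
  assumes inv: "inv col (i, k, c, g, q, h, fl)" and fin: "mfinal M S L r kk (i, k, c, g, q, h, fl)"
  shows "\<exists>\<D>. gds \<D>"
proof -
  let ?E = "set (exposed M S L fl)"
  define reps where "reps = {v \<in> ?E. \<forall>u\<in>set L. u < v \<longrightarrow> \<not> A u v}"
  note D = invD[OF inv] and F = fin[unfolded mfinal_iff, folded reps_def]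
  have E: "?E \<subseteq> set L" by (auto simp: exposed_iff)
  \<comment> \<open>A pending unit contains the vertex of \<open>S\<close> that names it, and the
    accepting test would see its label.\<close>
  have noPend: "col v \<noteq> Pend w" for v w
  proof
    assume "col v = Pend w"
    then obtain s where "s \<in> set S" "col s = Pend w" using D(13)[of v w] unfolding pend_ok_def by blast
    then show False using inv_Pend[OF inv, of s] F by auto
  qed
  have noCur: "col v \<noteq> Cur" for v using D(16) F by (auto simp: cls_def)
  have "\<exists>X. X \<subseteq> clq v \<and> card X = r" if "v \<in> ?E" for v
    using F that by (meson obtain_subset_with_card_n)
  then obtain U where U: "\<And>v. v \<in> ?E \<Longrightarrow> U v \<subseteq> clq v \<and> card (U v) = r" by metis
  \<comment> \<open>An exposed clique met by a finished unit gets no further one. In the others no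
    vertex is finished, so the chosen sets are disjoint from the finished units.\<close>
  define P where "P = {v \<in> reps. \<forall>u\<in>clq v. \<forall>j. col u \<noteq> Done j}"
  define \<D> where "\<D> = (\<lambda>j. cls col (Done j)) ` {..<k} \<union> U ` P"
  have fr: "finite reps" by (simp add: reps_def)
  then have fP: "finite P" by (simp add: P_def)
  have PE: "P \<subseteq> ?E" by (auto simp: P_def reps_def)
  have done_mem: "u \<in> \<Union>\<D>" if "col u = Done j" for u j
    using that D(9)[OF that] unfolding \<D>_def cls_def by blast
  have hit: "\<exists>u\<in>\<Union>\<D>. u \<in> clq x" if x: "x \<in> ?E" for x
  proof -
    have xL: "x \<in> set L" using x E by blast
    have fin: "finite (clq x)" by (simp add: clq_def)
    have xc: "x \<in> clq x" using xL by (simp add: clq_def)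
    \<comment> \<open>The least vertex of the clique has no smaller neighbour outside
      \<open>S\<close>, so it is the one by which the clique is counted.\<close>
    define \<rho> where "\<rho> = Min (clq x)"
    have \<rho>: "\<rho> \<in> clq x" "\<And>u. u \<in> clq x \<Longrightarrow> \<rho> \<le> u"
      unfolding \<rho>_def using Min_in[OF fin] Min_le[OF fin] xc by auto
    have eq: "clq \<rho> = clq x" using clq_eq[OF xL \<rho>(1)] .
    have \<rho>E: "\<rho> \<in> ?E" using exposed_clq[OF x \<rho>(1)] .
    have "\<not> A u \<rho>" if "u \<in> set L" "u < \<rho>" for u
    proof
      assume "A u \<rho>"
      then have "u \<in> clq \<rho>" using that sym by (simp add: clq_def)
      then show False using \<rho>(2)[of u] that eq by simp
    qed
    then have rep: "\<rho> \<in> reps" using \<rho>E by (simp add: reps_def)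
    show ?thesis
    proof (cases "\<rho> \<in> P")
      case True
      then obtain u where "u \<in> U \<rho>" using U[OF \<rho>E] r by fastforce
      then show ?thesis using True U[OF \<rho>E] eq unfolding \<D>_def by blast
    next
      case False
      then show ?thesis using rep eq done_mem unfolding P_def by blast
    qed
  qed
  have "finite \<D>" using fP by (simp add: \<D>_def)
  moreover have "card \<D> \<le> kk"
  proof -
    have "card \<D> \<le> card ((\<lambda>j. cls col (Done j)) ` {..<k}) + card (U ` P)"
      unfolding \<D>_def by (rule card_Un_le)
    also have "\<dots> \<le> k + card reps"
      using card_image_le[of "{..<k}" "\<lambda>j. cls col (Done j)"] card_image_le[OF fP, of U]
        card_mono[OF fr, of P] by (auto simp: P_def)
    finally show ?thesis using F by simp
  qed
  moreover have "pairwise disjnt \<D>"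
  proof -
    have 1: "disjnt (cls col (Done j)) (cls col (Done j'))" if "j \<noteq> j'" for j j'
      using that by (auto simp: disjnt_def cls_def)
    have 2: "disjnt (cls col (Done j)) (U v)" "disjnt (U v) (cls col (Done j))" if "v \<in> P" for j v
      using that U[of v] PE by (auto simp: disjnt_def cls_def P_def)
    have 3: "disjnt (U v) (U w)" if "v \<in> P" "w \<in> P" "v \<noteq> w" for v w
    proof (rule ccontr)
      assume "\<not> disjnt (U v) (U w)"
      then obtain u where "u \<in> U v" "u \<in> U w" by (auto simp: disjnt_def)
      then have u: "u \<in> clq v" "u \<in> clq w" using U[of v] U[of w] PE that by auto
      have vw: "v \<in> set L" "w \<in> set L" using that PE E by auto
      have "clq v = clq w" using clq_eq[OF vw(1) u(1)] clq_eq[OF vw(2) u(2)] by simp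
      then have "w \<in> clq v" using vw by (simp add: clq_def)
      then have "A v w" "A w v" using that(3) sym by (auto simp: clq_def)
      then show False using that vw unfolding P_def reps_def by (auto simp: nat_neq_iff)
    qed
    show ?thesis
      unfolding pairwise_def
    proof (intro ballI impI)
      fix X Y assume XY: "X \<in> \<D>" "Y \<in> \<D>" "X \<noteq> Y"
      have "(\<exists>j. X = cls col (Done j)) \<or> (\<exists>v\<in>P. X = U v)" "(\<exists>j. Y = cls col (Done j)) \<or> (\<exists>v\<in>P. Y = U v)"
        using XY unfolding \<D>_def by blast+
      then show "disjnt X Y"
        using XY(3) by (elim disjE exE bexE) (metis 1, metis 2(2), metis 2(1), metis 3)
    qed
  qed
  moreover have "X \<subseteq> {..<n} \<and> unit X r" if X: "X \<in> \<D>" for X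
  proof (cases "X \<in> U ` P")
    case True
    then obtain v where v: "v \<in> P" "X = U v" by blast
    then have "v \<in> set L" "U v \<subseteq> clq v" "card (U v) = r" using PE E U by blast+
    then show ?thesis using unit_clq[of v X r] r v L by (auto simp: clq_def)
  next
    case False
    then obtain j where j: "j < k" "X = cls col (Done j)" using X False unfolding \<D>_def by blast
    have "v < n" if "v \<in> X" for v
      using that j D(8)[of v] S L set_take_subset[of i L] by (auto simp: cls_def)
    then show ?thesis using D(10)[OF j(1)] j by auto
  qed
  moreover have "\<exists>u\<in>\<Union>\<D>. v = u \<or> A u v" if v: "v < n" for v
  proof (cases "v \<in> set S")
    case True
    show ?thesis
    proof (cases "val fl v = vU \<or> val fl v = vD")
      case True1: True
      show ?thesis
      proof (cases "val fl v = vU")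
        case True
        then obtain x where x: "x \<in> ?E" "A x v" using F \<open>v \<in> set S\<close> by blast
        obtain u where u: "u \<in> \<Union>\<D>" "u \<in> clq x" using hit[OF x(1)] by blast
        have "A u v" using clq_twin[of x u v] x u E \<open>v \<in> set S\<close> by blast
        then show ?thesis using u by blast
      next
        case False
        then obtain u where "A u v" "col u \<noteq> Free" "col u \<noteq> Own" using D(17) True1 by blast
        then show ?thesis using noPend noCur done_mem by (metis colour.exhaust)
      qed
    next
      case False
      then have "\<exists>j. col v = Done j"
        using D(11)[OF True] noPend noCur by (cases "col v") auto
      then show ?thesis using done_mem by blast
    qed
  next
    case False
    then have vL: "v \<in> set L" using L v by simp
    show ?thesis
    proof (cases "v \<in> ?E")
      case True
      then obtain u where "u \<in> \<Union>\<D>" "u \<in> clq v" using hit by blast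
      then show ?thesis using sym by (auto simp: clq_def)
    next
      case False
      then obtain s where "s \<in> set S" "val fl s = vX" "A s v" using vL by (auto simp: exposed_iff)
      then show ?thesis using inv_vX[OF inv, of s] done_mem by blast
    qed
  qed
  ultimately show ?thesis unfolding gds_def by blast
qed

text \<open>A pending unit contains \<open>s\<close> and some \<open>v\<close> outside
  \<open>S\<close>. If these are all of it, the vertex of \<open>S\<close> that names it can only be
  \<open>s\<close>, so the label is determined by \<open>s\<close>.\<close>

lemma inv_Pend_size:
  assumes inv: "inv col (i, k, c, g, q, h, fl)" and s: "0 < fst (val fl s)"
  shows "2 \<le> snd (val fl s)" "snd (val fl s) < r" "\<exists>l\<in>set S. fst (val fl s) = Suc l"
    "snd (val fl s) = 2 \<Longrightarrow> val fl s = (Suc s, 2)"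
proof -
  let ?w = "val fl s"
  have sS: "s \<in> set S" and cs: "col s = Pend ?w"
    using inv_Pend[OF inv, of s] s by auto
  have po: "pend_ok col ?w" using invD(13)[OF inv cs] .
  then obtain v l where v: "v \<notin> set S" "col v = Pend ?w" and l: "l \<in> set S" "col l = Pend ?w" "fst ?w = Suc l"
    unfolding pend_ok_def by blast
  have fin: "finite (cls col (Pend ?w))" by (rule finite_cls[OF inv]) simp
  have card: "card (cls col (Pend ?w)) = snd ?w" "snd ?w < r"
    using po by (auto simp: pend_ok_def unit_def)
  have sv: "{s, v} \<subseteq> cls col (Pend ?w)" "card {s, v} = 2"
    using cs v sS by (auto simp: cls_def card_insert_if)
  then show "2 \<le> snd ?w" using card_mono[OF fin sv(1)] card by simp
  show "snd ?w < r" by (fact card)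
  show "\<exists>l\<in>set S. fst ?w = Suc l" using l by blast
  show "?w = (Suc s, 2)" if "snd ?w = 2"
  proof -
    have "{s, v} = cls col (Pend ?w)"
      using card_subset_eq[OF fin sv(1)] sv(2) card that by simp
    then have "l = s" using l v by (auto simp: cls_def)
    then show ?thesis using l that by (metis prod.collapse)
  qed
qed

lemma inv_val:
  assumes inv: "inv col (i, k, c, g, q, h, fl)"
  shows "val fl s \<in> {vU, vD, vX, vC} \<or> 0 < fst (val fl s)"
proof (cases "s \<in> set S")
  case True
  then show ?thesis using invD(11)[OF inv True] by (cases "col s") auto
qed (use invD(12)[OF inv] in auto)

lemma inv_card_vC:
  assumes inv: "inv col (i, k, c, g, q, h, fl)"
  shows "card {s. val fl s = vC} \<le> r" "finite {s. val fl s = vC}"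
proof -
  have sub: "{s. val fl s = vC} \<subseteq> cls col Cur" using inv_vC[OF inv] by (auto simp: cls_def)
  have fin: "finite (cls col Cur)" by (rule finite_cls[OF inv]) simp
  have "card (cls col Cur) \<le> r"
    using invD(3,15,16)[OF inv] by (cases "c = 0") (auto simp: unit_def)
  then show "card {s. val fl s = vC} \<le> r" using card_mono[OF fin sub] by simp
  show "finite {s. val fl s = vC}" using finite_subset[OF sub fin] .
qed

text \<open>Distinct cliques are not adjacent, so a connected set leaves the clique of
  \<open>v\<close> by an edge into \<open>S\<close>. That edge may start at another vertex of the
  clique, but twins share their neighbours in \<open>S\<close>, so \<open>v\<close> has the same
  neighbour.\<close>

lemma nbr_S:
  assumes X: "conn A X" "X \<subseteq> {..<n}" "X \<inter> set S \<noteq> {}" and v: "v \<in> X" "v \<notin> set S"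
  shows "\<exists>s\<in>X \<inter> set S. A v s"
proof -
  have vL: "v \<in> set L" using X v L by auto
  obtain s where s: "s \<in> X" "s \<in> set S" using X by blast
  then have "s \<notin> clq v" using L by (auto simp: clq_def)
  moreover have "v \<in> clq v" using vL by (simp add: clq_def)
  ultimately obtain a b where ab: "a \<in> X" "b \<in> X" "a \<in> clq v" "b \<notin> clq v" "A a b"
    using conn_crossing[OF X(1) v(1) _ s(1), of "clq v"] by metis
  have aL: "a \<in> set L" using ab by (simp add: clq_def)
  have "b \<in> set S"
  proof (rule ccontr)
    assume "b \<notin> set S"
    then have "b \<in> clq a" using ab X L by (auto simp: clq_def)
    then show False using clq_eq[OF vL ab(3)] ab by simp
  qed
  moreover have "A v b" using clq_twin[OF aL clq_sym[OF vL ab(3)] \<open>b \<in> set S\<close> ab(5)] .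
  ultimately show ?thesis using ab by blast
qed

text \<open>Without vertices of \<open>S\<close> a connected set has no edge along which it could
  leave a clique.\<close>

lemma own_clq:
  assumes X: "conn A X" "X \<subseteq> {..<n}" "X \<inter> set S = {}" and v: "v \<in> X"
  shows "X \<subseteq> clq v"
proof
  fix u assume u: "u \<in> X"
  have XL: "X \<subseteq> set L" using X L by auto
  have vL: "v \<in> set L" "v \<in> clq v" using XL v by (auto simp: clq_def)
  show "u \<in> clq v"
  proof (rule ccontr)
    assume "u \<notin> clq v"
    then obtain a b where ab: "a \<in> X" "b \<in> X" "a \<in> clq v" "b \<notin> clq v" "A a b"
      using conn_crossing[OF X(1) v vL(2) u] by metis
    then have "b \<in> clq a" using XL by (auto simp: clq_def)
    then show False using clq_eq[OF vL(1) ab(3)] ab by simp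
  qed
qed

end

subsection \<open>Completeness of the dynamic program\<close>

text \<open>
  \<open>F\<close> is the part of a solution that the program has to assemble; it has at most one unit inside
  each clique.
\<close>

locale target = machine +
  fixes F :: "nat set set"
  assumes fin_F: "finite F" and card_F: "card F \<le> kk"
    and F_unit: "T \<in> F \<Longrightarrow> T \<subseteq> {..<n} \<and> unit T r"
    and F_disj: "T \<in> F \<Longrightarrow> T' \<in> F \<Longrightarrow> v \<in> T \<Longrightarrow> v \<in> T' \<Longrightarrow> T = T'"
    and F_own: "T \<in> F \<Longrightarrow> T' \<in> F \<Longrightarrow> T \<inter> set S = {} \<Longrightarrow> T' \<inter> set S = {} \<Longrightarrow>
      v \<in> T \<Longrightarrow> w \<in> T' \<Longrightarrow> w \<in> clq v \<Longrightarrow> T = T'"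
begin

abbreviation R :: "mstate \<Rightarrow> bool" where
  "R \<equiv> reach (msucc M S L r kk) (minit n)"

text \<open>The vertices a run has had the opportunity to use: those of \<open>S\<close> at any
  time, the others once they are scanned.\<close>

definition avail :: "nat \<Rightarrow> nat \<Rightarrow> bool" where
  "avail i v \<longleftrightarrow> v \<in> set S \<or> v \<in> set (take i L)"

definition settled :: "(nat \<Rightarrow> colour) \<Rightarrow> nat \<Rightarrow> bool" where
  "settled col v \<longleftrightarrow> (\<exists>j. col v = Done j) \<or> (\<exists>w. col v = Pend w)"

text \<open>
  The run is on its way to \<open>F\<close>: the units in \<open>Z\<close> are finished and \<open>T\<close> is being assembled. Each
  piece of a unit has already absorbed the available vertices of the unit adjacent to it, except
  possibly at the start vertex \<open>g\<close>; so the forgotten vertices outside \<open>S\<close> are not needed again.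
\<close>

definition ci :: "nat set set \<Rightarrow> nat set \<Rightarrow> (nat \<Rightarrow> colour) \<Rightarrow> mstate \<Rightarrow> bool" where
  "ci Z T col = (\<lambda>(i, k, c, g, q, h, fl).
     (\<forall>j<k. cls col (Done j) \<in> F) \<and>
     (\<forall>w v. col v = Pend w \<longrightarrow> (\<exists>T'\<in>F. cls col (Pend w) \<subseteq> T' \<and>
        (\<forall>a b. col a = Pend w \<longrightarrow> b \<in> T' \<longrightarrow> avail i b \<longrightarrow> (0 < c \<longrightarrow> b \<noteq> g) \<longrightarrow> A a b \<longrightarrow> col b = Pend w))) \<and>
     (\<forall>v\<in>set (take i L). v \<in> \<Union>F \<longrightarrow> col v \<noteq> Free) \<and>
     (\<forall>T'\<in>Z. \<exists>j<k. cls col (Done j) = T') \<and>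
     (\<forall>s v. s \<in> set S \<longrightarrow> val fl s = vU \<longrightarrow> settled col v \<longrightarrow> \<not> A v s) \<and>
     (0 < q \<longrightarrow> q < r \<and> (\<exists>T'\<in>F. T' \<inter> set S = {} \<and> cls col Own = T' \<inter> set (take i L))) \<and>
     (0 < c \<longrightarrow> T \<in> F \<and> cls col Cur \<subseteq> T \<and> T \<inter> set S \<noteq> {} \<and> (g \<in> set S \<longrightarrow> T \<subseteq> set S) \<and>
       (\<forall>a. col a = Cur \<longrightarrow> a \<notin> set S \<longrightarrow> a \<noteq> g \<longrightarrow>
         (\<forall>b. b \<in> T \<longrightarrow> avail i b \<longrightarrow> b \<noteq> g \<longrightarrow> A a b \<longrightarrow> col b = Cur) \<and>
         (\<forall>s\<in>set S. val fl s = vU \<longrightarrow> \<not> A a s))))"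

lemma ciI:
  assumes "\<And>j. j < k \<Longrightarrow> cls col (Done j) \<in> F"
    and "\<And>w v. col v = Pend w \<Longrightarrow> \<exists>T'\<in>F. cls col (Pend w) \<subseteq> T' \<and>
        (\<forall>a b. col a = Pend w \<longrightarrow> b \<in> T' \<longrightarrow> avail i b \<longrightarrow> (0 < c \<longrightarrow> b \<noteq> g) \<longrightarrow> A a b \<longrightarrow> col b = Pend w)"
    and "\<And>v. v \<in> set (take i L) \<Longrightarrow> v \<in> \<Union>F \<Longrightarrow> col v \<noteq> Free"
    and "\<And>T'. T' \<in> Z \<Longrightarrow> \<exists>j<k. cls col (Done j) = T'"
    and "\<And>s v. s \<in> set S \<Longrightarrow> val fl s = vU \<Longrightarrow> settled col v \<Longrightarrow> \<not> A v s"
    and "0 < q \<Longrightarrow> q < r" "0 < q \<Longrightarrow> \<exists>T'\<in>F. T' \<inter> set S = {} \<and> cls col Own = T' \<inter> set (take i L)"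
    and "0 < c \<Longrightarrow> T \<in> F \<and> cls col Cur \<subseteq> T \<and> T \<inter> set S \<noteq> {} \<and> (g \<in> set S \<longrightarrow> T \<subseteq> set S)"
    and "\<And>a b. 0 < c \<Longrightarrow> col a = Cur \<Longrightarrow> a \<notin> set S \<Longrightarrow> a \<noteq> g \<Longrightarrow> b \<in> T \<Longrightarrow> avail i b \<Longrightarrow> b \<noteq> g
        \<Longrightarrow> A a b \<Longrightarrow> col b = Cur"
    and "\<And>a s. 0 < c \<Longrightarrow> col a = Cur \<Longrightarrow> a \<notin> set S \<Longrightarrow> a \<noteq> g \<Longrightarrow> s \<in> set S \<Longrightarrow> val fl s = vU
        \<Longrightarrow> \<not> A a s"
  shows "ci Z T col (i, k, c, g, q, h, fl)"
  unfolding ci_def prod.case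
  apply (intro conjI allI impI ballI)
            apply (rule assms(1), assumption)
           apply (rule assms(2), assumption)
          apply (rule assms(3), assumption, assumption)
         apply (rule assms(4), assumption)
        apply (rule assms(5), assumption+)
       apply (rule assms(6), assumption)
      apply (rule assms(7), assumption)
     apply (use assms(8) in \<open>blast+\<close>)[4]
   apply (rule assms(9), assumption+)
  apply (rule assms(10), assumption+)
  done

lemma ciD:
  assumes "ci Z T col (i, k, c, g, q, h, fl)"
  shows "\<And>j. j < k \<Longrightarrow> cls col (Done j) \<in> F"
    and "\<And>w v. col v = Pend w \<Longrightarrow> \<exists>T'\<in>F. cls col (Pend w) \<subseteq> T' \<and>
        (\<forall>a b. col a = Pend w \<longrightarrow> b \<in> T' \<longrightarrow> avail i b \<longrightarrow> (0 < c \<longrightarrow> b \<noteq> g) \<longrightarrow> A a b \<longrightarrow> col b = Pend w)"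
    and "\<And>v. v \<in> set (take i L) \<Longrightarrow> v \<in> \<Union>F \<Longrightarrow> col v \<noteq> Free"
    and "\<And>T'. T' \<in> Z \<Longrightarrow> \<exists>j<k. cls col (Done j) = T'"
    and "\<And>s v. s \<in> set S \<Longrightarrow> val fl s = vU \<Longrightarrow> settled col v \<Longrightarrow> \<not> A v s"
    and "0 < q \<Longrightarrow> q < r" "0 < q \<Longrightarrow> \<exists>T'\<in>F. T' \<inter> set S = {} \<and> cls col Own = T' \<inter> set (take i L)"
    and "0 < c \<Longrightarrow> T \<in> F \<and> cls col Cur \<subseteq> T \<and> T \<inter> set S \<noteq> {} \<and> (g \<in> set S \<longrightarrow> T \<subseteq> set S)"
    and "\<And>a b. 0 < c \<Longrightarrow> col a = Cur \<Longrightarrow> a \<notin> set S \<Longrightarrow> a \<noteq> g \<Longrightarrow> b \<in> T \<Longrightarrow> avail i b \<Longrightarrow> b \<noteq> g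
        \<Longrightarrow> A a b \<Longrightarrow> col b = Cur"
    and "\<And>a s. 0 < c \<Longrightarrow> col a = Cur \<Longrightarrow> a \<notin> set S \<Longrightarrow> a \<noteq> g \<Longrightarrow> s \<in> set S \<Longrightarrow> val fl s = vU
        \<Longrightarrow> \<not> A a s"
proof -
  note h1 = assms[unfolded ci_def prod.case, THEN conjunct1]
    and h2 = assms[unfolded ci_def prod.case, THEN conjunct2, THEN conjunct1]
    and h3 = assms[unfolded ci_def prod.case, THEN conjunct2, THEN conjunct2, THEN conjunct1]
    and h4 = assms[unfolded ci_def prod.case, THEN conjunct2, THEN conjunct2, THEN conjunct2, THEN conjunct1]
    and h5 = assms[unfolded ci_def prod.case, THEN conjunct2, THEN conjunct2, THEN conjunct2, THEN conjunct2, THEN conjunct1]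
    and h6 = assms[unfolded ci_def prod.case, THEN conjunct2, THEN conjunct2, THEN conjunct2, THEN conjunct2, THEN conjunct2, THEN conjunct1]
    and h7 = assms[unfolded ci_def prod.case, THEN conjunct2, THEN conjunct2, THEN conjunct2, THEN conjunct2, THEN conjunct2, THEN conjunct2]
  show "cls col (Done j) \<in> F" if "j < k" for j using h1 that by blast
  show "\<exists>T'\<in>F. cls col (Pend w) \<subseteq> T' \<and> (\<forall>a b. col a = Pend w \<longrightarrow> b \<in> T' \<longrightarrow> avail i b \<longrightarrow>
      (0 < c \<longrightarrow> b \<noteq> g) \<longrightarrow> A a b \<longrightarrow> col b = Pend w)" if "col v = Pend w" for w v
    using h2[rule_format, OF that] by simp
  show "col v \<noteq> Free" if "v \<in> set (take i L)" "v \<in> \<Union>F" for v using h3 that by simp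
  show "\<exists>j<k. cls col (Done j) = T'" if "T' \<in> Z" for T' using h4 that by blast
  show "\<not> A v s" if "s \<in> set S" "val fl s = vU" "settled col v" for s v using h5 that by blast
  show "0 < q \<Longrightarrow> q < r" "0 < q \<Longrightarrow> \<exists>T'\<in>F. T' \<inter> set S = {} \<and> cls col Own = T' \<inter> set (take i L)"
    using h6 by blast+
  show "0 < c \<Longrightarrow> T \<in> F \<and> cls col Cur \<subseteq> T \<and> T \<inter> set S \<noteq> {} \<and> (g \<in> set S \<longrightarrow> T \<subseteq> set S)"
    using h7 by blast
  show "col b = Cur" if "0 < c" "col a = Cur" "a \<notin> set S" "a \<noteq> g" "b \<in> T" "avail i b" "b \<noteq> g" "A a b" for a b
    using h7 that by blast
  show "\<not> A a s" if "0 < c" "col a = Cur" "a \<notin> set S" "a \<noteq> g" "s \<in> set S" "val fl s = vU" for a s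
    using h7 that by blast
qed

section \<open>Growing one unit of the target\<close>

lemma memb_iff: "memb v S \<longleftrightarrow> v \<in> set S"
  by (auto simp: memb_def list_ex_iff)

lemma R_step:
  assumes "R st" "st' \<in> set (msucc M S L r kk st)"
  shows "R st'"
  using assms unfolding reach_def by (rule rtranclp.rtrancl_into_rtrancl)

lemma done_eq:
  assumes "ci Z T col (i, k, c, g, q, h, fl)" "inv col (i, k, c, g, q, h, fl)"
    "T' \<in> F" "v \<in> T'" "col v = Done j"
  shows "cls col (Done j) = T'" "j < k"
proof -
  show "j < k" using invD(9)[OF assms(2,5)] .
  then have "cls col (Done j) \<in> F" by (rule ciD(1)[OF assms(1)])
  then show "cls col (Done j) = T'" using F_disj[of _ T' v] assms by (simp add: cls_def)
qed

lemma pend_sub: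
  assumes "ci Z T col (i, k, c, g, q, h, fl)" "T' \<in> F" "v \<in> T'" "col v = Pend w"
  shows "cls col (Pend w) \<subseteq> T'"
    and "\<And>a b. col a = Pend w \<Longrightarrow> b \<in> T' \<Longrightarrow> avail i b \<Longrightarrow> (0 < c \<Longrightarrow> b \<noteq> g) \<Longrightarrow> A a b \<Longrightarrow> col b = Pend w"
proof -
  obtain T'' where T'': "T'' \<in> F" "cls col (Pend w) \<subseteq> T''"
    "\<forall>a b. col a = Pend w \<longrightarrow> b \<in> T'' \<longrightarrow> avail i b \<longrightarrow> (0 < c \<longrightarrow> b \<noteq> g) \<longrightarrow> A a b \<longrightarrow> col b = Pend w"
    using ciD(2)[OF assms(1,4)] by blast
  have "T'' = T'" using F_disj[OF T''(1) assms(2) _ assms(3)] T''(2) assms(4) by (auto simp: cls_def)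
  then show "cls col (Pend w) \<subseteq> T'"
    "\<And>a b. col a = Pend w \<Longrightarrow> b \<in> T' \<Longrightarrow> avail i b \<Longrightarrow> (0 < c \<Longrightarrow> b \<noteq> g) \<Longrightarrow> A a b \<Longrightarrow> col b = Pend w"
    using T'' by blast+
qed

text \<open>A vertex of \<open>T'\<close> without finished colour shows that \<open>T'\<close>
  itself is not finished. The finished units thus inject into \<open>F\<close> without
  \<open>T'\<close>, which opens the guard of the finishing moves.\<close>

lemma count_done:
  assumes ci: "ci Z T col (i, k, c, g, q, h, fl)" and inv: "inv col (i, k, c, g, q, h, fl)"
    and T': "T' \<in> F" "v \<in> T'" "\<And>j. col v \<noteq> Done j"
  shows "k < kk"
proof -
  let ?D = "\<lambda>j. cls col (Done j)"
  have "inj_on ?D {..<k}"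
  proof (rule inj_onI)
    fix x y assume xy: "x \<in> {..<k}" "y \<in> {..<k}" "?D x = ?D y"
    then have "?D x \<noteq> {}" using invD(10)[OF inv, of x] by (auto simp: unit_def conn_def)
    then obtain v where "col v = Done x" by (auto simp: cls_def)
    moreover then have "col v = Done y" using xy(3) by (auto simp: cls_def set_eq_iff)
    ultimately show "x = y" by simp
  qed
  moreover have "?D ` {..<k} \<subseteq> F - {T'}"
    using ciD(1)[OF ci] T'(2,3) by (auto simp: cls_def)
  ultimately have "k \<le> card (F - {T'})"
    using card_inj_on_le[of ?D "{..<k}" "F - {T'}"] fin_F by simp
  then show ?thesis
    using T' fin_F card_F by (metis card_Diff1_less order_less_le_trans order_le_less_trans)
qed

text \<open>The state in which no further vertex of \<open>S\<close> and no pending piece of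
  \<open>T\<close> can be attached.\<close>

definition saturated :: "nat set \<Rightarrow> (nat \<Rightarrow> colour) \<Rightarrow> nat \<Rightarrow> val list \<Rightarrow> bool" where
  "saturated T col g fl \<longleftrightarrow> (\<forall>s\<in>T \<inter> set S. touch M g fl s \<longrightarrow> col s \<noteq> Free \<and> (\<forall>w. col s \<noteq> Pend w))"

text \<open>Every free vertex or pending piece of \<open>T\<close> that is touched can be taken in
  without leaving \<open>T\<close>. Each such move enlarges the current unit, whose size is limited
  by \<open>card T = r\<close>, so saturation is reached.\<close>

lemma grow:
  assumes "R (i, k, c, g, q, h, fl)" "inv col (i, k, c, g, q, h, fl)" "ci Z T col (i, k, c, g, q, h, fl)"
    and "0 < c"
  shows "\<exists>c' fl' col'. R (i, k, c', g, q, h, fl') \<and> inv col' (i, k, c', g, q, h, fl') \<and>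
    ci Z T col' (i, k, c', g, q, h, fl') \<and> 0 < c' \<and> saturated T col' g fl'"
  using assms
proof (induction "r - c" arbitrary: c fl col rule: less_induct)
  case less
  note R = less.prems(1) and inv = less.prems(2) and ci = less.prems(3) and c = less.prems(4)
  note D = invD[OF inv] and C = ciD[OF ci]
  have T: "T \<in> F" "cls col Cur \<subseteq> T" using C(8) c by auto
  have uT: "finite T" "card T = r" using F_unit[OF T(1)] r by (auto simp: unit_def intro: card_ge_0_finite)
  have cK: "card (cls col Cur) = c" using D(15)[OF c] by (simp add: unit_def)
  show ?case
  proof (cases "saturated T col g fl")
    case True
    then show ?thesis using less.prems by blast
  next
    case False
    then obtain s where s: "s \<in> T" "s \<in> set S" "touch M g fl s" "col s = Free \<or> (\<exists>w. col s = Pend w)"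
      by (auto simp: saturated_def)
    show ?thesis
    proof (cases "col s = Free")
      case True
      have "cls col Cur \<subset> T" using T s True by (auto simp: cls_def)
      then have cr: "c < r" using psubset_card_mono[OF uT(1)] cK uT(2) by metis
      let ?fl = "upd fl s vC" and ?col = "col(s := Cur)"
      have sn: "s < length fl" using S s D(7) by auto
      have inv': "inv ?col (i, k, Suc c, g, q, h, ?fl)"
        by (rule inv_upd_Cur[OF inv s(2) True]) (use c cr s in auto)
      have "R (i, k, Suc c, g, q, h, ?fl)"
        by (rule R_step[OF R]) (use c cr s True inv_S_free[OF inv, of s] in \<open>auto simp: msucc_def\<close>)
      moreover have "ci Z T ?col (i, k, Suc c, g, q, h, ?fl)"
      proof (rule ciI)
        have eq: "cls ?col (Done j) = cls col (Done j)" "cls ?col (Pend w) = cls col (Pend w)"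
            "cls ?col Own = cls col Own" for j w
          using True by (simp_all add: cls_upd(2))
        show "cls ?col (Done j) \<in> F" if "j < k" for j using C(1)[OF that] eq by simp
        show "\<exists>T'\<in>F. cls ?col (Pend w) \<subseteq> T' \<and> (\<forall>a b. ?col a = Pend w \<longrightarrow> b \<in> T' \<longrightarrow> avail i b \<longrightarrow>
            (0 < Suc c \<longrightarrow> b \<noteq> g) \<longrightarrow> A a b \<longrightarrow> ?col b = Pend w)" if v: "?col v = Pend w" for w v
        proof -
          have v: "col v = Pend w" using v by (auto split: if_splits)
          obtain T' where T': "T' \<in> F" "cls col (Pend w) \<subseteq> T'"
            "\<forall>a b. col a = Pend w \<longrightarrow> b \<in> T' \<longrightarrow> avail i b \<longrightarrow> (0 < c \<longrightarrow> b \<noteq> g) \<longrightarrow> A a b \<longrightarrow> col b = Pend w"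
            using C(2)[OF v] by blast
          have "?col b = Pend w" if "?col a = Pend w" "b \<in> T'" "avail i b" "b \<noteq> g" "A a b" for a b
          proof -
            have "col a = Pend w" using that(1) by (auto split: if_splits)
            then have "col b = Pend w" using T'(3) that by blast
            then show ?thesis using True by auto
          qed
          then show ?thesis using T'(1,2) eq(2) by (intro bexI[of _ T']) auto
        qed
        show "?col v \<noteq> Free" if "v \<in> set (take i L)" "v \<in> \<Union>F" for v using C(3)[OF that] by auto
        show "\<exists>j<k. cls ?col (Done j) = T'" if "T' \<in> Z" for T' using C(4)[OF that] eq by simp
        show "\<not> A v t" if "t \<in> set S" "val ?fl t = vU" "settled ?col v" for t v
          using C(5)[of t v] that by (auto simp: val_upd[OF sn] settled_def split: if_splits)
        show "0 < q \<Longrightarrow> q < r" "0 < q \<Longrightarrow> \<exists>T'\<in>F. T' \<inter> set S = {} \<and> cls ?col Own = T' \<inter> set (take i L)"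
          using C(6,7) eq(3) by auto
        show "T \<in> F \<and> cls ?col Cur \<subseteq> T \<and> T \<inter> set S \<noteq> {} \<and> (g \<in> set S \<longrightarrow> T \<subseteq> set S)"
          using C(8)[OF c] s by (auto simp: cls_upd(1))
        show "?col b = Cur" if "?col a = Cur" "a \<notin> set S" "a \<noteq> g" "b \<in> T" "avail i b" "b \<noteq> g" "A a b" for a b
        proof -
          have "col a = Cur" using that s by (auto split: if_splits)
          then show ?thesis using C(9)[OF c, of a b] that by auto
        qed
        show "\<not> A a t" if "?col a = Cur" "a \<notin> set S" "a \<noteq> g" "t \<in> set S" "val ?fl t = vU" for a t
        proof -
          have "col a = Cur" using that s by (auto split: if_splits)
          then show ?thesis using C(10)[OF c, of a t] that by (auto simp: val_upd[OF sn] split: if_splits)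
        qed
      qed
      ultimately show ?thesis
        using less.hyps[OF _ _ inv'] cr by auto
    next
      case False
      then obtain w where cs: "col s = Pend w" using s(4) by blast
      have w: "val fl s = w" "0 < fst (val fl s)" using inv_Pend[OF inv, of s] cs s by auto
      note P = pend_sub[OF ci T(1) s(1) cs]
      let ?fl = "relab fl w vC" and ?col = "recol (Pend w) Cur col"
      have fin: "finite (cls col Cur)" "finite (cls col (Pend w))" using finite_cls[OF inv] by auto
      have cP: "card (cls col (Pend w)) = snd w"
        using D(13)[OF cs] by (simp add: pend_ok_def unit_def)
      moreover have "s \<in> cls col (Pend w)" using cs by (simp add: cls_def)
      \<comment> \<open>A pending piece is nonempty, so absorbing it makes progress in the
        induction.\<close>
      ultimately have cP2: "0 < snd w" using fin(2) by (metis card_gt_0_iff empty_iff)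
      have "card (cls col Cur \<union> cls col (Pend w)) = c + snd w"
        using card_Un_disjoint[OF fin] cK cP by (simp add: cls_def disjoint_iff)
      moreover have "card (cls col Cur \<union> cls col (Pend w)) \<le> r"
        using card_mono[OF uT(1)] T P(1) uT(2) by (metis Un_least)
      ultimately have cr: "c + snd w \<le> r" by simp
      have inv': "inv ?col (i, k, c + snd w, g, q, h, ?fl)"
        using inv_absorb[OF inv s(2) w(2) c _ s(3)] cr w by simp
      have "R (i, k, c + snd w, g, q, h, ?fl)"
        by (rule R_step[OF R]) (use c cr s w in \<open>auto simp: msucc_def image_iff\<close>)
      moreover have "ci Z T ?col (i, k, c + snd w, g, q, h, ?fl)"
      proof (rule ciI)
        have eq: "cls ?col (Done j) = cls col (Done j)" "cls ?col Own = cls col Own" for j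
          by (simp_all add: cls_recol(3))
        have wU: "w \<noteq> vU" using w by auto
        have U: "val ?fl t = vU \<Longrightarrow> val fl t = vU" for t
          by (auto simp: val_relab[OF wU] split: if_splits)
        show "cls ?col (Done j) \<in> F" if "j < k" for j using C(1)[OF that] eq by simp
        show "\<exists>T'\<in>F. cls ?col (Pend w') \<subseteq> T' \<and> (\<forall>a b. ?col a = Pend w' \<longrightarrow> b \<in> T' \<longrightarrow> avail i b \<longrightarrow>
            (0 < c + snd w \<longrightarrow> b \<noteq> g) \<longrightarrow> A a b \<longrightarrow> ?col b = Pend w')" if v: "?col v = Pend w'" for w' v
        proof -
          have v: "col v = Pend w'" "w' \<noteq> w" using v by (auto simp: recol_def split: if_splits)
          obtain T' where T': "T' \<in> F" "cls col (Pend w') \<subseteq> T'"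
            "\<forall>a b. col a = Pend w' \<longrightarrow> b \<in> T' \<longrightarrow> avail i b \<longrightarrow> (0 < c \<longrightarrow> b \<noteq> g) \<longrightarrow> A a b \<longrightarrow> col b = Pend w'"
            using C(2)[OF v(1)] by blast
          have col': "?col a = Pend w' \<longleftrightarrow> col a = Pend w'" for a using v(2) by (auto simp: recol_def)
          show ?thesis
            unfolding col' using T' c v(2) by (intro bexI[of _ T']) (auto simp: cls_recol(3))
        qed
        show "?col v \<noteq> Free" if "v \<in> set (take i L)" "v \<in> \<Union>F" for v using C(3)[OF that] by (auto simp: recol_def)
        show "\<exists>j<k. cls ?col (Done j) = T'" if "T' \<in> Z" for T' using C(4)[OF that] eq by simp
        show "\<not> A v t" if "t \<in> set S" "val ?fl t = vU" "settled ?col v" for t v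
          using C(5)[of t v] U that by (auto simp: settled_def recol_def split: if_splits)
        show "0 < q \<Longrightarrow> q < r" "0 < q \<Longrightarrow> \<exists>T'\<in>F. T' \<inter> set S = {} \<and> cls ?col Own = T' \<inter> set (take i L)"
          using C(6,7) eq by auto
        show "T \<in> F \<and> cls ?col Cur \<subseteq> T \<and> T \<inter> set S \<noteq> {} \<and> (g \<in> set S \<longrightarrow> T \<subseteq> set S)"
          using C(8)[OF c] P(1) by (auto simp: cls_recol(1))
        show "?col b = Cur" if "?col a = Cur" "a \<notin> set S" "a \<noteq> g" "b \<in> T" "avail i b" "b \<noteq> g" "A a b" for a b
        proof (cases "col a = Cur")
          case True
          then show ?thesis using C(9)[OF c, of a b] that by (simp add: recol_def)
        next
          case False
          then have "col a = Pend w" using that by (auto simp: recol_def split: if_splits)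
          then show ?thesis using P(2)[of a b] that by (simp add: recol_def)
        qed
        show "\<not> A a t" if "?col a = Cur" "a \<notin> set S" "a \<noteq> g" "t \<in> set S" "val ?fl t = vU" for a t
        proof (cases "col a = Cur")
          case True
          then show ?thesis using C(10)[OF c, of a t] U that by auto
        next
          case False
          \<comment> \<open>The vertex came with the absorbed piece; its neighbours in
            \<open>S\<close> were marked when that piece was put aside.\<close>
          then have "settled col a" using that by (auto simp: recol_def settled_def split: if_splits)
          then show ?thesis using C(5)[of t a] U that by blast
        qed
      qed
      ultimately show ?thesis
        using less.hyps[OF _ _ inv'] cr cP2 c by auto
    qed
  qed
qed

end

section \<open>Finishing a unit or putting it aside\<close>

context target
begin

lemma inv_avail: "inv col (i, k, c, g, q, h, fl) \<Longrightarrow> col v \<noteq> Free \<Longrightarrow> avail i v"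
  using invD(8) by (fastforce simp: avail_def)

lemma ci_idle: "ci Z T col (i, k, 0, g, q, h, fl) \<Longrightarrow> ci Z T' col (i, k, 0, g', q, h, fl)"
  unfolding ci_def by simp

lemma F_card: "T \<in> F \<Longrightarrow> finite T \<and> card T = r \<and> conn A T"
  using F_unit[of T] r by (auto simp: unit_def intro: card_ge_0_finite)

text \<open>Absorbed vertices outside \<open>S\<close> are covered by the closure property of their
  former piece, vertices \<open>b\<close> in \<open>S\<close> by saturation. A scanned
  \<open>b\<close> outside \<open>S\<close> is coloured, so the point is to exclude that it sits in
  another piece: the closure of that piece would have claimed \<open>a\<close>, unless
  \<open>a\<close> is the start vertex \<open>g\<close>, which appeared later.\<close>

lemma saturated_closed:
  assumes inv: "inv col (i, k, c, g, q, h, fl)" and ci: "ci Z T col (i, k, c, g, q, h, fl)"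
    and c: "0 < c" and sat: "saturated T col g fl"
    and ab: "col a = Cur" "b \<in> T" "avail i b" "A a b"
  shows "col b = Cur"
proof (cases "b = g \<or> (a \<notin> set S \<and> a \<noteq> g)")
  case True
  then show ?thesis using invD(14)[OF inv c] ciD(9)[OF ci c ab(1) _ _ ab(2,3) _ ab(4)] by blast
next
  case False
  note D = invD[OF inv] and C = ciD[OF ci]
  have T: "T \<in> F" "g \<in> T" "a \<in> T" using C(8)[OF c] D(14)[OF c] ab(1) by (auto simp: cls_def)
  have nDone: "col b \<noteq> Done j" for j
    using done_eq[OF ci inv T(1) ab(2), of j] T(2) D(14)[OF c] by (auto simp: cls_def)
  have t: "touch M g fl b" if "b \<in> set S"
    unfolding inv_touch[OF inv] using False ab by auto
  show ?thesis
  proof (cases "b \<in> set S")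
    case True
    then have "col b \<noteq> Free" "\<And>w. col b \<noteq> Pend w" using sat t ab(2) by (auto simp: saturated_def)
    moreover have "col b \<noteq> Own" using D(20)[of b] True by auto
    ultimately show ?thesis using nDone by (cases "col b") auto
  next
    case bS: False
    then have b: "b \<in> set (take i L)" using ab(3) by (simp add: avail_def)
    then have "col b \<noteq> Free" using C(3) ab(2) T(1) by blast
    moreover have "col b \<noteq> Own"
    proof
      \<comment> \<open>The unit inside the clique would have to be \<open>T\<close> itself, but
        \<open>T\<close> meets \<open>S\<close>.\<close>
      assume o: "col b = Own"
      then have "0 < q" using D(19) finite_cls[OF inv, of Own] by (auto simp: cls_def card_gt_0_iff)
      then obtain T' where T': "T' \<in> F" "T' \<inter> set S = {}" "cls col Own = T' \<inter> set (take i L)"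
        using C(7) by blast
      then have "b \<in> T'" using o by (auto simp: cls_def)
      then have "T' = T" using F_disj T'(1) T(1) ab(2) by blast
      then show False using T'(2) C(8)[OF c] by blast
    qed
    moreover have "col b \<noteq> Pend w" for w
    proof
      assume p: "col b = Pend w"
      note P = pend_sub[OF ci T(1) ab(2) p]
      show False
      proof (cases "a = g")
        case False
        then have "col a = Pend w"
          using P(2)[of b a] p T(3) inv_avail[OF inv, of a] ab sym by auto
        then show False using ab by simp
      next
        case True
        \<comment> \<open>Here \<open>g\<close> and \<open>b\<close> are twins. The piece of
          \<open>b\<close> contains a neighbour of \<open>b\<close> in \<open>S\<close>, which is
          then adjacent to \<open>g\<close> too and would have been absorbed.\<close>
        have gS: "g \<notin> set S" using C(8)[OF c] bS ab(2) by blast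
        have po: "pend_ok col w" using D(13)[OF p] .
        have "cls col (Pend w) \<inter> set S \<noteq> {}" "conn A (cls col (Pend w))"
          using po by (auto simp: pend_ok_def unit_def cls_def)
        moreover have "cls col (Pend w) \<subseteq> {..<n}" using P(1) F_unit[OF T(1)] by blast
        moreover have "b \<in> cls col (Pend w)" using p by (simp add: cls_def)
        ultimately obtain s where s: "s \<in> set S" "col s = Pend w" "A b s"
          using nbr_S[of "cls col (Pend w)" b] bS by (auto simp: cls_def)
        have "A g s"
          using twin[of b g s] bS gS sym ab(4) s True by auto
        then have "touch M g fl s" unfolding inv_touch[OF inv] by simp
        moreover have "s \<in> T" using P(1) s by (auto simp: cls_def)
        ultimately show False using sat s unfolding saturated_def by blast
      qed
    qed
    ultimately show ?thesis using nDone by (cases "col b") auto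
  qed
qed

text \<open>A saturated piece of size \<open>r\<close> equals \<open>T\<close>. A smaller one leaves
  \<open>T\<close> only along edges to vertices not yet scanned, so it may be put aside without
  losing a connection. The obligation in that case is a vertex of \<open>S\<close> by which to name
  it.\<close>

lemma finish:
  assumes R: "R (i, k, c, g, q, h, fl)" and inv: "inv col (i, k, c, g, q, h, fl)"
    and ci: "ci Z T col (i, k, c, g, q, h, fl)" and c: "0 < c" and sat: "saturated T col g fl"
  shows "\<exists>k' fl' col'. R (i, k', 0, 0, q, h, fl') \<and> inv col' (i, k', 0, 0, q, h, fl') \<and>
    ci Z T col' (i, k', 0, 0, q, h, fl') \<and> (T \<subseteq> set S \<longrightarrow> (\<exists>j<k'. cls col' (Done j) = T))"
proof -
  note D = invD[OF inv] and C = ciD[OF ci] and closed = saturated_closed[OF inv ci c sat]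
  have T: "T \<in> F" "cls col Cur \<subseteq> T" "T \<inter> set S \<noteq> {}" "g \<in> set S \<Longrightarrow> T \<subseteq> set S" using C(8)[OF c] by auto
  have gC: "col g = Cur" "g \<in> T" using D(14)[OF c] T(2) by (auto simp: cls_def)
  note uT = F_card[OF T(1)]
  have cK: "card (cls col Cur) = c" using D(15)[OF c] by (simp add: unit_def)
  note v = inv_settle_val[OF inv]
  \<comment> \<open>Three sources: \<open>touch\<close> handles \<open>g\<close> and the vertices of
    \<open>S\<close> in the current unit, the invariant handles its other vertices and all settled
    ones.\<close>
  have U: "\<not> A u s" if "s \<in> set S" "val (settle M S g fl w) s = vU" "w \<noteq> vU" "settled col u \<or> col u = Cur" for u s w
  proof -
    have 1: "val fl s = vU" "\<not> touch M g fl s"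
      using that(1,2,3) v[of w s] by (cases "col s = Cur"; cases "val fl s = vU"; cases "touch M g fl s"; simp)+
    show ?thesis
    proof (cases "settled col u")
      case True
      then show ?thesis using C(5)[OF that(1) 1(1)] by blast
    next
      case False
      then have "col u = Cur" using that by blast
      then show ?thesis
        using C(10)[OF c _ _ _ that(1) 1(1), of u] 1(2)[unfolded inv_touch[OF inv]] by blast
    qed
  qed
  show ?thesis
  proof (cases "c = r")
    case True
    then have KT: "cls col Cur = T" using card_subset_eq[of T "cls col Cur"] uT T(2) cK by simp
    have k: "k < kk" by (rule count_done[OF ci inv T(1) gC(2)]) (use gC in auto)
    have no: "cls col (Done k) = {}" using D(9) by (auto simp: cls_def)
    let ?col = "recol Cur (Done k) col" and ?fl = "settle M S g fl vX"
    have inv': "inv ?col (i, Suc k, 0, 0, q, h, ?fl)"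
      by (rule inv_done[OF inv[unfolded True] k])
    have R': "R (i, Suc k, 0, 0, q, h, ?fl)"
      by (rule R_step[OF R]) (use True k in \<open>simp add: msucc_def\<close>)
    have dk: "cls ?col (Done k) = T" using KT no by (simp add: cls_recol(1))
    have dj: "cls ?col (Done j) = cls col (Done j)" if "j < k" for j using that by (simp add: cls_recol(3))
    have "ci Z T ?col (i, Suc k, 0, 0, q, h, ?fl)"
    proof (rule ciI)
      show "cls ?col (Done j) \<in> F" if "j < Suc k" for j
        using C(1)[of j] dj[of j] dk T(1) that by (cases "j = k") auto
      show "\<exists>T'\<in>F. cls ?col (Pend w) \<subseteq> T' \<and> (\<forall>a b. ?col a = Pend w \<longrightarrow> b \<in> T' \<longrightarrow> avail i b \<longrightarrow>
            (0 < (0::nat) \<longrightarrow> b \<noteq> 0) \<longrightarrow> A a b \<longrightarrow> ?col b = Pend w)" if v: "?col v = Pend w" for w v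
      proof -
        have cp: "?col a = Pend w \<longleftrightarrow> col a = Pend w" for a by (auto simp: recol_def)
        have v: "col v = Pend w" using v cp by simp
        obtain T' where T': "T' \<in> F" "cls col (Pend w) \<subseteq> T'"
            "\<forall>a b. col a = Pend w \<longrightarrow> b \<in> T' \<longrightarrow> avail i b \<longrightarrow> (0 < c \<longrightarrow> b \<noteq> g) \<longrightarrow> A a b \<longrightarrow> col b = Pend w"
          using C(2)[OF v] by blast
        \<comment> \<open>The closure of pending pieces exempted \<open>g\<close> while it was the
          start vertex. The exemption ends here, so \<open>g\<close> must be shown to lie in another
          unit.\<close>
        have "g \<notin> T'"
        proof
          assume "g \<in> T'"
          then have "T' = T" using F_disj T'(1) T(1) gC(2) by blast
          then have "v \<in> cls col Cur" using T'(2) v KT by (auto simp: cls_def)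
          then show False using v by (simp add: cls_def)
        qed
        then show ?thesis
          unfolding cp using T' by (intro bexI[of _ T']) (auto simp: cls_recol(3))
      qed
      show "?col v \<noteq> Free" if "v \<in> set (take i L)" "v \<in> \<Union>F" for v using C(3)[OF that] by (auto simp: recol_def)
      show "\<exists>j<Suc k. cls ?col (Done j) = T'" if "T' \<in> Z" for T'
        using C(4)[OF that] dj by (metis less_SucI)
      show "\<not> A u t" if "t \<in> set S" "val ?fl t = vU" "settled ?col u" for t u
        by (rule U[OF that(1,2)]) (use that(3) in \<open>auto simp: settled_def recol_def split: if_splits\<close>)
      show "0 < q \<Longrightarrow> q < r" "0 < q \<Longrightarrow> \<exists>T'\<in>F. T' \<inter> set S = {} \<and> cls ?col Own = T' \<inter> set (take i L)"
        using C(6,7) by (auto simp: cls_recol(3))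
    qed auto
    then show ?thesis using R' inv' dk by blast
  next
    case False
    then have cr: "c < r" using D(3) by simp
    have "cls col Cur \<noteq> T" using cK uT False by auto
    then obtain b0 where b0: "b0 \<in> T" "b0 \<notin> cls col Cur" using T(2) by blast
    have gK: "g \<in> cls col Cur" using gC by (simp add: cls_def)
    obtain a b where ab: "a \<in> T" "b \<in> T" "a \<in> cls col Cur" "b \<notin> cls col Cur" "A a b"
      using conn_crossing[of A T g "cls col Cur" b0, OF _ gC(2) gK b0] uT by blast
    have nb: "\<not> avail i b" using closed[of a b] ab by (auto simp: cls_def)
    \<comment> \<open>A start in \<open>S\<close> is reserved for units contained in
      \<open>S\<close>, all of whose vertices are available. So \<open>g\<close> lies outside
      \<open>S\<close>, and its neighbour \<open>s\<close> in \<open>T\<close> and \<open>S\<close>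
      is in the piece by closure and can name it.\<close>
    then have gS: "g \<notin> set S" using T(4) ab(2) by (auto simp: avail_def)
    obtain s where s: "s \<in> T" "s \<in> set S" "A g s"
      using nbr_S[of T g] uT F_unit[OF T(1)] T(3) gC(2) gS by blast
    have sC: "col s = Cur" by (rule closed[OF gC(1) s(1) _ s(3)]) (simp add: avail_def s)
    let ?w = "(Suc s, c)"
    let ?col = "recol Cur (Pend ?w) col" and ?fl = "settle M S g fl ?w"
    have no: "cls col (Pend ?w) = {}"
      using D(13)[of _ ?w] sC by (auto simp: cls_def pend_ok_def)
    have inv': "inv ?col (i, k, 0, 0, q, h, ?fl)"
      by (rule inv_pend[OF inv c cr gS s(2) sC])
    have "(i, k, 0, 0, q, h, ?fl) \<in> (\<lambda>s. (i, k, 0, 0, q, h, settle M S g fl (Suc s, c))) `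
        {s \<in> set S. val fl s = vC}"
      by (rule image_eqI[of _ _ s]) (use s sC inv_vC[OF inv, of s] in simp_all)
    then have R': "R (i, k, 0, 0, q, h, ?fl)"
      by (intro R_step[OF R]) (use c cr gS in \<open>simp add: msucc_def memb_iff; blast\<close>)
    have eq: "cls ?col (Done j) = cls col (Done j)" "cls ?col Own = cls col Own" for j
      by (simp_all add: cls_recol(3))
    have "ci Z T ?col (i, k, 0, 0, q, h, ?fl)"
    proof (rule ciI)
      show "cls ?col (Done j) \<in> F" if "j < k" for j using C(1)[OF that] eq by simp
      show "\<exists>T'\<in>F. cls ?col (Pend w) \<subseteq> T' \<and> (\<forall>a b. ?col a = Pend w \<longrightarrow> b \<in> T' \<longrightarrow> avail i b \<longrightarrow>
            (0 < (0::nat) \<longrightarrow> b \<noteq> 0) \<longrightarrow> A a b \<longrightarrow> ?col b = Pend w)" if v: "?col v = Pend w" for w v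
      proof (cases "w = ?w")
        case True
        have cp: "?col a = Pend w \<longleftrightarrow> col a = Cur" for a
          using no True by (auto simp: recol_def cls_def)
        have "cls ?col (Pend w) = cls col Cur" using cp by (auto simp: cls_def)
        then show ?thesis
          unfolding cp using T(1,2) closed by (intro bexI[of _ T]) auto
      next
        case False
        have cp: "?col a = Pend w \<longleftrightarrow> col a = Pend w" for a using False by (auto simp: recol_def)
        have v: "col v = Pend w" using v cp by simp
        obtain T' where T': "T' \<in> F" "cls col (Pend w) \<subseteq> T'"
            "\<forall>a b. col a = Pend w \<longrightarrow> b \<in> T' \<longrightarrow> avail i b \<longrightarrow> (0 < c \<longrightarrow> b \<noteq> g) \<longrightarrow> A a b \<longrightarrow> col b = Pend w"
          using C(2)[OF v] by blast
        \<comment> \<open>The exempted case \<open>b = g\<close> cannot arise: both ends would lie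
          in \<open>T\<close>, and closure of the current piece would have taken in
          \<open>a\<close>.\<close>
        have "col b = Pend w" if x: "col a = Pend w" "b \<in> T'" "avail i b" "A a b" for a b
        proof (cases "b = g")
          case True
          have "a \<in> T'" using T'(2) x(1) by (auto simp: cls_def)
          moreover have "T' = T" using F_disj T'(1) T(1) gC(2) x(2) True by blast
          ultimately have "col a = Cur"
            using closed[OF gC(1), of a] inv_avail[OF inv, of a] x True sym by auto
          then show ?thesis using x by simp
        qed (use T'(3) x in blast)
        moreover have "cls ?col (Pend w) = cls col (Pend w)" using cp by (auto simp: cls_def)
        ultimately show ?thesis
          unfolding cp using T'(1,2) by (intro bexI[of _ T']) auto
      qed
      show "?col v \<noteq> Free" if "v \<in> set (take i L)" "v \<in> \<Union>F" for v using C(3)[OF that] by (auto simp: recol_def)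
      show "\<exists>j<k. cls ?col (Done j) = T'" if "T' \<in> Z" for T'
        using C(4)[OF that] eq by simp
      show "\<not> A u t" if "t \<in> set S" "val ?fl t = vU" "settled ?col u" for t u
        by (rule U[OF that(1,2)]) (use that(3) in \<open>auto simp: settled_def recol_def split: if_splits\<close>)
      show "0 < q \<Longrightarrow> q < r" "0 < q \<Longrightarrow> \<exists>T'\<in>F. T' \<inter> set S = {} \<and> cls ?col Own = T' \<inter> set (take i L)"
        using C(6,7) eq by auto
    qed auto
    moreover have "\<not> T \<subseteq> set S" using nb ab(2) by (auto simp: avail_def)
    ultimately show ?thesis using R' inv' by blast
  qed
qed

text \<open>Units contained in \<open>S\<close> are never triggered by a scanned vertex, so they are
  assembled one by one before the scan begins.\<close>

lemma phase_S:
  assumes "finite Z" "Z \<subseteq> {T \<in> F. T \<subseteq> set S}"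
  shows "\<exists>k fl col. R (0, k, 0, 0, 0, 0, fl) \<and> inv col (0, k, 0, 0, 0, 0, fl) \<and> ci Z {} col (0, k, 0, 0, 0, 0, fl)"
  using assms
proof (induction Z rule: finite_induct)
  case empty
  have "ci {} {} (\<lambda>_. Free) (minit n)"
    by (auto simp: ci_def minit_def settled_def)
  moreover have "R (minit n)" by (simp add: reach_def)
  ultimately show ?case using inv_init unfolding minit_def by blast
next
  case (insert T Z)
  then obtain k fl col where R: "R (0, k, 0, 0, 0, 0, fl)" and inv: "inv col (0, k, 0, 0, 0, 0, fl)"
    and ci: "ci Z {} col (0, k, 0, 0, 0, 0, fl)" by blast
  note D = invD[OF inv] and C = ciD[OF ci]
  have T: "T \<in> F" "T \<subseteq> set S" using insert.prems by auto
  then obtain s where s: "s \<in> T" "s \<in> set S" using F_card[OF T(1)] T(2) unfolding conn_def by blast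
  have ins: "ci (insert T Z) {} col' (0, k', 0, 0, 0, 0, fl')"
    if "ci Z T' col' (0, k', 0, 0, 0, 0, fl')" "\<exists>j<k'. cls col' (Done j) = T" for T' col' k' fl'
    using that unfolding ci_def by simp
  show ?case
  proof (cases "\<exists>j. col s = Done j")
    case True
    then have "\<exists>j<k. cls col (Done j) = T" using done_eq[OF ci inv T(1) s(1)] by blast
    then show ?thesis using R inv ins[OF ci] by blast
  next
    case False
    \<comment> \<open>A pending unit contains a scanned vertex outside \<open>S\<close>, and none is
      scanned yet.\<close>
    have "col s \<noteq> Pend w" for w
      using D(13)[of s w] D(8) by (auto simp: pend_ok_def)
    moreover have "col s \<noteq> Own" using D(20)[of s] s by auto
    moreover have "col s \<noteq> Cur" using D(16) by (auto simp: cls_def)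
    ultimately have free: "col s = Free" using False by (cases "col s") auto
    let ?col = "col(s := Cur)" and ?fl = "upd fl s vC"
    have sn: "s < length fl" using S s D(7) by auto
    have inv': "inv ?col (0, k, Suc 0, s, 0, 0, ?fl)"
      by (rule inv_upd_Cur[OF inv s(2) free]) simp
    have R': "R (0, k, Suc 0, s, 0, 0, ?fl)"
      by (rule R_step[OF R]) (use s free inv_S_free[OF inv, of s] in \<open>auto simp: msucc_def\<close>)
    have "ci Z T ?col (0, k, Suc 0, s, 0, 0, ?fl)"
    proof (rule ciI)
      have eq: "cls ?col (Done j) = cls col (Done j)" for j
        using free by (simp add: cls_upd(2))
      show "cls ?col (Done j) \<in> F" if "j < k" for j using C(1)[OF that] eq by simp
      show "\<exists>T'\<in>F. cls ?col (Pend w) \<subseteq> T' \<and> (\<forall>a b. ?col a = Pend w \<longrightarrow> b \<in> T' \<longrightarrow> avail 0 b \<longrightarrow>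
            (0 < Suc 0 \<longrightarrow> b \<noteq> s) \<longrightarrow> A a b \<longrightarrow> ?col b = Pend w)" if v: "?col v = Pend w" for w v
      proof -
        have "col v = Pend w" using v by (auto split: if_splits)
        then show ?thesis using D(13)[of v w] D(8) by (auto simp: pend_ok_def)
      qed
      show "\<exists>j<k. cls ?col (Done j) = T'" if "T' \<in> Z" for T' using C(4)[OF that] eq by simp
      show "\<not> A v t" if "t \<in> set S" "val ?fl t = vU" "settled ?col v" for t v
        using C(5)[of t v] that by (auto simp: val_upd[OF sn] settled_def split: if_splits)
      have "cls col Cur = {}" using D(16) by simp
      then show "T \<in> F \<and> cls ?col Cur \<subseteq> T \<and> T \<inter> set S \<noteq> {} \<and> (s \<in> set S \<longrightarrow> T \<subseteq> set S)"
        using T s by (auto simp: cls_upd(1))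
    qed (use s D(16) in \<open>auto simp: cls_def split: if_splits\<close>)
    then obtain c fl' col' where "R (0, k, c, s, 0, 0, fl')" "inv col' (0, k, c, s, 0, 0, fl')"
      "ci Z T col' (0, k, c, s, 0, 0, fl')" "0 < c" "saturated T col' s fl'"
      using grow[OF R' inv'] by blast
    from finish[OF this] T(2) obtain k' fl'' col'' where "R (0, k', 0, 0, 0, 0, fl'')"
      "inv col'' (0, k', 0, 0, 0, 0, fl'')" "ci Z T col'' (0, k', 0, 0, 0, 0, fl'')"
      "\<exists>j<k'. cls col'' (Done j) = T" by blast
    then show ?thesis using ins by blast
  qed
qed

end

section \<open>Scanning the vertices outside the cover\<close>

context target
begin

lemma avail_Suc: "i < length L \<Longrightarrow> avail (Suc i) v \<longleftrightarrow> avail i v \<or> v = L ! i"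
  by (auto simp: avail_def take_Suc_L)

text \<open>The unit of the next vertex decides the move: skip if there is none; start a unit, grow
  it and close it again if the unit meets \<open>S\<close>; extend the unit inside the clique
  otherwise. Between two vertices no unit is current.\<close>

lemma phase_L_step:
  assumes R: "R (i, k, 0, 0, q, h, fl)" and inv: "inv col (i, k, 0, 0, q, h, fl)"
    and ci: "ci Z {} col (i, k, 0, 0, q, h, fl)" and i: "i < length L"
  shows "\<exists>k' q' h' fl' col'. R (Suc i, k', 0, 0, q', h', fl') \<and> inv col' (Suc i, k', 0, 0, q', h', fl') \<and>
    ci Z {} col' (Suc i, k', 0, 0, q', h', fl')"
proof -
  note D = invD[OF inv] and C = ciD[OF ci] and Li = L_nth[OF i] and free = inv_L_free[OF inv i]
  have nth: "nth_default 0 L i = L ! i" using i by (simp add: nth_default_def)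
  have noCur: "col v \<noteq> Cur" for v using D(16) by (auto simp: cls_def)
  consider (skip) "L ! i \<notin> \<Union>F" | (S) T where "T \<in> F" "L ! i \<in> T" "T \<inter> set S \<noteq> {}"
    | (own) T where "T \<in> F" "L ! i \<in> T" "T \<inter> set S = {}"
    by blast
  then show ?thesis
  proof cases
    case skip
    have inv': "inv col (Suc i, k, 0, 0, q, h, fl)" by (rule inv_skip[OF inv i])
    have R': "R (Suc i, k, 0, 0, q, h, fl)"
      by (rule R_step[OF R]) (use i in \<open>simp add: msucc_def\<close>)
    have "ci Z {} col (Suc i, k, 0, 0, q, h, fl)"
    proof (rule ciI)
      show "\<exists>T'\<in>F. cls col (Pend w) \<subseteq> T' \<and> (\<forall>a b. col a = Pend w \<longrightarrow> b \<in> T' \<longrightarrow> avail (Suc i) b \<longrightarrow>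
            (0 < (0::nat) \<longrightarrow> b \<noteq> 0) \<longrightarrow> A a b \<longrightarrow> col b = Pend w)" if v: "col v = Pend w" for w v
      proof -
        obtain T' where T': "T' \<in> F" "cls col (Pend w) \<subseteq> T'"
            "\<forall>a b. col a = Pend w \<longrightarrow> b \<in> T' \<longrightarrow> avail i b \<longrightarrow> (0 < (0::nat) \<longrightarrow> b \<noteq> 0) \<longrightarrow> A a b \<longrightarrow> col b = Pend w"
          using C(2)[OF v] by blast
        moreover have "avail (Suc i) b \<longleftrightarrow> avail i b" if "b \<in> T'" for b
          using avail_Suc[OF i, of b] skip T'(1) that by blast
        ultimately show ?thesis by (intro bexI[of _ T']) simp_all
      qed
      show "col v \<noteq> Free" if "v \<in> set (take (Suc i) L)" "v \<in> \<Union>F" for v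
        using C(3)[of v] that skip by (auto simp: take_Suc_L[OF i])
      show "\<exists>T'\<in>F. T' \<inter> set S = {} \<and> cls col Own = T' \<inter> set (take (Suc i) L)" if q: "0 < q"
      proof -
        obtain T' where "T' \<in> F" "T' \<inter> set S = {}" "cls col Own = T' \<inter> set (take i L)"
          using C(7)[OF q] by blast
        moreover then have "T' \<inter> set (take (Suc i) L) = T' \<inter> set (take i L)"
          using skip by (auto simp: take_Suc_L[OF i])
        ultimately show ?thesis by metis
      qed
    qed (use C(1,4,5,6) in auto)
    then show ?thesis using R' inv' by blast
  next
    case (S T)
    let ?g = "L ! i" and ?col = "col(L ! i := Cur)"
    have inv': "inv ?col (Suc i, k, 1, ?g, q, h, fl)" by (rule inv_startL[OF inv i])
    have R': "R (Suc i, k, 1, ?g, q, h, fl)"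
      by (rule R_step[OF R]) (use i nth in \<open>simp add: msucc_def\<close>)
    have eq: "cls ?col (Done j) = cls col (Done j)" "cls ?col Own = cls col Own" "cls ?col (Pend w) = cls col (Pend w)" for j w
      using free by (simp_all add: cls_upd(2))
    have ci': "ci Z T ?col (Suc i, k, 1, ?g, q, h, fl)"
    proof (rule ciI)
      show "cls ?col (Done j) \<in> F" if "j < k" for j using C(1)[OF that] eq by simp
      show "\<exists>T'\<in>F. cls ?col (Pend w) \<subseteq> T' \<and> (\<forall>a b. ?col a = Pend w \<longrightarrow> b \<in> T' \<longrightarrow> avail (Suc i) b \<longrightarrow>
            (0 < (1::nat) \<longrightarrow> b \<noteq> ?g) \<longrightarrow> A a b \<longrightarrow> ?col b = Pend w)" if v: "?col v = Pend w" for w v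
      proof -
        have cp: "?col a = Pend w \<longleftrightarrow> col a = Pend w" for a using free by auto
        have v: "col v = Pend w" using v cp by blast
        obtain T' where T': "T' \<in> F" "cls col (Pend w) \<subseteq> T'"
            "\<forall>a b. col a = Pend w \<longrightarrow> b \<in> T' \<longrightarrow> avail i b \<longrightarrow> (0 < (0::nat) \<longrightarrow> b \<noteq> 0) \<longrightarrow> A a b \<longrightarrow> col b = Pend w"
          using C(2)[OF v] by blast
        have "col b = Pend w" if "col a = Pend w" "b \<in> T'" "avail (Suc i) b" "b \<noteq> ?g" "A a b" for a b
          using T'(3) that avail_Suc[OF i, of b] by blast
        then show ?thesis
          unfolding cp eq using T'(1,2) by (intro bexI[of _ T']) simp_all
      qed
      show "?col v \<noteq> Free" if "v \<in> set (take (Suc i) L)" "v \<in> \<Union>F" for v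
        using C(3)[of v] that by (auto simp: take_Suc_L[OF i])
      show "\<exists>j<k. cls ?col (Done j) = T'" if "T' \<in> Z" for T' using C(4)[OF that] eq by simp
      show "\<not> A v s" if "s \<in> set S" "val fl s = vU" "settled ?col v" for s v
        using C(5)[OF that(1,2), of v] that(3) by (auto simp: settled_def split: if_splits)
      show "\<exists>T'\<in>F. T' \<inter> set S = {} \<and> cls ?col Own = T' \<inter> set (take (Suc i) L)" if q: "0 < q"
      proof -
        obtain T' where T': "T' \<in> F" "T' \<inter> set S = {}" "cls col Own = T' \<inter> set (take i L)"
          using C(7)[OF q] by blast
        have "L ! i \<notin> T'" using F_disj[OF S(1) T'(1) S(2)] S(3) T'(2) by blast
        then have "T' \<inter> set (take (Suc i) L) = T' \<inter> set (take i L)"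
          by (auto simp: take_Suc_L[OF i])
        then show ?thesis using T' eq(2) by metis
      qed
      show "T \<in> F \<and> cls ?col Cur \<subseteq> T \<and> T \<inter> set S \<noteq> {} \<and> (?g \<in> set S \<longrightarrow> T \<subseteq> set S)"
        using S Li D(16) by (auto simp: cls_upd(1))
      show "?col b = Cur" if "?col a = Cur" "a \<noteq> ?g" for a b
        using that noCur by auto
      show "\<not> A a s" if "?col a = Cur" "a \<noteq> ?g" for a s
        using that noCur by auto
    qed (use C(6) in auto)
    then obtain c fl' col' where "R (Suc i, k, c, ?g, q, h, fl')" "inv col' (Suc i, k, c, ?g, q, h, fl')"
      "ci Z T col' (Suc i, k, c, ?g, q, h, fl')" "0 < c" "saturated T col' ?g fl'"
      using grow[OF R' inv' ci'] by auto
    from finish[OF this] obtain k' fl'' col'' where "R (Suc i, k', 0, 0, q, h, fl'')"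
      "inv col'' (Suc i, k', 0, 0, q, h, fl'')" "ci Z T col'' (Suc i, k', 0, 0, q, h, fl'')" by blast
    then show ?thesis using ci_idle by blast
  next
    case (own T)
    note uT = F_card[OF own(1)]
    have Tn: "T \<subseteq> {..<n}" using F_unit[OF own(1)] by blast
    have clqT: "T \<subseteq> clq v" if "v \<in> T" for v
      using own_clq[of T v] uT Tn own(3) that by blast
    have qr: "q < r" using C(6) r by (cases "q = 0") auto
    have fO: "finite (cls col Own)" by (rule finite_cls[OF inv]) simp
    \<comment> \<open>One register \<open>Own\<close> must suffice for all units inside cliques: if
      it is in use, it already holds the scanned part of this very \<open>T\<close>.\<close>
    have Own: "cls col Own = T \<inter> set (take i L) \<and> (0 < q \<longrightarrow> A h (L ! i))"
    proof (cases "q = 0")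
      case True
      have "col v \<noteq> Own" for v using D(19) True fO by (auto simp: cls_def)
      moreover have "v \<notin> T" if "v \<in> set (take i L)" for v
      proof
        assume v: "v \<in> T"
        then have "col v \<noteq> Free" using C(3)[OF that] own(1) by blast
        moreover have "col v \<noteq> Done j" for j
          using done_eq[OF ci inv own(1) v, of j] own(2) free by (auto simp: cls_def)
        moreover have "col v \<noteq> Pend w" for w
        proof
          assume p: "col v = Pend w"
          obtain s where "s \<in> set S" "col s = Pend w" using D(13)[OF p] by (auto simp: pend_ok_def)
          then show False using pend_sub(1)[OF ci own(1) v p] own(3) by (auto simp: cls_def)
        qed
        ultimately show False using noCur \<open>\<And>v. col v \<noteq> Own\<close> by (cases "col v") auto
      qed
      ultimately show ?thesis using True by (auto simp: cls_def)
    next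
      case False
      then obtain T' where T': "T' \<in> F" "T' \<inter> set S = {}" "cls col Own = T' \<inter> set (take i L)"
        using C(7) by blast
      have hO: "h \<in> T'" "h \<in> set (take i L)" using D(18) False T'(3) by (auto simp: cls_def)
      note uT' = F_card[OF T'(1)]
      have T'c: "T' \<subseteq> clq h"
        using own_clq[of T' h] uT' F_unit[OF T'(1)] T'(2) hO(1) by blast
      have "L ! i \<in> clq h"
      proof (cases "L ! i \<in> T'")
        case True
        then show ?thesis using T'c by blast
      next
        case notin: False
        \<comment> \<open>The incomplete unit still has a vertex \<open>x\<close> to come. The
          current vertex stands between \<open>h\<close> and \<open>x\<close>, so it belongs to
          their clique by contiguity, and a clique has only one such unit.\<close>
        have "T' \<noteq> T' \<inter> set (take i L)" using D(19) T'(3) qr uT' by auto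
        then obtain x where x: "x \<in> T'" "x \<notin> set (take i L)" by blast
        then have "x \<in> set L" using F_unit[OF T'(1)] T'(2) L by auto
        then obtain b where b: "b < length L" "x = L ! b" by (auto simp: in_set_conv_nth)
        have "\<not> b < i"
          using x(2) b i by (auto simp: in_set_conv_nth)
        then have ib: "i < b" using notin x(1) b(2) by (cases "b = i") auto
        obtain a where a: "a < i" "h = L ! a" using hO(2) i by (auto simp: in_set_conv_nth)
        have "x \<noteq> h" using x(2) hO(2) by blast
        then have "A (L ! a) (L ! b)" using T'c x(1) a b by (auto simp: clq_def)
        then have "A (L ! a) (L ! i)" using contig[OF a(1) ib b(1)] by simp
        then show ?thesis using a i by (auto simp: clq_def)
      qed
      moreover then have "T' = T" using F_own[OF T'(1) own(1) T'(2) own(3) hO(1) own(2)] by blast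
      moreover have "L ! i \<noteq> h" using hO(2) Li by auto
      ultimately show ?thesis using T'(3) by (auto simp: clq_def)
    qed
    let ?col = "col(L ! i := Own)" and ?h = "if q = 0 then L ! i else h"
    have inv': "inv ?col (Suc i, k, 0, 0, Suc q, ?h, fl)"
      by (rule inv_own_add[OF inv i qr]) (use Own in auto)
    have "(Suc i, k, 0, 0, Suc q, ?h, fl) \<in> set (msucc M S L r kk (i, k, 0, 0, q, h, fl))"
      using i qr Own nth by (cases "q = 0") (simp_all add: msucc_def)
    then have R': "R (Suc i, k, 0, 0, Suc q, ?h, fl)" by (rule R_step[OF R])
    have eq: "cls ?col (Done j) = cls col (Done j)" "cls ?col (Pend w) = cls col (Pend w)" for j w
      using free by (simp_all add: cls_upd(2))
    have own': "cls ?col Own = T \<inter> set (take (Suc i) L)"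
      using Own own(2) by (auto simp: cls_upd(1) take_Suc_L[OF i])
    have cp: "?col a = Pend w \<longleftrightarrow> col a = Pend w" for a w using free by auto
    have pend: "\<exists>T'\<in>F. cls ?col (Pend w) \<subseteq> T' \<and> (\<forall>a b. ?col a = Pend w \<longrightarrow> b \<in> T' \<longrightarrow> avail (Suc i) b \<longrightarrow>
            (0 < (0::nat) \<longrightarrow> b \<noteq> 0) \<longrightarrow> A a b \<longrightarrow> ?col b = Pend w)" if v: "?col v = Pend w" for w v
    proof -
      have v: "col v = Pend w" using v cp by blast
      obtain T' where T': "T' \<in> F" "cls col (Pend w) \<subseteq> T'"
          "\<forall>a b. col a = Pend w \<longrightarrow> b \<in> T' \<longrightarrow> avail i b \<longrightarrow> (0 < (0::nat) \<longrightarrow> b \<noteq> 0) \<longrightarrow> A a b \<longrightarrow> col b = Pend w"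
        using C(2)[OF v] by blast
      have "L ! i \<notin> T'"
      proof
        assume "L ! i \<in> T'"
        then have "T' = T" using F_disj T'(1) own(1,2) by blast
        moreover obtain s where "s \<in> set S" "col s = Pend w" using D(13)[OF v] by (auto simp: pend_ok_def)
        ultimately show False using T'(2) own(3) by (auto simp: cls_def)
      qed
      then have "col b = Pend w" if "col a = Pend w" "b \<in> T'" "avail (Suc i) b" "A a b" for a b
        using T'(3) that avail_Suc[OF i, of b] by blast
      then show ?thesis
        unfolding cp eq using T'(1,2) by (intro bexI[of _ T']) simp_all
    qed
    have ntc: "?col v \<noteq> Free" if "v \<in> set (take (Suc i) L)" "v \<in> \<Union>F" for v
      using C(3)[of v] that by (auto simp: take_Suc_L[OF i])
    have ns: "\<not> A v s" if "s \<in> set S" "val fl s = vU" "settled ?col v" for s v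
      using C(5)[OF that(1,2), of v] that(3) by (auto simp: settled_def split: if_splits)
    show ?thesis
    proof (cases "Suc q = r")
      case False
      have "ci Z {} ?col (Suc i, k, 0, 0, Suc q, ?h, fl)"
      proof (rule ciI)
        show "Suc q < r" using qr False by simp
        show "cls ?col (Done j) \<in> F" if "j < k" for j using C(1)[OF that] eq by simp
        show "\<exists>j<k. cls ?col (Done j) = T'" if "T' \<in> Z" for T' using C(4)[OF that] eq by simp
        show "\<exists>T'\<in>F. T' \<inter> set S = {} \<and> cls ?col Own = T' \<inter> set (take (Suc i) L)"
          using own own' by blast
        show "\<exists>T'\<in>F. cls ?col (Pend w) \<subseteq> T' \<and> (\<forall>a b. ?col a = Pend w \<longrightarrow> b \<in> T' \<longrightarrow> avail (Suc i) b \<longrightarrow>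
            (0 < (0::nat) \<longrightarrow> b \<noteq> 0) \<longrightarrow> A a b \<longrightarrow> ?col b = Pend w)" if "?col v = Pend w" for w v
          by (rule pend[OF that])
        show "?col v \<noteq> Free" if "v \<in> set (take (Suc i) L)" "v \<in> \<Union>F" for v by (rule ntc[OF that])
        show "\<not> A v s" if "s \<in> set S" "val fl s = vU" "settled ?col v" for s v by (rule ns[OF that])
      qed simp_all
      then show ?thesis using R' inv' by blast
    next
      case True
      have k: "k < kk" by (rule count_done[OF ci inv own(1,2)]) (use free in auto)
      have "card (cls ?col Own) = r" using invD(19)[OF inv'] True by simp
      moreover have "cls ?col Own \<subseteq> T" unfolding own' by simp
      ultimately have OT: "cls ?col Own = T"
        using card_subset_eq[of T "cls ?col Own"] uT by simp
      let ?col' = "recol Own (Done k) ?col" and ?fl = "settle_own M S ?h fl"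
      have inv'': "inv ?col' (Suc i, Suc k, 0, 0, 0, 0, ?fl)"
        by (rule inv_own_done[OF inv'[unfolded True] k])
      have R'': "R (Suc i, Suc k, 0, 0, 0, 0, ?fl)"
        by (rule R_step[OF R']) (use True k in \<open>simp add: msucc_def\<close>)
      have no: "cls ?col (Done k) = {}" using D(9) by (auto simp: cls_def)
      have dk: "cls ?col' (Done k) = T" using OT no by (simp add: cls_recol(1))
      have dj: "cls ?col' (Done j) = cls col (Done j)" if "j < k" for j
        using that eq by (simp add: cls_recol(3))
      have vfl: "val ?fl v = (if v \<in> set S \<and> val fl v = vU \<and> A ?h v then vD else val fl v)" for v
        using S D(7) by (auto simp: val_settle_own)
      have "?col ?h = Own" by (rule invD(18)[OF inv']) simp
      then have hT: "?h \<in> T" using OT by (simp only: cls_def mem_Collect_eq set_eq_iff)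
      have "ci Z {} ?col' (Suc i, Suc k, 0, 0, 0, 0, ?fl)"
      proof (rule ciI)
        show "cls ?col' (Done j) \<in> F" if "j < Suc k" for j
          using C(1)[of j] dj[of j] dk own(1) that by (cases "j = k") auto
        show "\<exists>T'\<in>F. cls ?col' (Pend w) \<subseteq> T' \<and> (\<forall>a b. ?col' a = Pend w \<longrightarrow> b \<in> T' \<longrightarrow> avail (Suc i) b \<longrightarrow>
            (0 < (0::nat) \<longrightarrow> b \<noteq> 0) \<longrightarrow> A a b \<longrightarrow> ?col' b = Pend w)" if v: "?col' v = Pend w" for w v
        proof -
          have cp': "?col' a = Pend w \<longleftrightarrow> ?col a = Pend w" for a by (simp add: recol_def)
          have "cls ?col' (Pend w) = cls ?col (Pend w)" by (simp add: cls_recol(3))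
          then show ?thesis using pend[of v w] v unfolding cp' by simp
        qed
        show "?col' v \<noteq> Free" if "v \<in> set (take (Suc i) L)" "v \<in> \<Union>F" for v
          using ntc[OF that] by (simp add: recol_def)
        show "\<exists>j<Suc k. cls ?col' (Done j) = T'" if "T' \<in> Z" for T'
          using C(4)[OF that] dj by (metis less_SucI)
        show "\<not> A v s" if s: "s \<in> set S" "val ?fl s = vU" "settled ?col' v" for s v
        proof -
          have 1: "val fl s = vU" "\<not> A ?h s" using s(1,2) vfl[of s] by (auto split: if_splits)
          show ?thesis
          proof (cases "settled ?col v")
            case True
            then show ?thesis using ns[OF s(1) 1(1)] by blast
          next
            case False
            \<comment> \<open>The vertices finished just now share their neighbours in
              \<open>S\<close> with \<open>?h\<close>, whose neighbours have been marked.\<close>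
            then have "?col v = Own" using s(3) unfolding settled_def recol_def by (metis colour.distinct(19))
            then have "v \<in> T" using OT by (simp only: cls_def mem_Collect_eq set_eq_iff)
            then have "?h \<in> clq v" "v \<in> set L" using clqT[of v] hT by (auto simp: clq_def)
            then show ?thesis using clq_twin[OF _ _ s(1)] 1(2) by blast
          qed
        qed
      qed auto
      then show ?thesis using R'' inv'' by blast
    qed
  qed
qed

lemma phase_L:
  "i \<le> length L \<Longrightarrow> \<exists>k q h fl col. R (i, k, 0, 0, q, h, fl) \<and> inv col (i, k, 0, 0, q, h, fl) \<and>
    ci {T \<in> F. T \<subseteq> set S} {} col (i, k, 0, 0, q, h, fl)"
proof (induction i)
  case 0
  have "finite {T \<in> F. T \<subseteq> set S}" using fin_F by simp
  from phase_S[OF this subset_refl] show ?case by blast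
next
  case (Suc i)
  then have i: "i < length L" by simp
  obtain k q h fl col where "R (i, k, 0, 0, q, h, fl)" "inv col (i, k, 0, 0, q, h, fl)"
    "ci {T \<in> F. T \<subseteq> set S} {} col (i, k, 0, 0, q, h, fl)"
    using Suc by auto
  from phase_L_step[OF this i] show ?case by blast
qed

text \<open>After the scan every vertex is available. The closure of a pending piece then gives a
  whole unit, contradicting its size below \<open>r\<close>; for the same reason no unit inside a
  clique is incomplete.\<close>

lemma path:
  obtains st i k q h fl col where "st = (i, k, 0, 0, q, h, fl)" "R st" "inv col st" "k = card F"
    "\<And>v w. col v \<noteq> Pend w" "\<And>v. v \<in> \<Union>F \<longleftrightarrow> (\<exists>j. col v = Done j)"
    "\<And>s v. s \<in> set S \<Longrightarrow> val fl s = vU \<Longrightarrow> v \<in> \<Union>F \<Longrightarrow> \<not> A v s"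
proof -
  define i where "i = length L"
  obtain k q h fl col where R: "R (i, k, 0, 0, q, h, fl)" and inv: "inv col (i, k, 0, 0, q, h, fl)"
    and ci: "ci {T \<in> F. T \<subseteq> set S} {} col (i, k, 0, 0, q, h, fl)"
    using phase_L[of i] by (auto simp: i_def)
  note D = invD[OF inv] and C = ciD[OF ci]
  have av: "avail i v" if "v < n" for v using that L by (auto simp: avail_def i_def)
  have noPend: "col v \<noteq> Pend w" for v w
  proof
    assume p: "col v = Pend w"
    then obtain T where T: "T \<in> F" "v \<in> T" using C(2)[OF p] by (auto simp: cls_def)
    note P = pend_sub[OF ci T p]
    have Tn: "T \<subseteq> {..<n}" using F_unit[OF T(1)] by blast
    \<comment> \<open>An edge of \<open>T\<close> leaving the piece would contradict closure, since
      its far end is available.\<close>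
    have "T \<subseteq> cls col (Pend w)"
    proof
      fix b assume b: "b \<in> T"
      show "b \<in> cls col (Pend w)"
      proof (rule ccontr)
        assume nb: "b \<notin> cls col (Pend w)"
        obtain x y where "x \<in> T" "y \<in> T" "x \<in> cls col (Pend w)" "y \<notin> cls col (Pend w)" "A x y"
          using conn_crossing[of A T v "cls col (Pend w)" b, OF _ T(2) _ b nb] F_card[OF T(1)] p
          by (auto simp: cls_def)
        then show False using P(2)[of x y] av[of y] Tn by (auto simp: cls_def)
      qed
    qed
    then have "cls col (Pend w) = T" using P(1) by blast
    moreover have "card (cls col (Pend w)) = snd w" "snd w < r"
      using D(13)[OF p] by (simp_all add: pend_ok_def unit_def)
    ultimately show False using F_card[OF T(1)] by simp
  qed
  have q0: "q = 0"
  proof (rule ccontr)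
    assume "q \<noteq> 0"
    then obtain T where T: "T \<in> F" "T \<inter> set S = {}" "cls col Own = T \<inter> set (take i L)" "q < r"
      using C(6,7) by auto
    have "T \<subseteq> set L" using F_unit[OF T(1)] T(2) L by auto
    then have "cls col Own = T" using T(3) by (auto simp: i_def)
    then show False using D(19) F_card[OF T(1)] T(4) by simp
  qed
  have nO: "col v \<noteq> Own" for v
    using D(19) q0 finite_cls[OF inv, of Own] by (auto simp: cls_def)
  have nC: "col v \<noteq> Cur" for v using D(16) by (auto simp: cls_def)
  have all: "\<exists>j<k. cls col (Done j) = T" if T: "T \<in> F" for T
  proof (cases "T \<subseteq> set S")
    case True
    then show ?thesis using C(4)[of T] T by blast
  next
    case False
    then obtain v where v: "v \<in> T" "v \<in> set L" using F_unit[OF T] L by auto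
    then have "col v \<noteq> Free" using C(3)[of v] T by (auto simp: i_def)
    then obtain j where "col v = Done j" using noPend nO nC by (cases "col v") auto
    then show ?thesis using done_eq[OF ci inv T v(1)] by blast
  qed
  have F: "F = (\<lambda>j. cls col (Done j)) ` {..<k}"
    using all C(1) by auto
  moreover have "inj_on (\<lambda>j. cls col (Done j)) {..<k}"
  proof (rule inj_onI)
    fix x y assume xy: "x \<in> {..<k}" "y \<in> {..<k}" "cls col (Done x) = cls col (Done y)"
    then obtain v where "col v = Done x" using D(10)[of x] by (auto simp: unit_def conn_def cls_def)
    moreover then have "col v = Done y" using xy(3) by (auto simp: cls_def set_eq_iff)
    ultimately show "x = y" by simp
  qed
  ultimately have k: "k = card F" by (simp add: card_image)
  have mem: "v \<in> \<Union>F \<longleftrightarrow> (\<exists>j. col v = Done j)" for v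
    using F D(9) by (auto simp: cls_def)
  show ?thesis
    by (rule that[OF refl R inv k noPend mem]) (use C(5) mem in \<open>auto simp: settled_def\<close>)
qed

end

section \<open>Normalising a solution\<close>

context machine
begin

text \<open>\<open>own\<close> collects the units that avoid \<open>S\<close>, and \<open>B\<close>
  those of them whose clique is dominated from \<open>S\<close>. One unit of \<open>B\<close> per
  clique dominates as much as all of them, so the run assembles these representatives and the units
  meeting \<open>S\<close>. The units in \<open>own - B\<close> lie in exposed cliques and are left
  to the final count.\<close>

lemma completeness:
  assumes gds: "gds \<D>"
  shows "\<exists>st. reach (msucc M S L r kk) (minit n) st \<and> mfinal M S L r kk st"
proof -
  have \<D>: "finite \<D>" "card \<D> \<le> kk" "pairwise disjnt \<D>"
    and unit: "\<And>T. T \<in> \<D> \<Longrightarrow> T \<subseteq> {..<n} \<and> unit T r"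
    and dom: "\<And>v. v < n \<Longrightarrow> \<exists>u\<in>\<Union>\<D>. v = u \<or> A u v"
    using gds unfolding gds_def by blast+
  have disj: "T = T'" if "T \<in> \<D>" "T' \<in> \<D>" "v \<in> T" "v \<in> T'" for T T' v
    using \<D>(3) that unfolding pairwise_def disjnt_def by blast
  have cT: "finite T \<and> card T = r \<and> conn A T \<and> T \<noteq> {}" if "T \<in> \<D>" for T
    using unit[OF that] r by (auto simp: unit_def conn_def intro: card_ge_0_finite)
  define own where "own = {T \<in> \<D>. T \<inter> set S = {}}"
  define near where "near = (\<lambda>v. \<exists>s\<in>set S \<inter> \<Union>\<D>. A s v)"
  define B where "B = {T \<in> own. \<exists>v\<in>T. near v}"
  define cl where "cl = (\<lambda>T. clq (SOME v. v \<in> T))"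
  have some: "(SOME v. v \<in> T) \<in> T" if "T \<in> \<D>" for T using cT[OF that] some_in_eq by blast
  have own_L: "T \<subseteq> set L" if "T \<in> own" for T using that unit L unfolding own_def by auto
  have own_sub: "T \<subseteq> clq v" if "T \<in> own" "v \<in> T" for T v
    using own_clq[of T v] cT unit that by (auto simp: own_def)
  have own_cl: "cl T = clq v" if T: "T \<in> own" and v: "v \<in> T" for T v
    using own_sub[OF T v] some[of T] clq_eq[of v] own_L[OF T] v T unfolding cl_def own_def by blast
  have near_clq: "near u \<longleftrightarrow> near v" if "v \<in> set L" "u \<in> clq v" for u v
  proof -
    have *: "A s y" if "A s x" "s \<in> set S" "x \<in> set L" "y \<in> clq x" for s x y
      using clq_twin[OF that(3,4,2)] that(1) sym by blast
    have "u \<in> set L" using that by (simp add: clq_def)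
    then show ?thesis
      unfolding near_def using * that clq_sym[OF that] by blast
  qed
  \<comment> \<open>\<open>C\<close> picks one unit of \<open>B\<close> from each clique that
    contains any.\<close>
  obtain C where C: "C \<subseteq> B" "inj_on cl C" "cl ` B = cl ` C"
    using subset_image_inj[of "cl ` B" cl B] by auto
  define F where "F = (\<D> - own) \<union> C"
  have Cown: "C \<subseteq> own" using C(1) by (auto simp: B_def)
  have F\<D>: "F \<subseteq> \<D>" using Cown by (auto simp: F_def own_def)
  have fin: "finite F" using F\<D> \<D>(1) finite_subset by blast
  interpret target M S L r kk n F
  proof
    show "finite F" by (fact fin)
    show "card F \<le> kk" using card_mono[OF \<D>(1) F\<D>] \<D>(2) by simp
    show "T \<subseteq> {..<n} \<and> unit T r" if "T \<in> F" for T using unit F\<D> that by blast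
    show "T = T'" if "T \<in> F" "T' \<in> F" "v \<in> T" "v \<in> T'" for T T' v using disj F\<D> that by blast
    show "T = T'" if "T \<in> F" "T' \<in> F" "T \<inter> set S = {}" "T' \<inter> set S = {}" "v \<in> T" "w \<in> T'" "w \<in> clq v"
      for T T' v w
    proof -
      have TC: "T \<in> C" "T' \<in> C" using that by (auto simp: F_def own_def)
      then have o: "T \<in> own" "T' \<in> own" using Cown by auto
      have "cl T = cl T'"
        using own_cl[OF o(1) that(5)] own_cl[OF o(2) that(6)] clq_eq[of v w] that(5,7) own_L[OF o(1)] by auto
      then show ?thesis using C(2) TC by (auto simp: inj_on_def)
    qed
  qed
  obtain st i k q h fl col where st: "st = (i, k, 0, 0, q, h, fl)" and R: "reach (msucc M S L r kk) (minit n) st"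
    and inv: "inv col st" and k: "k = card F" and noPend: "\<And>v w. col v \<noteq> Pend w"
    and mem: "\<And>v. v \<in> \<Union>F \<longleftrightarrow> (\<exists>j. col v = Done j)"
    and U: "\<And>s v. s \<in> set S \<Longrightarrow> val fl s = vU \<Longrightarrow> v \<in> \<Union>F \<Longrightarrow> \<not> A v s"
    using path by blast
  note inv = inv[unfolded st]
  have FS: "s \<in> \<Union>F \<longleftrightarrow> s \<in> \<Union>\<D>" if "s \<in> set S" for s
  proof
    assume "s \<in> \<Union>\<D>"
    then show "s \<in> \<Union>F" using that unfolding F_def own_def by blast
  qed (use F\<D> in blast)
  let ?E = "set (exposed M S L fl)"
  have E: "v \<in> ?E \<longleftrightarrow> v \<in> set L \<and> \<not> near v" for v
    unfolding exposed_iff near_def inv_vX[OF inv] using FS mem by blast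
  have hit: "\<exists>T\<in>own - B. T \<subseteq> clq v \<and> card T = r" if v: "v \<in> ?E" for v
  proof -
    have vL: "v \<in> set L" "\<not> near v" using v E by auto
    then have vn: "v < n" "v \<notin> set S" using L by auto
    obtain u T where u: "T \<in> \<D>" "u \<in> T" "v = u \<or> A u v" using dom[OF vn(1)] by blast
    have uS: "u \<notin> set S" using u vL(2) vn(2) unfolding near_def by blast
    then have uL: "u \<in> set L" using unit[OF u(1)] u(2) L by auto
    have uv: "u \<in> clq v" using u(3) uL sym by (auto simp: clq_def)
    have nu: "\<not> near u" using near_clq[OF vL(1) uv] vL(2) by simp
    \<comment> \<open>If the unit dominating \<open>v\<close> met \<open>S\<close>, it would contain
      a neighbour in \<open>S\<close> of the clique, which would then not be exposed.\<close>
    have o: "T \<in> own"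
    proof (rule ccontr)
      assume "T \<notin> own"
      then have "T \<inter> set S \<noteq> {}" using u(1) by (simp add: own_def)
      then obtain s where "s \<in> T" "s \<in> set S" "A u s"
        using nbr_S[of T u] cT[OF u(1)] unit[OF u(1)] u(2) uS by blast
      then show False using nu u(1) sym unfolding near_def by blast
    qed
    have "\<not> near x" if "x \<in> T" for x
      using near_clq[OF uL, of x] own_sub[OF o u(2)] that nu by blast
    then have "T \<notin> B" by (simp add: B_def)
    moreover have "T \<subseteq> clq v" using own_sub[OF o u(2)] clq_eq[OF vL(1) uv] by simp
    ultimately show ?thesis using o cT[OF u(1)] by blast
  qed
  \<comment> \<open>Each exposed clique contains a unit of \<open>own - B\<close>, and a nonempty
    unit lies in one clique only; so the cliques counted at the end inject into the units left out
    of the run.\<close>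
  have "card {v \<in> ?E. \<forall>u\<in>set L. u < v \<longrightarrow> \<not> A u v} \<le> card (own - B)"
  proof -
    obtain f where f: "\<And>v. v \<in> ?E \<Longrightarrow> f v \<in> own - B \<and> f v \<subseteq> clq v" using hit by metis
    have "inj_on f {v \<in> ?E. \<forall>u\<in>set L. u < v \<longrightarrow> \<not> A u v}"
    proof (rule inj_onI, rule ccontr)
      fix x y assume x: "x \<in> {v \<in> ?E. \<forall>u\<in>set L. u < v \<longrightarrow> \<not> A u v}"
        and y: "y \<in> {v \<in> ?E. \<forall>u\<in>set L. u < v \<longrightarrow> \<not> A u v}" and eq: "f x = f y" "x \<noteq> y"
      have L': "x \<in> set L" "y \<in> set L" using x y E by auto
      have xE: "x \<in> ?E" and yE: "y \<in> ?E" using x y by simp_all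
      have fx: "f x \<in> own" "f x \<subseteq> clq x" using f[OF xE] by simp_all
      have fy: "f y \<subseteq> clq y" using f[OF yE] by simp
      have "f x \<noteq> {}" using cT[of "f x"] fx(1) by (simp add: own_def)
      then obtain u where u: "u \<in> f x" by blast
      have "u \<in> clq x" by (rule subsetD[OF fx(2) u])
      moreover have "u \<in> clq y" by (rule subsetD[OF fy u[unfolded eq(1)]])
      ultimately have "clq x = clq y" using clq_eq[OF L'(1), of u] clq_eq[OF L'(2), of u] by simp
      then have "y \<in> clq x" using L' by (simp add: clq_def)
      then have "A x y" "A y x" using eq(2) sym by (auto simp: clq_def)
      then show False using x y L' eq(2) by (auto simp: nat_neq_iff)
    qed
    then show ?thesis
      by (rule card_inj_on_le) (use f \<D>(1) in \<open>auto simp: own_def\<close>)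
  qed
  moreover have "card F + card (own - B) \<le> kk"
  proof -
    have "F \<inter> (own - B) = {}" using C(1) by (auto simp: F_def)
    moreover have "F \<union> (own - B) \<subseteq> \<D>" using F\<D> by (auto simp: own_def)
    moreover have "finite (own - B)" using \<D>(1) by (simp add: own_def)
    ultimately have "card F + card (own - B) \<le> card \<D>"
      using card_Un_disjoint[OF fin] card_mono[OF \<D>(1)] by metis
    then show ?thesis using \<D>(2) by simp
  qed
  moreover have "fst (val fl s) = 0" for s
    using inv_Pend(1)[OF inv, of s] noPend by auto
  moreover have "r \<le> card (clq v)" if "v \<in> ?E" for v
    using hit[OF that] card_mono[of "clq v"] by (auto simp: clq_def)
  moreover have "\<exists>v\<in>?E. A v s" if s: "s \<in> set S" "val fl s = vU" for s
  proof -
    have "s \<notin> \<Union>F"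
    proof
      assume "s \<in> \<Union>F"
      then have "val fl s = vX" using mem[of s] inv_vX[OF inv, of s] s(1) by blast
      then show False using s(2) by simp
    qed
    then have sD: "s \<notin> \<Union>\<D>" using FS[OF s(1)] by blast
    have "s < n" using S s(1) by auto
    then obtain u T where u: "T \<in> \<D>" "u \<in> T" "A u s" using dom sD by blast
    have "T \<notin> F" using U[OF s] u by blast
    then have o: "T \<in> own" "T \<notin> C" using u(1) by (auto simp: F_def)
    have uL: "u \<in> set L" using own_L[OF o(1)] u(2) by blast
    have "\<not> near u"
    proof
      assume "near u"
      \<comment> \<open>A dropped unit is replaced by the representative of its clique, whose
        vertices have the same neighbours in \<open>S\<close> and so would have dominated
        \<open>s\<close>.\<close>
      then have "T \<in> B" using o(1) u(2) by (auto simp: B_def)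
      then obtain T' where T': "T' \<in> C" "cl T' = cl T" using C(3) by (metis imageE imageI)
      then have o': "T' \<in> own" "T' \<in> F" using Cown by (auto simp: F_def)
      have "T' \<in> \<D>" using o'(1) by (simp add: own_def)
      then obtain u' where u': "u' \<in> T'" using cT by blast
      have u'L: "u' \<in> set L" using own_L[OF o'(1)] u' by blast
      have "clq u' = clq u" using own_cl[OF o'(1) u'] own_cl[OF o(1) u(2)] T'(2) by simp
      then have "u' \<in> clq u" using u'L by (auto simp: clq_def)
      then have "A u' s" using clq_twin[OF uL _ s(1) u(3)] by blast
      then show False using U[OF s] u' o'(2) by blast
    qed
    then show ?thesis using E uL u(3) by blast
  qed
  ultimately have "mfinal M S L r kk st"
    unfolding st mfinal_iff using k by auto
  then show ?thesis using R by blast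
qed

end

section \<open>The dynamic program runs in polynomial time per move\<close>

lemma pt_adj: "pt M \<Longrightarrow> pt u \<Longrightarrow> pt v \<Longrightarrow> pt (\<lambda>x. adj (M x) (u x) (v x))"
  unfolding adj_def by (intro pt_intros)

lemma pt_val: "pt f \<Longrightarrow> pt v \<Longrightarrow> pt (\<lambda>x. val (f x) (v x))"
  unfolding val_def by (intro pt_intros)

lemma pt_free: "pt f \<Longrightarrow> pt v \<Longrightarrow> pt (\<lambda>x. free (f x) (v x))"
  unfolding free_def by (intro pt_intros pt_val)

lemma pt_memb:
  assumes "pt v" "pt S"
  shows "pt (\<lambda>x. memb (v x) (S x))"
  \<comment> \<open>Under a binder the argument is a pair of the outer argument and an element;
    \<open>pt_lift\<close> transports the hypothesis to its first component.\<close>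
  unfolding memb_def by (intro pt_intros pt_lift[OF assms(1)] assms(2))

lemma pt_touch:
  assumes "pt M" "pt g" "pt f" "pt s"
  shows "pt (\<lambda>x. touch (M x) (g x) (f x) (s x))"
  unfolding touch_def by (intro pt_intros pt_adj pt_val assms assms[THEN pt_lift])

lemma pt_upd:
  assumes "pt f" "pt s" "pt w"
  shows "pt (\<lambda>x. upd (f x) (s x) (w x))"
  unfolding upd_def by (intro pt_intros pt_val assms assms[THEN pt_lift])

lemma pt_relab:
  assumes "pt f" "pt w" "pt w'"
  shows "pt (\<lambda>x. relab (f x) (w x) (w' x))"
  unfolding relab_def by (intro pt_intros assms assms[THEN pt_lift])

lemma pt_settle:
  assumes "pt M" "pt S" "pt g" "pt f" "pt w"
  shows "pt (\<lambda>x. settle (M x) (S x) (g x) (f x) (w x))"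
  unfolding settle_def by (intro pt_intros pt_val pt_memb pt_touch assms assms[THEN pt_lift])

lemma pt_settle_own:
  assumes "pt M" "pt S" "pt h" "pt f"
  shows "pt (\<lambda>x. settle_own (M x) (S x) (h x) (f x))"
  unfolding settle_own_def by (intro pt_intros pt_val pt_memb pt_adj assms assms[THEN pt_lift])

lemma pt_exposed:
  assumes "pt M" "pt S" "pt L" "pt f"
  shows "pt (\<lambda>x. exposed (M x) (S x) (L x) (f x))"
  unfolding exposed_def by (intro pt_intros pt_val pt_adj assms assms[THEN pt_lift] pt_lift[OF pt_lift[OF assms(1)]] pt_lift[OF pt_lift[OF assms(4)]])

type_synonym mctx = "bool list list \<times> nat list \<times> nat list \<times> nat \<times> nat"

definition ctx_succ :: "mctx \<Rightarrow> mstate \<Rightarrow> mstate list" where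
  "ctx_succ = (\<lambda>(M, S, L, r, kk). msucc M S L r kk)"

definition ctx_final :: "mctx \<Rightarrow> mstate \<Rightarrow> bool" where
  "ctx_final = (\<lambda>(M, S, L, r, kk). mfinal M S L r kk)"

definition ctx_init :: "mctx \<Rightarrow> mstate" where
  "ctx_init = (\<lambda>(M, S, L, r, kk). minit (length M))"

lemma pt_ctx_succ: "pt (\<lambda>p. ctx_succ (fst p) (snd p))"
  unfolding ctx_succ_def msucc_def case_prod_unfold
  by (intro pt_intros pt_val pt_memb pt_adj pt_touch pt_free pt_upd pt_relab pt_settle pt_settle_own)

lemma pt_ctx_final: "pt (\<lambda>p. ctx_final (fst p) (snd p))"
  unfolding ctx_final_def mfinal_def case_prod_unfold
  by (intro pt_intros pt_val pt_memb pt_adj pt_exposed)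

lemma pt_ctx_init: "pt ctx_init"
proof -
  have "minit n = (0, 0, 0, 0, 0, 0, map (\<lambda>_. vU) [0..<n])" for n
    by (simp add: minit_def map_replicate_const)
  then show ?thesis
    unfolding ctx_init_def case_prod_unfold by (simp only:) (intro pt_intros)
qed

subsection \<open>Minimum twin covers\<close>

definition twins :: "bool list list \<Rightarrow> nat \<Rightarrow> nat \<Rightarrow> bool" where
  "twins M u v \<longleftrightarrow> list_all (\<lambda>w. (w = u \<or> adj M u w) = (w = v \<or> adj M v w)) [0..<length M]"

definition uncovered :: "bool list list \<Rightarrow> nat list \<Rightarrow> (nat \<times> nat) list" where
  "uncovered M T = filter (\<lambda>e. adj M (fst e) (snd e) \<and> \<not> twins M (fst e) (snd e) \<and>
     \<not> memb (fst e) T \<and> \<not> memb (snd e) T)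
     (concat (map (\<lambda>u. map (\<lambda>v. (u, v)) [0..<length M]) [0..<length M]))"

type_synonym cstate = "nat \<times> nat list"

definition csucc :: "bool list list \<Rightarrow> cstate \<Rightarrow> cstate list" where
  "csucc M st = (if fst st = 0 \<or> uncovered M (snd st) = [] then []
     else [(fst st - Suc 0, fst (hdd (0, 0) (uncovered M (snd st))) # snd st),
           (fst st - Suc 0, snd (hdd (0, 0) (uncovered M (snd st))) # snd st)])"

definition cfinal :: "bool list list \<Rightarrow> cstate \<Rightarrow> bool" where
  "cfinal M st \<longleftrightarrow> uncovered M (snd st) = []"

lemma pt_twins:
  assumes "pt M" "pt u" "pt v"
  shows "pt (\<lambda>x. twins (M x) (u x) (v x))"
  unfolding twins_def by (intro pt_intros pt_adj assms assms[THEN pt_lift])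

lemma pt_uncovered:
  assumes "pt M" "pt T"
  shows "pt (\<lambda>x. uncovered (M x) (T x))"
  unfolding uncovered_def by (intro pt_intros pt_adj pt_twins pt_memb assms assms[THEN pt_lift])

lemma pt_csucc:
  assumes "pt M" "pt st"
  shows "pt (\<lambda>x. csucc (M x) (st x))"
  unfolding csucc_def by (intro pt_intros pt_uncovered assms)

lemma pt_cfinal:
  assumes "pt M" "pt st"
  shows "pt (\<lambda>x. cfinal (M x) (st x))"
  unfolding cfinal_def by (intro pt_intros pt_uncovered assms)

text \<open>A superset of the states reachable from \<open>(b, T)\<close>, defined along the
  branching tree so that its size is bounded by recursion on the budget.\<close>

fun cset :: "bool list list \<Rightarrow> nat \<Rightarrow> nat list \<Rightarrow> cstate set" where
  "cset M 0 T = {(0, T)}"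
| "cset M (Suc b) T = insert (Suc b, T) (\<Union>s\<in>set (csucc M (Suc b, T)). cset M b (snd s))"

lemma finite_cset: "finite (cset M b T)"
  by (induction b arbitrary: T) auto

lemma card_cset: "card (cset M b T) < 2 ^ Suc b"
proof (induction b arbitrary: T)
  case (Suc b)
  obtain x y where xy: "set (csucc M (Suc b, T)) \<subseteq> {(b, x), (b, y)}"
    by (cases "uncovered M T = []") (auto simp: csucc_def)
  have "cset M (Suc b) T \<subseteq> insert (Suc b, T) (cset M b x \<union> cset M b y)"
    using xy by auto
  then have "card (cset M (Suc b) T) \<le> card (insert (Suc b, T) (cset M b x \<union> cset M b y))"
    by (intro card_mono) (auto simp: finite_cset)
  also have "\<dots> \<le> Suc (card (cset M b x \<union> cset M b y))"
    by (simp add: card_insert_if finite_cset)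
  also have "\<dots> \<le> Suc (card (cset M b x) + card (cset M b y))"
    by (simp add: card_Un_le)
  also have "\<dots> < 2 ^ Suc (Suc b)" using Suc[of x] Suc[of y] by simp
  finally show ?case .
qed simp

lemma mem_uncovered: "(u, v) \<in> set (uncovered M T) \<longleftrightarrow> u < length M \<and> v < length M \<and> adj M u v \<and>
    \<not> twins M u v \<and> u \<notin> set T \<and> v \<notin> set T"
  by (auto simp: uncovered_def memb_def list_ex_iff image_iff)

lemma hdd_mem: "xs \<noteq> [] \<Longrightarrow> hdd d xs \<in> set xs"
  by (simp add: hdd_def)

lemma csucc_mem:
  assumes "s \<in> set (csucc M (b, T))"
  obtains u v x b' where "b = Suc b'" "(u, v) \<in> set (uncovered M T)" "x \<in> {u, v}" "s = (b', x # T)"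
proof -
  let ?e = "hdd (0, 0) (uncovered M T)"
  have e: "b \<noteq> 0" "uncovered M T \<noteq> []" "s = (b - 1, fst ?e # T) \<or> s = (b - 1, snd ?e # T)"
    using assms by (auto simp: csucc_def split: if_splits)
  have "(fst ?e, snd ?e) \<in> set (uncovered M T)" using hdd_mem[OF e(2)] by simp
  then show ?thesis using that[of "b - 1" "fst ?e" "snd ?e"] e by auto
qed

lemma cset_self: "(b, T) \<in> cset M b T"
  by (cases b) auto

lemma cset_closed: "s \<in> cset M b T \<Longrightarrow> set (csucc M s) \<subseteq> cset M b T"
proof (induction b arbitrary: T)
  case 0
  then show ?case by (auto simp: csucc_def)
next
  case (Suc b)
  show ?case
  proof (cases "s = (Suc b, T)")
    case True
    have "s' \<in> cset M b (snd s')" if "s' \<in> set (csucc M (Suc b, T))" for s'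
      using that by (rule csucc_mem) (auto simp: cset_self)
    then show ?thesis using True by auto
  next
    case False
    then show ?thesis using Suc by fastforce
  qed
qed

lemma cset_bound:
  "(b', T') \<in> cset M b T \<Longrightarrow> length T' + b' = length T + b \<and> set T' \<subseteq> set T \<union> {..<length M}"
proof (induction b arbitrary: T)
  case (Suc b)
  show ?case
  proof (cases "(b', T') = (Suc b, T)")
    case False
    then obtain s where s: "s \<in> set (csucc M (Suc b, T))" "(b', T') \<in> cset M b (snd s)"
      using Suc.prems by auto
    from s(1) obtain u v x where x: "(u, v) \<in> set (uncovered M T)" "x \<in> {u, v}" "snd s = x # T"
      by (rule csucc_mem) auto
    then have "x < length M" by (auto simp: mem_uncovered)
    then show ?thesis using Suc.IH[OF s(2)] x(3) by auto
  qed auto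
qed auto

definition covers :: "bool list list \<Rightarrow> nat set \<Rightarrow> bool" where
  "covers M C \<longleftrightarrow> C \<subseteq> {..<length M} \<and>
     (\<forall>u<length M. \<forall>v<length M. adj M u v \<longrightarrow> \<not> twins M u v \<longrightarrow> u \<in> C \<or> v \<in> C)"

lemma cfinal_iff: "set T \<subseteq> {..<length M} \<Longrightarrow> cfinal M (b, T) \<longleftrightarrow> covers M (set T)"
proof -
  assume T: "set T \<subseteq> {..<length M}"
  have "uncovered M T = [] \<longleftrightarrow> (\<forall>u v. (u, v) \<notin> set (uncovered M T))"
    by (metis ex_in_conv set_empty2 surj_pair)
  then show ?thesis
    using T unfolding cfinal_def covers_def mem_uncovered by auto
qed

text \<open>Every uncovered edge has an endpoint in the cover \<open>C\<close>. Always following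
  that endpoint lowers \<open>card (C - set T)\<close> together with the budget.\<close>

lemma search_complete:
  assumes C: "covers M C"
  shows "card (C - set T) \<le> b \<Longrightarrow> \<exists>s. reach (csucc M) (b, T) s \<and> cfinal M s"
proof (induction b arbitrary: T)
  have finC: "finite C" using C finite_subset unfolding covers_def by blast
  have pick: "\<exists>x\<in>C - set T. (b, x # T) \<in> set (csucc M (Suc b, T))" if ne: "uncovered M T \<noteq> []" for b T
  proof -
    let ?e = "hdd (0, 0) (uncovered M T)"
    have "(fst ?e, snd ?e) \<in> set (uncovered M T)" using hdd_mem[OF ne] by simp
    then have "fst ?e \<in> C - set T \<or> snd ?e \<in> C - set T"
      using C unfolding mem_uncovered covers_def by blast
    then show ?thesis using ne by (auto simp: csucc_def)
  qed
  {
    case 0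
    have "uncovered M T = []"
    proof (rule ccontr)
      assume "uncovered M T \<noteq> []"
      then show False using pick[of T 0] 0 finC by auto
    qed
    then show ?case by (intro exI[of _ "(0, T)"]) (simp add: reach_def cfinal_def)
  next
    case (Suc b)
    show ?case
    proof (cases "uncovered M T = []")
      case True
      then show ?thesis by (intro exI[of _ "(Suc b, T)"]) (simp add: reach_def cfinal_def)
    next
      case False
      then obtain x where x: "x \<in> C - set T" "(b, x # T) \<in> set (csucc M (Suc b, T))"
        using pick by blast
      have "C - set (x # T) \<subset> C - set T" using x(1) by auto
      then have "card (C - set (x # T)) < card (C - set T)"
        using finC by (intro psubset_card_mono) auto
      then obtain s where "reach (csucc M) (b, x # T) s" "cfinal M s"
        using Suc.IH[of "x # T"] Suc.prems by auto
      then show ?thesis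
        using x(2) unfolding reach_def by (metis (mono_tags, lifting) converse_rtranclp_into_rtranclp)
    qed
  }
qed

definition cover_number :: "bool list list \<Rightarrow> nat" where
  "cover_number M = (LEAST b. \<exists>C. covers M C \<and> card C \<le> b)"

lemma covers_all: "covers M {..<length M}"
  by (auto simp: covers_def)

lemma cover_number_iff: "cover_number M \<le> b \<longleftrightarrow> (\<exists>C. covers M C \<and> card C \<le> b)"
proof -
  have "\<exists>C. covers M C \<and> card C \<le> cover_number M"
    unfolding cover_number_def by (rule LeastI[of _ "length M"]) (use covers_all[of M] in auto)
  then show ?thesis
    unfolding cover_number_def by (metis (no_types, lifting) Least_le order_trans)
qed

lemma sz_nat_list: "set T \<subseteq> {..<n} \<Longrightarrow> sz (T :: nat list) \<le> length T * (n + 1)"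
  by (rule sz_list_le) auto

lemma cover_search:
  obtains f :: "bool list list \<times> nat \<Rightarrow> cstate list" where "ot UNIV f (\<lambda>e. card (cset (fst e) (snd e) []))"
    "\<And>M b. f (M, b) = [] \<longleftrightarrow> b < cover_number M"
    "\<And>M b. f (M, b) \<noteq> [] \<Longrightarrow> \<exists>b' T. f (M, b) = [(b', T)] \<and> covers M (set T) \<and> length T \<le> b"
proof -
  have i: "pt (\<lambda>e :: bool list list \<times> nat. (snd e, [] :: nat list))" by (intro pt_intros)
  have s: "pt (\<lambda>p :: (bool list list \<times> nat) \<times> cstate. csucc (fst (fst p)) (snd p))"
    by (intro pt_intros pt_csucc)
  have fi: "pt (\<lambda>p :: (bool list list \<times> nat) \<times> cstate. cfinal (fst (fst p)) (snd p))"
    by (intro pt_intros pt_cfinal)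
  have cs: "s \<in> cset M b []" if "reach (csucc M) (b, []) s" for s M b
    using that unfolding reach_def by induction (use cset_self cset_closed in blast)+
  obtain f :: "bool list list \<times> nat \<Rightarrow> cstate list" where f: "ot UNIV f (\<lambda>e. card (cset (fst e) (snd e) []))"
    "\<And>e. search_result (csucc (fst e)) (cfinal (fst e)) (snd e, []) (f e)"
  proof (rule ot_search[OF i, of "\<lambda>e. csucc (fst e)" "\<lambda>e. cfinal (fst e)" UNIV
        "\<lambda>e. cset (fst e) (snd e) []" "\<lambda>e. sz e + sz e * (sz e + 1) + 1"])
    show "pb UNIV (\<lambda>e :: bool list list \<times> nat. sz e + sz e * (sz e + 1) + 1)"
      by (intro pb_add pb_mult pb_sz pb_const)
    fix e :: "bool list list \<times> nat" and st assume st: "st \<in> cset (fst e) (snd e) []"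
    obtain b' T where bT: "st = (b', T)" by (cases st)
    have 1: "length T + b' = snd e" "set T \<subseteq> {..<length (fst e)}" using cset_bound[of b' T "fst e" "snd e" "[]"] st bT by auto
    obtain M b where e: "e = (M, b)" by (cases e)
    have "length M \<le> sz M" by (rule length_le_sz)
    then have 2: "length (fst e) \<le> sz e" "snd e \<le> sz e" by (auto simp: e)
    have "sz T \<le> length T * (length (fst e) + 1)" by (rule sz_nat_list[OF 1(2)])
    also have "\<dots> \<le> sz e * (sz e + 1)" using 1(1) 2 by (intro mult_le_mono) auto
    finally show "sz st \<le> sz e + sz e * (sz e + 1) + 1" using 1 2 bT by simp
  qed (use s fi finite_cset cset_self cset_closed in auto)
  have wf: "set (snd s) \<subseteq> {..<length M} \<and> length (snd s) \<le> b" if "reach (csucc M) (b, []) s" for s M b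
    using cset_bound[of "fst s" "snd s" M b "[]"] cs[OF that] by auto
  have fin: "covers M (set (snd s))" if "reach (csucc M) (b, []) s" "cfinal M s" for s M b
    using cfinal_iff[of "snd s" M "fst s"] wf[OF that(1)] that(2) by simp
  have R: "search_result (csucc M) (cfinal M) (b, []) (f (M, b))" for M b
    using f(2)[of "(M, b)"] by simp
  have some: "\<exists>b' T. f (M, b) = [(b', T)] \<and> covers M (set T) \<and> length T \<le> b" if ne: "f (M, b) \<noteq> []" for M b
  proof -
    obtain st where st: "f (M, b) = [st]" "reach (csucc M) (b, []) st" "cfinal M st"
      using R[of M b] ne unfolding search_result_def by blast
    then show ?thesis using fin[OF st(2,3)] wf[OF st(2)] by (cases st) simp
  qed
  have "f (M, b) = [] \<longleftrightarrow> b < cover_number M" for M b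
  proof
    assume e: "f (M, b) = []"
    show "b < cover_number M"
    proof (rule ccontr)
      assume "\<not> b < cover_number M"
      then obtain C where "covers M C" "card C \<le> b" using cover_number_iff by (meson not_le)
      then have "\<exists>s. reach (csucc M) (b, []) s \<and> cfinal M s" by (intro search_complete) simp_all
      moreover have "\<forall>s. reach (csucc M) (b, []) s \<longrightarrow> \<not> cfinal M s"
        using R[of M b] unfolding search_result_def e by simp
      ultimately show False by blast
    qed
  next
    assume b: "b < cover_number M"
    show "f (M, b) = []"
    proof (rule ccontr)
      assume "f (M, b) \<noteq> []"
      then obtain b' T where T: "covers M (set T)" "length T \<le> b" using some by blast
      have "card (set T) \<le> b" using card_length[of T] T(2) by (rule le_trans)
      then have "cover_number M \<le> b" using T(1) cover_number_iff by blast
      then show False using b by simp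
    qed
  qed
  then show ?thesis using that f(1) some by blast
qed

lemma pt_rev_upt: "pt (\<lambda>M. rev [0..<Suc (length M)])"
proof -
  have "rev [0..<Suc n] = map (\<lambda>i. n - i) [0..<Suc n]" for n
    by (rule nth_equalityI) (auto simp: rev_nth nth_append simp del: upt_Suc)
  then show ?thesis
    by (simp only:) (intro pt_intros)
qed

text \<open>\<open>foldr\<close> starts at the end of its list, so on the reversed list it tries the
  budgets 0, 1, 2 and so on. Once a cover is found the remaining rounds cost a constant, hence only
  budgets up to the cover number are expensive.\<close>

lemma minimum_cover:
  obtains f :: "bool list list \<Rightarrow> nat list" where "ot UNIV f (\<lambda>M. 2 ^ cover_number M)"
    "\<And>M. covers M (set (f M)) \<and> length (f M) \<le> cover_number M"
proof -
  obtain s :: "bool list list \<times> nat \<Rightarrow> cstate list" where s: "ot UNIV s (\<lambda>e. card (cset (fst e) (snd e) []))"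
    and s0: "\<And>M b. s (M, b) = [] \<longleftrightarrow> b < cover_number M"
    and s1: "\<And>M b. s (M, b) \<noteq> [] \<Longrightarrow> \<exists>b' T. s (M, b) = [(b', T)] \<and> covers M (set T) \<and> length T \<le> b"
    by (rule cover_search) (rule that)
  define h where "h = (\<lambda>M b acc. if acc = [] then s (M, b) else acc)"
  define g where "g = (\<lambda>M m. foldr (h M) (rev [0..<m]) [])"
  let ?l = "\<lambda>M :: bool list list. rev [0..<Suc (length M)]"
  \<comment> \<open>All smaller budgets fail, the budget equal to the cover number succeeds, and its
    result is never replaced.\<close>
  have g: "g M m = (if m \<le> cover_number M then [] else s (M, cover_number M))" for M m
  proof (induction m)
    case (Suc m)
    have "g M (Suc m) = h M m (g M m)" by (simp add: g_def)
    then show ?case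
      using Suc s0[of M m] s0[of M "cover_number M"] by (auto simp: h_def le_Suc_eq not_le)
  qed (simp add: g_def)
  have drop: "foldr (h M) (drop i (?l M)) [] = g M (Suc (length M) - i)" for M i
    by (simp add: g_def drop_rev take_upt del: upt_Suc)
  obtain d where d: "\<And>e. sz (s e) \<le> (sz e + 2) ^ d" using ot_size[OF s] unfolding pb_def by blast
  let ?b = "\<lambda>M :: bool list list. (sz M + sz M + 3) ^ d"
  let ?J = "UNIV :: (bool list list \<times> nat \<times> cstate list) set"
  let ?Th = "\<lambda>p. 1 + (if snd (snd p) = [] then card (cset (fst p) (fst (snd p)) []) + 1 else 1)"
  have le_n: "cover_number M \<le> length M" for M
    using cover_number_iff[of M "length M"] covers_all[of M] by auto
  have pth: "ot ?J (\<lambda>p. h (fst p) (fst (snd p)) (snd (snd p))) ?Th"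
    unfolding h_def
  proof (rule ot_if)
    show "ot UNIV (\<lambda>p :: bool list list \<times> nat \<times> cstate list. snd (snd p) = []) (\<lambda>_. 1)"
      by (intro pt_intros)
    have "ot UNIV (\<lambda>p :: bool list list \<times> nat \<times> cstate list. s (fst p, fst (snd p)))
        (\<lambda>p. card (cset (fst (fst p, fst (snd p))) (snd (fst p, fst (snd p))) []) + 1)"
      by (rule ot_comp[OF s]) (intro pt_intros | simp)+
    then have "ot UNIV (\<lambda>p :: bool list list \<times> nat \<times> cstate list. s (fst p, fst (snd p)))
        (\<lambda>p. card (cset (fst p) (fst (snd p)) []) + 1)"
      by (simp only: fst_conv snd_conv)
    then show "ot {p \<in> (UNIV :: (bool list list \<times> nat \<times> cstate list) set). snd (snd p) = []}
        (\<lambda>p. s (fst p, fst (snd p)))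
        (\<lambda>p. card (cset (fst p) (fst (snd p)) []) + 1)"
      by (rule ot_subset) simp
    have "ot UNIV (\<lambda>p :: bool list list \<times> nat \<times> cstate list. snd (snd p)) (\<lambda>_. 1)"
      by (intro pt_intros)
    then show "ot {p \<in> UNIV. snd (snd p) \<noteq> []} (\<lambda>p :: bool list list \<times> nat \<times> cstate list. snd (snd p)) (\<lambda>_. 1)"
      by (rule ot_subset) simp
  qed
  have "ot UNIV (\<lambda>M. foldr (h M) (?l M) []) (\<lambda>M. 1 + 1 +
    (\<Sum>i<length (?l M). ?Th (M, ?l M ! i, foldr (h M) (drop (Suc i) (?l M)) [])))"
  proof (rule ot_foldr[OF pt_rev_upt pt_const pth])
    show "pb UNIV ?b" by (intro pb_power pb_add pb_sz pb_const)
    show "sz (foldr (h M) (drop i (?l M)) []) \<le> ?b M" for M i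
    proof -
      have "sz (s (M, cover_number M)) \<le> (sz (M, cover_number M) + 2) ^ d" by (rule d)
      also have "\<dots> \<le> ?b M"
        using le_n[of M] length_le_sz[of M] by (intro power_mono) auto
      finally show ?thesis unfolding drop g by simp
    qed
  qed simp
  then have main: "ot UNIV (\<lambda>M. foldr (h M) (?l M) []) (\<lambda>M. 2 ^ cover_number M)"
  proof (rule ot_weaken)
    show "pb UNIV (\<lambda>M :: bool list list. 5 * (sz M + 1) + 2)" by (intro pb_add pb_mult pb_sz pb_const)
    fix M :: "bool list list"
    let ?t = "cover_number M"
    \<comment> \<open>The factor 5 is generous: a search that takes place has a budget of at most
      \<open>?t\<close>, hence fewer than twice \<open>2 ^ ?t\<close> states, plus two units of
      overhead.\<close>
    have "?Th (M, ?l M ! i, foldr (h M) (drop (Suc i) (?l M)) []) \<le> 5 * 2 ^ ?t" if "i < length (?l M)" for i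
    proof -
      have nth: "?l M ! i = length M - i" using that by (simp add: rev_nth del: upt_Suc)
      have dr: "foldr (h M) (drop (Suc i) (?l M)) [] = g M (length M - i)" using drop[of M "Suc i"] by simp
      have one: "1 \<le> (2 :: nat) ^ ?t" by simp
      show ?thesis
      proof (cases "length M - i \<le> ?t")
        case True
        have "(2 :: nat) ^ Suc (length M - i) \<le> 2 ^ Suc ?t" using True by (intro power_increasing) auto
        then have "card (cset M (length M - i) []) \<le> 2 ^ Suc ?t"
          by (rule order_trans[OF less_imp_le[OF card_cset]])
        then have "1 + (card (cset M (length M - i) []) + 1) \<le> 5 * 2 ^ ?t"
          using one unfolding power_Suc by linarith
        then show ?thesis unfolding nth dr g using True by simp
      next
        case False
        then have "g M (length M - i) \<noteq> []" using g[of M "length M - i"] s0[of M ?t] by simp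
        moreover have "1 + 1 \<le> 5 * (2 :: nat) ^ ?t" using one by linarith
        ultimately show ?thesis unfolding nth dr by simp
      qed
    qed
    then have "(\<Sum>i<length (?l M). ?Th (M, ?l M ! i, foldr (h M) (drop (Suc i) (?l M)) []))
        \<le> (\<Sum>i<length (?l M). 5 * 2 ^ ?t)"
      by (intro sum_mono) (simp only: lessThan_iff)
    also have "\<dots> = (length M + 1) * (5 * 2 ^ ?t)" by simp
    also have "\<dots> \<le> (sz M + 1) * (5 * 2 ^ ?t)"
      using length_le_sz[of M] by (intro mult_le_mono) auto
    finally have "1 + 1 + (\<Sum>i<length (?l M). ?Th (M, ?l M ! i, foldr (h M) (drop (Suc i) (?l M)) []))
        \<le> 2 + (sz M + 1) * (5 * 2 ^ ?t)" by linarith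
    also have "\<dots> \<le> (5 * (sz M + 1) + 2) * 2 ^ ?t"
      by (simp add: algebra_simps)
    finally show "1 + 1 + (\<Sum>i<length (?l M). ?Th (M, ?l M ! i, foldr (h M) (drop (Suc i) (?l M)) []))
        \<le> (5 * (sz M + 1) + 2) * 2 ^ ?t" .
  qed auto
  define f where "f = (\<lambda>M. snd (hdd (0, []) (foldr (h M) (?l M) [])))"
  have pf: "pt (\<lambda>l :: cstate list. snd (hdd (0, []) l))" by (intro pt_intros)
  have "ot UNIV f (\<lambda>M. 1 + 2 ^ cover_number M)"
    unfolding f_def using ot_comp[OF pf main] by simp
  then have "ot UNIV f (\<lambda>M. 2 ^ cover_number M)"
    by (rule ot_weaken[OF _ _ pb_const[of _ 2]]) auto
  moreover have "covers M (set (f M)) \<and> length (f M) \<le> cover_number M" for M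
  proof -
    have "foldr (h M) (?l M) [] = s (M, cover_number M)"
      using drop[of M 0] g[of M "Suc (length M)"] le_n[of M] by simp
    moreover obtain b' T where "s (M, cover_number M) = [(b', T)]" "covers M (set T)" "length T \<le> cover_number M"
      using s0[of M "cover_number M"] s1[of M "cover_number M"] by auto
    ultimately show ?thesis by (simp add: f_def hdd_def)
  qed
  ultimately show ?thesis using that by blast
qed

subsection \<open>The number of reachable states\<close>

text \<open>The admissible labels may depend on the vertex; this is used where a pending unit is
  named by the labelled vertex itself.\<close>

definition label_sets :: "nat \<Rightarrow> (nat \<Rightarrow> val set) \<Rightarrow> nat set \<Rightarrow> val list set" where
  "label_sets n V S = {fl. length fl = n \<and> (\<forall>s\<in>S. val fl s \<in> V s) \<and> (\<forall>v. v \<notin> S \<longrightarrow> val fl v = vU)}"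

lemma label_sets_inj: "inj_on (\<lambda>fl. restrict (val fl) S) (label_sets n V S)"
proof (rule inj_onI)
  fix f g assume f: "f \<in> label_sets n V S" and g: "g \<in> label_sets n V S"
    and eq: "restrict (val f) S = restrict (val g) S"
  have "val f v = val g v" for v
  proof (cases "v \<in> S")
    case True
    then show ?thesis using eq by (metis restrict_apply')
  next
    case False
    then show ?thesis using f g by (simp add: label_sets_def)
  qed
  moreover have "length f = n" "length g = n" using f g by (auto simp: label_sets_def)
  ultimately show "f = g"
    by (intro nth_equalityI) (auto simp: val_def nth_default_def split: if_splits, metis)
qed

lemma card_label_sets:
  assumes "finite S" "\<And>s. s \<in> S \<Longrightarrow> finite (V s) \<and> card (V s) \<le> c"
  shows "finite (label_sets n V S)" "card (label_sets n V S) \<le> c ^ card S"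
proof -
  have sub: "(\<lambda>fl. restrict (val fl) S) ` label_sets n V S \<subseteq> PiE S V"
    by (auto simp: label_sets_def)
  have fin: "finite (PiE S V)" using assms by (intro finite_PiE) auto
  show "finite (label_sets n V S)"
    using finite_subset[OF sub fin] finite_imageD[OF _ label_sets_inj] by blast
  have "card (label_sets n V S) \<le> card (PiE S V)"
    by (rule card_inj_on_le[OF label_sets_inj sub fin])
  also have "\<dots> = (\<Prod>s\<in>S. card (V s))" using assms(1) by (rule card_PiE)
  also have "\<dots> \<le> (\<Prod>s\<in>S. c)" using assms by (intro prod_mono) auto
  finally show "card (label_sets n V S) \<le> c ^ card S" by simp
qed

context machine
begin

lemma states_subset:
  assumes inv: "inv col st" and n': "kk \<le> n" "r \<le> n + 3"
    and lab: "\<And>col i k c g q h fl. inv col (i, k, c, g, q, h, fl) \<Longrightarrow> fl \<in> Fl"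
  shows "st \<in> {..n + 3} \<times> {..n + 3} \<times> {..n + 3} \<times> {..n + 3} \<times> {..n + 3} \<times> {..n + 3} \<times> Fl"
proof -
  obtain i k c g q h fl where st: "st = (i, k, c, g, q, h, fl)" by (cases st) auto
  note D = invD[OF inv[unfolded st]]
  have "length L = card ({..<n} - set S)" using L distinct_card by metis
  also have "\<dots> \<le> card {..<n}" by (intro card_mono) auto
  finally have "length L \<le> n" by simp
  moreover have "fl \<in> Fl" using lab inv st by blast
  ultimately show ?thesis using D(1-6) n' st by simp
qed

text \<open>The six counters contribute a polynomial factor only, so the label vectors alone decide
  the exponential part.\<close>

lemma card_states:
  assumes n': "kk \<le> n" "r \<le> n + 3" and fin: "finite Fl"
    and lab: "\<And>col i k c g q h fl. inv col (i, k, c, g, q, h, fl) \<Longrightarrow> fl \<in> Fl"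
  shows "finite {st. reach (msucc M S L r kk) (minit n) st}"
    "card {st. reach (msucc M S L r kk) (minit n) st} \<le> (n + 4) ^ 6 * card Fl"
proof -
  let ?B = "{..n + 3} \<times> {..n + 3} \<times> {..n + 3} \<times> {..n + 3} \<times> {..n + 3} \<times> {..n + 3} \<times> Fl"
  have sub: "{st. reach (msucc M S L r kk) (minit n) st} \<subseteq> ?B"
  proof
    fix st assume "st \<in> {st. reach (msucc M S L r kk) (minit n) st}"
    then obtain col where "inv col st" using inv_reach by blast
    then show "st \<in> ?B" by (rule states_subset[OF _ n' lab])
  qed
  have finB: "finite ?B" using fin by simp
  show "finite {st. reach (msucc M S L r kk) (minit n) st}" by (rule finite_subset[OF sub finB])
  have "card {st. reach (msucc M S L r kk) (minit n) st} \<le> card ?B" by (rule card_mono[OF finB sub])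
  also have "\<dots> = (n + 4) ^ 6 * card Fl"
  proof -
    obtain N where N: "N = card {..n + 3}" by simp
    then have "n + 4 = N" by simp
    moreover have "card ?B = N * (N * (N * (N * (N * (N * card Fl)))))"
      unfolding N by (simp only: card_cartesian_product)
    moreover have "\<dots> = N ^ 6 * card Fl" by (simp add: eval_nat_numeral)
    ultimately show ?thesis by simp
  qed
  finally show "card {st. reach (msucc M S L r kk) (minit n) st} \<le> (n + 4) ^ 6 * card Fl" .
qed

definition pend_vals :: "val set" where
  "pend_vals = Suc ` set S \<times> {1..<r}"

lemma labels_general:
  assumes inv: "inv col (i, k, c, g, q, h, fl)"
  shows "fl \<in> label_sets n (\<lambda>_. {vU, vD, vX, vC} \<union> pend_vals) (set S)"
proof -
  have "val fl s \<in> {vU, vD, vX, vC} \<union> pend_vals" for s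
  proof (cases "0 < fst (val fl s)")
    case True
    then show ?thesis
      using inv_Pend_size(1-3)[OF inv True] unfolding pend_vals_def
      by (intro UnI2) (auto simp: mem_Times_iff)
  next
    case False
    then show ?thesis using inv_val[OF inv, of s] by auto
  qed
  then show ?thesis using invD(7,12)[OF inv] by (auto simp: label_sets_def)
qed

lemma card_general:
  "finite (label_sets n (\<lambda>_. {vU, vD, vX, vC} \<union> pend_vals) (set S))"
  "card (label_sets n (\<lambda>_. {vU, vD, vX, vC} \<union> pend_vals) (set S))
     \<le> (4 + card (set S) * (r - 1)) ^ card (set S)"
proof -
  have "card ({vU, vD, vX, vC} \<union> pend_vals) \<le> card {vU, vD, vX, vC} + card pend_vals"
    by (rule card_Un_le)
  also have "\<dots> \<le> 4 + card (set S) * (r - 1)"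
    by (simp add: pend_vals_def card_cartesian_product card_image)
  finally have c: "card ({vU, vD, vX, vC} \<union> pend_vals) \<le> 4 + card (set S) * (r - 1)" .
  have f: "finite ({vU, vD, vX, vC} \<union> pend_vals)" by (simp add: pend_vals_def)
  show "finite (label_sets n (\<lambda>_. {vU, vD, vX, vC} \<union> pend_vals) (set S))"
    "card (label_sets n (\<lambda>_. {vU, vD, vX, vC} \<union> pend_vals) (set S))
     \<le> (4 + card (set S) * (r - 1)) ^ card (set S)"
    using card_label_sets[of "set S" "\<lambda>_. {vU, vD, vX, vC} \<union> pend_vals"] c f by auto
qed

text \<open>
  For \<open>r \<le> 3\<close> a unit put aside contains a single vertex \<open>s\<close> of \<open>S\<close>, so \<open>(Suc s, 2)\<close> is the only
  label of this kind that \<open>s\<close> can have.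
\<close>

definition small_vals :: "nat \<Rightarrow> val set" where
  "small_vals s = {vU, vD, vX} \<union> (if r = 3 then {(Suc s, 2)} else {})"

text \<open>The label \<open>vC\<close> is masked as \<open>vX\<close>, which leaves at most
  \<open>r + 1\<close> choices per vertex. The masking is undone by the set of at most three
  positions of \<open>vC\<close>, a polynomial amount of information.\<close>

definition small_labels :: "val list set" where
  "small_labels = {fl. relab fl vC vX \<in> label_sets n small_vals (set S) \<and>
     {s. val fl s = vC} \<subseteq> {..<n} \<and> card {s. val fl s = vC} \<le> 3 \<and> length fl = n}"

lemma labels_small:
  assumes r3: "r \<in> {2, 3}" and inv: "inv col (i, k, c, g, q, h, fl)"
  shows "fl \<in> small_labels"
proof -
  have len: "length fl = n" using invD(7)[OF inv] .
  have v: "val (relab fl vC vX) s = (if val fl s = vC then vX else val fl s)" for s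
    by (simp add: val_relab)
  have "val (relab fl vC vX) s \<in> small_vals s" for s
  proof (cases "0 < fst (val fl s)")
    case True
    note P = inv_Pend_size[OF inv True]
    have "r = 3" "snd (val fl s) = 2" using P(1,2) r3 by auto
    moreover then have "val fl s = (Suc s, 2)" using P(4) by simp
    ultimately show ?thesis unfolding small_vals_def v by simp
  next
    case False
    then show ?thesis using inv_val[OF inv, of s] by (auto simp: v small_vals_def)
  qed
  moreover have "val (relab fl vC vX) u = vU" if "u \<notin> set S" for u
    using invD(12)[OF inv that] by (simp add: v)
  ultimately have "relab fl vC vX \<in> label_sets n small_vals (set S)"
    using len by (simp add: label_sets_def)
  moreover have "{s. val fl s = vC} \<subseteq> {..<n}" using inv_vC[OF inv] S by auto
  moreover have "card {s. val fl s = vC} \<le> 3" using inv_card_vC(1)[OF inv] r3 by auto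
  ultimately show ?thesis using len by (simp add: small_labels_def)
qed

lemma card_small:
  assumes r3: "r \<in> {2, 3}"
  shows "finite small_labels" "card small_labels \<le> 4 * (n + 1) ^ 3 * (r + 1) ^ card (set S)"
proof -
  let ?f = "\<lambda>fl. (relab fl vC vX, {s. val fl s = vC})"
  let ?C = "{X. X \<subseteq> {..<n} \<and> card X \<le> 3}" and ?N = "label_sets n small_vals (set S)"
  have inj: "inj_on ?f small_labels"
  proof (rule inj_onI)
    fix x y assume x: "x \<in> small_labels" and y: "y \<in> small_labels" and eq: "?f x = ?f y"
    have r: "val (relab z vC vX) s = (if val z s = vC then vX else val z s)" for s z
      by (simp add: val_relab)
    have eqC: "{s. val x s = vC} = {s. val y s = vC}" using eq by simp
    have "val x s = val y s" for s
    proof (cases "val x s = vC")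
      case True
      then have "val y s = vC" using eqC by blast
      then show ?thesis using True by simp
    next
      case False
      then have "val y s \<noteq> vC" using eqC by blast
      moreover have "val (relab x vC vX) s = val (relab y vC vX) s" using eq by simp
      ultimately show ?thesis using False by (simp add: r)
    qed
    moreover have "length x = n" "length y = n" using x y by (auto simp: small_labels_def)
    ultimately show "x = y"
      by (intro nth_equalityI) (auto simp: val_def nth_default_def split: if_splits, metis)
  qed
  have "finite (small_vals s) \<and> card (small_vals s) \<le> r + 1" for s
    using r3 by (auto simp: small_vals_def card_insert_if)
  then have N: "finite ?N" "card ?N \<le> (r + 1) ^ card (set S)"
    using card_label_sets[of "set S" small_vals "r + 1" n] by auto
  \<comment> \<open>Sets of at most three positions are images of lists of length at most 3; the
    four lengths give the factor 4.\<close>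
  let ?X = "{xs. set xs \<subseteq> {..<n} \<and> length xs \<le> 3}"
  have CX: "?C \<subseteq> set ` ?X"
  proof
    fix X assume X: "X \<in> ?C"
    then have "finite X" using finite_subset by blast
    then obtain xs where "set xs = X" "length xs = card X"
      using finite_distinct_list distinct_card by metis
    then show "X \<in> set ` ?X" using X by (intro image_eqI[of _ _ xs]) auto
  qed
  have fX: "finite ?X" by (rule finite_lists_length_le) simp
  then have fC: "finite ?C" using CX finite_surj by blast
  have "card ?C \<le> card ?X" using surj_card_le[OF fX CX] .
  also have "\<dots> = (\<Sum>i\<le>3. n ^ i)" by (subst card_lists_length_le) auto
  also have "\<dots> \<le> (\<Sum>i\<le>(3::nat). (n + 1) ^ 3)"
  proof (rule sum_mono)
    fix i :: nat assume "i \<in> {..3}"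
    then have "(n + 1) ^ i \<le> (n + 1) ^ 3" by (intro power_increasing) auto
    moreover have "n ^ i \<le> (n + 1) ^ i" by (intro power_mono) auto
    ultimately show "n ^ i \<le> (n + 1) ^ 3" by simp
  qed
  finally have C: "card ?C \<le> 4 * (n + 1) ^ 3" by simp
  have sub: "?f ` small_labels \<subseteq> ?N \<times> ?C" by (auto simp: small_labels_def)
  have fin: "finite (?N \<times> ?C)" using N fC by simp
  show "finite small_labels" using finite_subset[OF sub fin] finite_imageD[OF _ inj] by blast
  have "card small_labels \<le> card (?N \<times> ?C)" by (rule card_inj_on_le[OF inj sub fin])
  also have "\<dots> = card ?N * card ?C" by (rule card_cartesian_product)
  also have "\<dots> \<le> (r + 1) ^ card (set S) * (4 * (n + 1) ^ 3)" using N C by (rule_tac mult_le_mono)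
  finally show "card small_labels \<le> 4 * (n + 1) ^ 3 * (r + 1) ^ card (set S)" by (simp add: mult_ac)
qed

lemma search_iff:
  "(\<exists>st. reach (msucc M S L r kk) (minit n) st \<and> mfinal M S L r kk st) \<longleftrightarrow> (\<exists>\<D>. gds \<D>)"
proof
  assume "\<exists>st. reach (msucc M S L r kk) (minit n) st \<and> mfinal M S L r kk st"
  then obtain st where st: "reach (msucc M S L r kk) (minit n) st" "mfinal M S L r kk st" by blast
  obtain col where "inv col st" using inv_reach[OF st(1)] by blast
  then show "\<exists>\<D>. gds \<D>" using st(2) soundness by (cases st) blast
qed (use completeness in blast)

end

subsection \<open>Instances as adjacency matrices\<close>

definition outside :: "bool list list \<Rightarrow> nat list \<Rightarrow> nat list" where
  "outside M S = filter (\<lambda>v. \<not> memb v S) [0..<length M]"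

text \<open>
  If \<open>S\<close> is a twin cover, then the closed neighbourhood of \<open>v\<close> outside \<open>S\<close> is the clique of \<open>v\<close>,
  and its least vertex is a name for it.
\<close>

definition clique_rep :: "bool list list \<Rightarrow> nat list \<Rightarrow> nat \<Rightarrow> nat" where
  "clique_rep M S v = hdd 0 (filter (\<lambda>u. u = v \<or> adj M u v) (outside M S))"

text \<open>Bucketing by representative places the vertices of each clique next to each other, as
  the scan requires.\<close>

definition clique_order :: "bool list list \<Rightarrow> nat list \<Rightarrow> nat list" where
  "clique_order M S =
     concat (map (\<lambda>\<rho>. filter (\<lambda>v. clique_rep M S v = \<rho>) (outside M S)) [0..<length M])"

text \<open>
  The value of a binary number, cut off at \<open>c\<close>: in unary, \<open>r\<close> and \<open>k\<close> themselves may be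
  exponentially long. Nothing is lost, since an instance with \<open>r > n\<close> has no units and no family
  has more than \<open>n\<close> of them. The cut-off \<open>n + 3\<close> for \<open>r\<close> preserves \<open>r \<in> {2, 3}\<close>.
\<close>

definition capped :: "nat \<Rightarrow> bool list \<Rightarrow> nat" where
  "capped c bs = foldr (\<lambda>b a. min c (if b then Suc (a + a) else a + a)) bs 0"

type_synonym instance_code = "bool list list \<times> bool list \<times> bool list"

definition make_ctx :: "instance_code \<Rightarrow> nat list \<Rightarrow> mctx" where
  "make_ctx x S = (fst x, S, clique_order (fst x) S,
     capped (Suc (Suc (Suc (length (fst x))))) (fst (snd x)), capped (length (fst x)) (snd (snd x)))"

lemma pt_outside:
  assumes "pt M" "pt S"
  shows "pt (\<lambda>x. outside (M x) (S x))"
  unfolding outside_def by (intro pt_intros pt_memb assms assms[THEN pt_lift])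

lemma pt_clique_rep:
  assumes "pt M" "pt S" "pt v"
  shows "pt (\<lambda>x. clique_rep (M x) (S x) (v x))"
  unfolding clique_rep_def by (intro pt_intros pt_adj pt_outside assms assms[THEN pt_lift])

lemma pt_clique_order:
  assumes "pt M" "pt S"
  shows "pt (\<lambda>x. clique_order (M x) (S x))"
  unfolding clique_order_def
  by (intro pt_intros pt_clique_rep pt_outside assms assms[THEN pt_lift]
      assms[THEN pt_lift, THEN pt_lift])

lemma pt_capped:
  assumes "pt c" "pt bs"
  shows "pt (\<lambda>x. capped (c x) (bs x))"
proof -
  have le: "foldr (\<lambda>b a. min c (if b then Suc (a + a) else a + a)) bs 0 \<le> c" for c and bs :: "bool list"
    by (cases bs) auto
  show ?thesis
    unfolding capped_def
    by (rule pt_foldr[OF assms(2) _ pt_const ot_size[OF assms(1)]])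
      (intro pt_intros assms[THEN pt_lift] | simp add: le)+
qed

lemma pt_make_ctx: "pt (\<lambda>p. make_ctx (fst p) (snd p))"
  unfolding make_ctx_def by (intro pt_intros pt_clique_order pt_capped)

text \<open>Cutting off in every round is harmless: if half of \<open>N\<close> already exceeds or
  meets the cap, both sides equal \<open>c\<close>; otherwise nothing has been cut off so
  far.\<close>

lemma capped_step:
  "min c (if odd N then Suc (min c (N div 2) + min c (N div 2)) else min c (N div 2) + min c (N div 2))
    = min c (N :: nat)"
proof (cases "c \<le> N div 2")
  case True
  moreover have "N div 2 \<le> N" by simp
  ultimately have "c \<le> N" by linarith
  then show ?thesis using True by (simp add: min_def)
next
  case False
  then have "min c (N div 2) = N div 2" by simp
  moreover have "(if odd N then Suc (N div 2 + N div 2) else N div 2 + N div 2) = N"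
    by presburger
  ultimately show ?thesis by (simp only:)
qed

lemma capped_nat_bits: "capped c (nat_bits n) = min c n"
proof (induction n rule: nat_bits.induct)
  case (2 n)
  have "capped c (nat_bits (Suc n)) = min c (if odd (Suc n)
      then Suc (capped c (nat_bits (Suc n div 2)) + capped c (nat_bits (Suc n div 2)))
      else capped c (nat_bits (Suc n div 2)) + capped c (nat_bits (Suc n div 2)))"
    unfolding capped_def nat_bits.simps(2) foldr.simps comp_def by (rule refl)
  then show ?case unfolding 2 capped_step .
qed (simp add: capped_def)

lemma outside_iff: "v \<in> set (outside M S) \<longleftrightarrow> v < length M \<and> v \<notin> set S"
  by (auto simp: outside_def memb_def list_ex_iff)

lemma distinct_blocks:
  "distinct xs \<Longrightarrow> distinct \<rho>s \<Longrightarrow> distinct (concat (map (\<lambda>\<rho>. filter (\<lambda>v. f v = \<rho>) xs) \<rho>s))"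
  by (induction \<rho>s) auto

lemma sorted_blocks:
  "sorted (\<rho>s :: nat list) \<Longrightarrow> sorted (map f (concat (map (\<lambda>\<rho>. filter (\<lambda>v. f v = \<rho>) xs) \<rho>s)))"
proof (induction \<rho>s)
  case (Cons \<rho> \<rho>s)
  have "sorted (map f (filter (\<lambda>v. f v = \<rho>) xs))"
    by (induction xs) auto
  then show ?case using Cons by (auto simp: sorted_append)
qed simp

section \<open>From graphs to adjacency matrices\<close>

definition matrix :: "nat pair_pre_digraph \<Rightarrow> bool list list" where
  "matrix G = map (\<lambda>u. map (\<lambda>v. (u, v) \<in> parcs G) [0..<card (pverts G)]) [0..<card (pverts G)]"

lemma length_matrix [simp]: "length (matrix G) = card (pverts G)"
  by (simp add: matrix_def)

text \<open>Connectedness of a digraph is strong connectedness of its symmetric closure, which adds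
  no arcs here. Both sides exclude the empty set.\<close>

lemma reachable_conn:
  assumes sym: "\<And>u v. (u, v) \<in> parcs G \<Longrightarrow> (v, u) \<in> parcs G"
  shows "connected (with_proj G \<restriction> D) \<longleftrightarrow> conn (\<lambda>u v. (u, v) \<in> parcs G) D"
proof -
  let ?r = "\<lambda>a b. a \<in> D \<and> b \<in> D \<and> (a, b) \<in> parcs G"
  let ?H = "with_proj (mk_symmetric (with_proj G \<restriction> D))"
  have arcs: "arcs_ends ?H = {(a, b). ?r a b}"
    using sym by (auto simp: parcs_mk_symmetric arcs_ends_def arc_to_ends_def)
  have "(u, v) \<in> rtrancl_on D {(a, b). ?r a b} \<longleftrightarrow> ?r\<^sup>*\<^sup>* u v" if u: "u \<in> D" for u v
  proof
    assume "(u, v) \<in> rtrancl_on D {(a, b). ?r a b}"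
    then show "?r\<^sup>*\<^sup>* u v"
      by (induction rule: rtrancl_on_induct) (auto intro: rtranclp.rtrancl_into_rtrancl)
  next
    assume "?r\<^sup>*\<^sup>* u v"
    then show "(u, v) \<in> rtrancl_on D {(a, b). ?r a b}"
      by induction (use u in \<open>auto intro: rtrancl_on_into_rtrancl_on\<close>)
  qed
  then show ?thesis
    unfolding connected_def strongly_connected_def reachable_def arcs conn_def by auto
qed

locale graph_instance =
  fixes G :: "nat pair_pre_digraph" and n :: nat
  assumes graph: "pair_graph G" and verts: "pverts G = {..<n}"
begin

lemma card_verts [simp]: "card (pverts G) = n"
  by (simp add: verts)

lemma parcs_less: "(u, v) \<in> parcs G \<Longrightarrow> u < n \<and> v < n"
proof -
  interpret pair_graph G by (fact graph)
  show "(u, v) \<in> parcs G \<Longrightarrow> u < n \<and> v < n"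
    using in_arcsD1 in_arcsD2 verts by blast
qed

lemma parcs_sym: "(u, v) \<in> parcs G \<Longrightarrow> (v, u) \<in> parcs G"
proof -
  interpret pair_graph G by (fact graph)
  show "(u, v) \<in> parcs G \<Longrightarrow> (v, u) \<in> parcs G"
    using pair_sym_arcs by (simp add: symmetric_def sym_def)
qed

lemma parcs_irrefl: "(v, v) \<notin> parcs G"
proof -
  interpret pair_graph G by (fact graph)
  show ?thesis using pair_no_loops by force
qed

lemma adj_matrix [simp]: "adj (matrix G) u v \<longleftrightarrow> (u, v) \<in> parcs G"
  using parcs_less[of u v] by (auto simp: adj_def matrix_def nth_default_def)

lemma twins_matrix: "u < n \<Longrightarrow> v < n \<Longrightarrow> twins (matrix G) u v \<longleftrightarrow> true_twins G u v"
  using parcs_less by (auto simp: twins_def true_twins_def closed_nbhd_def list_all_iff set_eq_iff)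

lemma covers_matrix: "covers (matrix G) C \<longleftrightarrow> twin_cover G C"
proof -
  have "(\<forall>u<n. \<forall>v<n. (u, v) \<in> parcs G \<longrightarrow> \<not> twins (matrix G) u v \<longrightarrow> u \<in> C \<or> v \<in> C) \<longleftrightarrow>
      (\<forall>u v. (u, v) \<in> parcs G \<longrightarrow> true_twins G u v \<or> u \<in> C \<or> v \<in> C)"
    using parcs_less twins_matrix by blast
  then show ?thesis
    unfolding covers_def twin_cover_def length_matrix card_verts adj_matrix unfolding verts
    by (simp add: Ball_def)
qed

lemma cover_number_matrix: "cover_number (matrix G) = twin_cover_number G"
proof -
  let ?N = "card ` {C. twin_cover G C}"
  have sub: "{C. twin_cover G C} \<subseteq> Pow {..<n}" by (auto simp: twin_cover_def verts)
  have fin: "finite ?N" using finite_subset[OF sub] by simp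
  have "twin_cover G {..<n}" using covers_all[of "matrix G"] covers_matrix by simp
  then have ne: "?N \<noteq> {}" by blast
  have "cover_number (matrix G) \<le> b \<longleftrightarrow> twin_cover_number G \<le> b" for b
    unfolding cover_number_iff covers_matrix twin_cover_number_def Min_le_iff[OF fin ne] by blast
  then show ?thesis by (metis order_antisym order_refl)
qed

text \<open>Adjacent vertices outside a twin cover are twins and filter the same vertices, so they
  have the same first one. Conversely a common representative is equal or adjacent to both, and the
  twin property joins them.\<close>

lemma rep_eq:
  assumes cov: "covers (matrix G) (set S)"
    and x: "x \<in> set (outside (matrix G) S)" and y: "y \<in> set (outside (matrix G) S)"
  shows "clique_rep (matrix G) S x = clique_rep (matrix G) S y \<longleftrightarrow> x = y \<or> (x, y) \<in> parcs G"
proof -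
  let ?R = "outside (matrix G) S"
  let ?f = "\<lambda>x. filter (\<lambda>u. u = x \<or> adj (matrix G) u x) ?R"
  have tw: "(w, b) \<in> parcs G" if "a \<in> set ?R" "b \<in> set ?R" "(a, b) \<in> parcs G" "(w, a) \<in> parcs G" "w \<noteq> b"
    for a b w
  proof -
    have "twins (matrix G) a b"
      using cov that unfolding covers_def by (auto simp: outside_iff)
    then have "closed_nbhd G a = closed_nbhd G b"
      using twins_matrix parcs_less that(3) by (simp add: true_twins_def)
    then show ?thesis using that parcs_sym unfolding closed_nbhd_def by blast
  qed
  have mem: "clique_rep (matrix G) S a \<in> set (?f a)" if "a \<in> set ?R" for a
    unfolding clique_rep_def using that by (intro hdd_mem) (auto simp: filter_empty_conv)
  show ?thesis
  proof
    assume eq: "clique_rep (matrix G) S x = clique_rep (matrix G) S y"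
    obtain \<rho> where r: "\<rho> \<in> set ?R" "\<rho> = x \<or> (\<rho>, x) \<in> parcs G" "\<rho> = y \<or> (\<rho>, y) \<in> parcs G"
      using mem[OF x] mem[OF y] eq by auto
    show "x = y \<or> (x, y) \<in> parcs G"
    proof (cases "\<rho> = x \<or> \<rho> = y")
      case True
      then show ?thesis using r parcs_sym by blast
    next
      case False
      then show ?thesis using r tw[OF r(1) y, of x] parcs_sym by blast
    qed
  next
    assume xy: "x = y \<or> (x, y) \<in> parcs G"
    have "?f x = ?f y"
    proof (rule filter_cong[OF refl])
      fix u assume "u \<in> set ?R"
      show "(u = x \<or> adj (matrix G) u x) = (u = y \<or> adj (matrix G) u y)"
        unfolding adj_matrix
      proof (cases "x = y")
        case False
        then have "(x, y) \<in> parcs G" "(y, x) \<in> parcs G" using xy parcs_sym by blast+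
        then show "(u = x \<or> (u, x) \<in> parcs G) = (u = y \<or> (u, y) \<in> parcs G)"
          using tw[OF x y, of u] tw[OF y x, of u] by blast
      qed simp
    qed
    then show "clique_rep (matrix G) S x = clique_rep (matrix G) S y"
      by (simp add: clique_rep_def)
  qed
qed

lemma machine:
  assumes cov: "covers (matrix G) (set S)" and r: "0 < r"
  shows "machine (matrix G) S (clique_order (matrix G) S) r n"
proof
  let ?M = "matrix G" and ?R = "outside (matrix G) S" and ?L = "clique_order (matrix G) S"
  let ?rep = "clique_rep ?M S"
  show "n = length ?M" by simp
  show "adj ?M v u" if "adj ?M u v" for u v using that parcs_sym[of u v] by simp
  show "\<not> adj ?M v v" for v using parcs_irrefl by simp
  show "u < n" if "adj ?M u v" for u v using that parcs_less[of u v] by simp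
  show Sn: "set S \<subseteq> {..<n}" using cov by (simp add: covers_def)
  have dR: "distinct ?R" by (simp add: outside_def)
  then show dL: "distinct ?L" unfolding clique_order_def by (rule distinct_blocks) simp
  have "?rep v < n" if "v \<in> set ?R" for v
  proof -
    have "?rep v \<in> set (filter (\<lambda>u. u = v \<or> adj ?M u v) ?R)"
      unfolding clique_rep_def using that by (intro hdd_mem) (auto simp: filter_empty_conv)
    then show ?thesis by (auto simp: outside_iff)
  qed
  then have LR: "set ?L = set ?R" unfolding clique_order_def by auto
  show "set ?L = {..<n} - set S" unfolding LR by (auto simp: outside_iff)
  show "0 < r" by fact
  show "adj ?M v w" if "u \<notin> set S" "v \<notin> set S" "adj ?M u v" "w \<noteq> v" "adj ?M u w" for u v w
  proof -
    have uv: "u < n" "v < n" using parcs_less[of u v] that(3) by simp_all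
    then have "twins ?M u v"
      using cov that(1-3) unfolding covers_def length_matrix card_verts by blast
    then have "closed_nbhd G u = closed_nbhd G v" using twins_matrix[OF uv] by (simp add: true_twins_def)
    moreover have "w \<in> closed_nbhd G u" using that(5) by (simp add: closed_nbhd_def)
    ultimately have "w \<in> closed_nbhd G v" by simp
    then show ?thesis using that(4) by (simp add: closed_nbhd_def)
  qed
  show "adj ?M (?L ! a) (?L ! b)" if abc: "a < b" "b < c" "c < length ?L" "adj ?M (?L ! a) (?L ! c)" for a b c
  proof -
    have R: "?L ! a \<in> set ?R" "?L ! b \<in> set ?R" "?L ! c \<in> set ?R"
      unfolding LR[symmetric] using abc by (intro nth_mem; linarith)+
    \<comment> \<open>The representatives are sorted along the list, so equal ends force equality in
      between.\<close>
    have "sorted (map ?rep ?L)" unfolding clique_order_def by (rule sorted_blocks) simp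
    then have "?rep (?L ! a) \<le> ?rep (?L ! b)" "?rep (?L ! b) \<le> ?rep (?L ! c)"
      using abc sorted_nth_mono[of "map ?rep ?L" a b] sorted_nth_mono[of "map ?rep ?L" b c] by simp_all
    moreover have "?rep (?L ! a) = ?rep (?L ! c)"
      using rep_eq[OF cov R(1,3)] abc(4) by simp
    ultimately have "?rep (?L ! a) = ?rep (?L ! b)" by simp
    then have "?L ! a = ?L ! b \<or> adj ?M (?L ! a) (?L ! b)"
      using rep_eq[OF cov R(1,2)] by simp
    moreover have "?L ! a \<noteq> ?L ! b" using abc dL by (simp add: nth_eq_iff_index_eq)
    ultimately show ?thesis by blast
  qed
qed

lemma gds_iff:
  assumes cov: "covers (matrix G) (set S)" and r: "0 < r"
  shows "(\<exists>\<D>. machine.gds (matrix G) (min (n + 3) r) (min n k) n \<D>) \<longleftrightarrow> gds_yes (G, r, k)"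
proof -
  interpret machine "matrix G" S "clique_order (matrix G) S" "min (n + 3) r" "min n k" n
    by (rule machine[OF cov]) (use r in simp)
  have conn: "connected (with_proj G \<restriction> D) \<longleftrightarrow> conn A D" for D
  proof -
    have "A = (\<lambda>u v. (u, v) \<in> parcs G)" by (intro ext) simp
    then show ?thesis using reachable_conn[OF parcs_sym, of D] by (simp only:)
  qed
  have cardr: "card D = min (n + 3) r \<longleftrightarrow> card D = r" if "D \<subseteq> {..<n}" for D
  proof -
    have "card D \<le> n" using card_mono[OF finite_lessThan that] by simp
    then show ?thesis by (simp add: min_def)
  qed
  have dom: "dominating_set G (\<Union>\<D>) \<longleftrightarrow> (\<forall>v<n. \<exists>u\<in>\<Union>\<D>. v = u \<or> A u v)"
    if "\<forall>D\<in>\<D>. D \<subseteq> {..<n}" for \<D>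
  proof -
    have "\<Union>\<D> \<subseteq> {..<n}" using that by blast
    then show ?thesis
      unfolding dominating_set_def closed_nbhd_def verts adj_matrix by (simp add: Ball_def)
  qed
  have main: "gds \<D> \<longleftrightarrow> card \<D> \<le> k \<and> grouped_dominating_set G r (card \<D>) \<D>" for \<D>
  proof -
    have "gds \<D> \<longleftrightarrow> finite \<D> \<and> card \<D> \<le> min n k \<and> pairwise disjnt \<D> \<and>
        (\<forall>D\<in>\<D>. D \<subseteq> pverts G \<and> card D = r \<and> connected (with_proj G \<restriction> D)) \<and> dominating_set G (\<Union>\<D>)"
    proof -
      have "D \<subseteq> {..<n} \<and> unit D (min (n + 3) r) \<longleftrightarrow>
          D \<subseteq> pverts G \<and> card D = r \<and> connected (with_proj G \<restriction> D)" for D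
        unfolding verts unit_def conn by (rule conj_cong[OF refl]) (simp only: cardr conj_commute)
      then have eq: "(\<forall>D\<in>\<D>. D \<subseteq> {..<n} \<and> unit D (min (n + 3) r)) \<longleftrightarrow>
          (\<forall>D\<in>\<D>. D \<subseteq> pverts G \<and> card D = r \<and> connected (with_proj G \<restriction> D))"
        by (simp only:)
      have "\<forall>D\<in>\<D>. D \<subseteq> {..<n}" if "\<forall>D\<in>\<D>. D \<subseteq> pverts G \<and> card D = r \<and> connected (with_proj G \<restriction> D)"
        using that unfolding verts by blast
      then show ?thesis
        unfolding gds_def eq by (intro conj_cong refl dom[symmetric])
    qed
    also have "\<dots> \<longleftrightarrow> card \<D> \<le> k \<and> grouped_dominating_set G r (card \<D>) \<D>"
    proof -
      have "card \<D> \<le> n" if D: "finite \<D>" "pairwise disjnt \<D>" "\<forall>D\<in>\<D>. D \<subseteq> pverts G \<and> card D = r"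
      proof -
        have "card \<D> = (\<Sum>D\<in>\<D>. 1)" by simp
        also have "\<dots> \<le> (\<Sum>D\<in>\<D>. card D)" using D(3) r by (intro sum_mono) auto
        also have "\<dots> = card (\<Union>\<D>)"
          using D by (intro card_Union_disjoint[symmetric]) (auto simp: verts intro: finite_subset)
        also have "\<dots> \<le> card {..<n}" using D(3) verts by (intro card_mono) auto
        finally show ?thesis by simp
      qed
      then show ?thesis unfolding grouped_dominating_set_def by auto
    qed
    finally show ?thesis .
  qed
  have "(\<exists>\<D>. gds \<D>) \<longleftrightarrow> gds_yes (G, r, k)"
    unfolding main gds_yes_def prod.case
  proof (intro iffI)
    assume "\<exists>j\<le>k. \<exists>\<D>. grouped_dominating_set G r j \<D>"
    then obtain j \<D> where "j \<le> k" "grouped_dominating_set G r j \<D>" by blast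
    moreover from this have "card \<D> = j" unfolding grouped_dominating_set_def by blast
    ultimately show "\<exists>\<D>. card \<D> \<le> k \<and> grouped_dominating_set G r (card \<D>) \<D>" by blast
  qed blast
  then show ?thesis .
qed

end

section \<open>The complete decision procedure and its running time\<close>

definition states :: "mctx \<Rightarrow> mstate set" where
  "states c = {st. reach (ctx_succ c) (ctx_init c) st}"

definition code_of :: "gds_instance \<Rightarrow> instance_code" where
  "code_of = (\<lambda>(G, r, k). (matrix G, nat_bits r, nat_bits k))"

lemma gds_instance_locale:
  assumes "(G, r, k) \<in> gds_instances"
  obtains n where "graph_instance G n" "0 < r"
  using assms unfolding gds_instances_def graph_instance_def by auto

lemma enc_code_of: "enc (code_of x) = gds_encode x"
proof -
  obtain G r k where x: "x = (G, r, k)" by (cases x)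
  have b: "(enc :: bool \<Rightarrow> sexp) = bool_sexp" by (rule ext) (rule enc_bool_def)
  show ?thesis
    by (simp add: x code_of_def gds_encode_def nat_sexp_def graph_sexp_def matrix_def Let_def
        enc_list_conv b comp_def)
qed

text \<open>Time bounds of programs are functions of the code, whereas the target bound is a
  function of the instance; injectivity carries it over.\<close>

lemma inj_code_of: "inj_on code_of gds_instances"
proof (rule inj_onI)
  fix x y assume x: "x \<in> gds_instances" and y: "y \<in> gds_instances" and eq: "code_of x = code_of y"
  obtain G r k where xs: "x = (G, r, k)" by (cases x)
  obtain H r' k' where ys: "y = (H, r', k')" by (cases y)
  obtain n where G: "graph_instance G n" using gds_instance_locale x xs by blast
  obtain m where H: "graph_instance H m" using gds_instance_locale y ys by blast
  have eqM: "matrix G = matrix H" and bits: "nat_bits r = nat_bits r'" "nat_bits k = nat_bits k'"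
    using eq by (auto simp: code_of_def xs ys)
  have "a = b" if "nat_bits a = nat_bits b" for a b
  proof -
    have "capped (max a b) (nat_bits a) = capped (max a b) (nat_bits b)" by (simp only: that)
    then show ?thesis unfolding capped_nat_bits by simp
  qed
  then have rk: "r = r'" "k = k'" using bits by auto
  have "length (matrix G) = length (matrix H)" using eqM by simp
  then have "n = m" using graph_instance.card_verts[OF G] graph_instance.card_verts[OF H] by simp
  then have pv: "pverts G = pverts H"
    using graph_instance.verts[OF G] graph_instance.verts[OF H] by simp
  have "(u, v) \<in> parcs G \<longleftrightarrow> (u, v) \<in> parcs H" for u v
    using graph_instance.adj_matrix[OF G, of u v] graph_instance.adj_matrix[OF H, of u v] eqM by simp
  then have "parcs G = parcs H" by auto
  then show "x = y" using pv rk xs ys by simp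
qed

lemma solvableI:
  assumes ot: "ot (code_of ` I) f T" and I: "\<And>x. x \<in> I \<Longrightarrow> f (code_of x) = Q x"
    and T: "\<And>x. x \<in> I \<Longrightarrow> T (code_of x) = g x"
  shows "solvable_in_O_star I gds_encode Q g"
proof -
  obtain P A where A: "pb (code_of ` I) A" "impl P 0 f (code_of ` I) (\<lambda>x. A x * T x)"
    using ot unfolding ot_def by blast
  obtain d where d: "\<And>x. x \<in> I \<Longrightarrow> A (code_of x) \<le> (sz (code_of x) + 2) ^ d"
    using A(1) unfolding pb_def by blast
  \<comment> \<open>\<open>[:2, 1:]\<close> is the polynomial x + 2, the base used in
    \<open>pb\<close>. The constant 3 covers the two extra nodes of the entry call, since
    \<open>g x\<close> is positive.\<close>
  let ?p = "[:2, 1:] ^ d + [:3:] :: nat poly"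
  have "\<exists>t. runs P (gds_encode x) (bool_sexp (Q x)) t \<and> t \<le> poly ?p (size (gds_encode x)) * g x"
    if x: "x \<in> I" for x
  proof -
    have sz: "sz (code_of x) = size (gds_encode x)" by (simp add: sz_def enc_code_of)
    have body: "evb P [enc (code_of x)] (P ! 0) (enc (f (code_of x))) (A (code_of x) * T (code_of x))"
      by (rule implD[OF A(2)]) (use x in simp)
    have l: "0 < length P" by (rule impl_lessD[OF A(2)])
    have "evb P [enc (code_of x)] (Call 0 [Var 0]) (enc (f (code_of x)))
        (1 + A (code_of x) * T (code_of x) + 1)"
      by (rule evb_Call1[OF l evb_Var0 body])
    then obtain t where t: "runs P (gds_encode x) (bool_sexp (Q x)) t" "t \<le> A (code_of x) * g x + 2"
      using I[OF x] T[OF x] by (auto simp: evb_def runs_def enc_code_of enc_bool_def)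
    have g: "0 < g x" using evb_pos[OF body] T[OF x] by simp
    have "A (code_of x) * g x + 2 \<le> (size (gds_encode x) + 2) ^ d * g x + 3 * g x"
      using d[OF x] g unfolding sz by (intro add_mono mult_le_mono1) auto
    also have "\<dots> = poly ?p (size (gds_encode x)) * g x"
      by (simp add: poly_power add_mult_distrib add.commute)
    finally show ?thesis using t by (meson le_trans)
  qed
  then show ?thesis unfolding solvable_in_O_star_def by blast
qed

text \<open>For positive \<open>t\<close> the difference of \<open>2 * t * (r + 1)\<close> and
  \<open>t * (r - 1)\<close> is \<open>t * (r + 3)\<close>, at least 4, which makes room for the
  four labels without a name. For \<open>t = 0\<close> both powers are 1.\<close>

lemma general_bound:
  assumes "s \<le> t" "0 < r" "r' \<le> (r :: nat)"
  shows "(4 + s * (r' - 1)) ^ s \<le> (2 * t * (r + 1)) ^ t"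
proof (cases "t = 0")
  case False
  have "4 + s * (r' - 1) \<le> 4 + t * (r - 1)"
    using assms by (intro add_left_mono mult_le_mono) auto
  also have "\<dots> \<le> 2 * t * (r + 1)"
  proof -
    obtain t' where t': "t = Suc t'" using False by (cases t) auto
    obtain q where q: "r = Suc q" using assms(2) by (cases r) auto
    show ?thesis unfolding t' q by (simp add: algebra_simps)
  qed
  finally have b: "4 + s * (r' - 1) \<le> 2 * t * (r + 1)" .
  have "(4 + s * (r' - 1)) ^ s \<le> (2 * t * (r + 1)) ^ s" using b by (rule power_mono) simp
  also have "\<dots> \<le> (2 * t * (r + 1)) ^ t" using False assms(1) by (intro power_increasing) auto
  finally show ?thesis .
qed (use assms in simp)

text \<open>Looking up a state costs time linear in its size, and counters are unary. This is where
  the caps on \<open>r\<close> and \<open>k\<close> are needed.\<close>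

lemma sz_states:
  assumes "machine M S L r n" "kk \<le> n" "r \<le> n + 3" "st \<in> states (M, S, L, r, kk)"
  shows "sz st \<le> 6 * (n + 3) + n * (2 * n + 9) + 9"
proof -
  interpret machine M S L r kk n by fact
  have "reach (msucc M S L r kk) (minit n) st"
    using assms(4) n by (simp add: states_def ctx_succ_def ctx_init_def)
  then obtain col where inv: "inv col st" using inv_reach by blast
  obtain i k c g q h fl where st: "st = (i, k, c, g, q, h, fl)" by (cases st) auto
  note inv = inv[unfolded st]
  have in_box: "st \<in> {..n + 3} \<times> {..n + 3} \<times> {..n + 3} \<times> {..n + 3} \<times> {..n + 3} \<times> {..n + 3} \<times> UNIV"
    by (rule states_subset[OF _ assms(2,3)]) (use inv st in auto)
  have "sz x \<le> 2 * n + 8" if X: "x \<in> set fl" for x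
  proof -
    obtain v where v: "v < length fl" "x = fl ! v" using X by (auto simp: in_set_conv_nth)
    then have x: "x = val fl v" by (simp add: val_def nth_default_def)
    show ?thesis
    proof (cases "0 < fst x")
      case True
      obtain a b where ab: "x = (a, b)" by (cases x)
      then have "val fl v = (a, b)" using x by simp
      then have "b < r" "\<exists>l\<in>set S. a = Suc l"
        using inv_Pend_size(2,3)[OF inv, of v] True ab by auto
      then have "b < n + 3" "a \<le> n" using assms(3) S by auto
      then show ?thesis by (simp add: ab)
    next
      case False
      then have "x \<in> {vU, vD, vX, vC}" using inv_val[OF inv, of v] x by auto
      then show ?thesis by auto
    qed
  qed
  then have "sz fl \<le> length fl * (2 * n + 8 + 1)" by (rule sz_list_le)
  then have "sz fl \<le> n * (2 * n + 9)" using invD(7)[OF inv] by (simp add: algebra_simps)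
  then show ?thesis using in_box by (simp add: st)
qed

text \<open>The common part of both claims: cover search plus state search. \<open>T2\<close> pays
  for the former. The factor \<open>(n + 4) ^ 9 * 4\<close> leaves room for the six counters and,
  for small \<open>r\<close>, for the positions of \<open>vC\<close>.\<close>

lemma solvable_if_few_states:
  assumes I: "I \<subseteq> gds_instances"
    and T2: "\<And>G r k. (G, r, k) \<in> I \<Longrightarrow> 2 ^ twin_cover_number G \<le> T (G, r, k)"
    and card: "\<And>G r k n S. (G, r, k) \<in> I \<Longrightarrow> graph_instance G n \<Longrightarrow>
      machine (matrix G) S (clique_order (matrix G) S) (min (n + 3) r) n \<Longrightarrow>
      card (set S) \<le> twin_cover_number G \<Longrightarrow>
      card {st. reach (msucc (matrix G) S (clique_order (matrix G) S) (min (n + 3) r) (min n k)) (minit n) st}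
        \<le> (n + 4) ^ 9 * 4 * T (G, r, k)"
  shows "solvable_in_O_star I gds_encode gds_yes T"
proof -
  obtain mc where mc: "ot UNIV mc (\<lambda>M. 2 ^ cover_number M)"
    "\<And>M. covers M (set (mc M)) \<and> length (mc M) \<le> cover_number M"
    by (rule minimum_cover) (rule that)
  let ?C = "code_of ` I"
  define ctx where "ctx = (\<lambda>x :: instance_code. make_ctx x (mc (fst x)))"
  define T' where "T' = (\<lambda>y. T (the_inv_into I code_of y))"
  have inj: "inj_on code_of I" using inj_code_of I inj_on_subset by blast
  have T': "T' (code_of x) = T x" if "x \<in> I" for x
    unfolding T'_def using the_inv_into_f_f[OF inj that] by simp
  have ctx_eq: "ctx (code_of (G, r, k)) = (matrix G, mc (matrix G), clique_order (matrix G) (mc (matrix G)),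
      min (n + 3) r, min n k)" if "graph_instance G n" for G r k n
    using graph_instance.card_verts[OF that]
    by (simp add: ctx_def make_ctx_def code_of_def capped_nat_bits numeral_3_eq_3)
  have mach: "machine (matrix G) (mc (matrix G)) (clique_order (matrix G) (mc (matrix G)))
      (min (n + 3) r) n" if "graph_instance G n" "0 < r" for G r k n
    using graph_instance.machine[OF that(1)] mc(2) that(2) by simp
  have "ot UNIV (\<lambda>x :: instance_code. (x, mc (fst x))) (\<lambda>x. 1 + (2 ^ cover_number (fst x) + 1))"
    by (rule ot_pair[OF pt_id ot_comp[OF mc(1) pt_fst[OF pt_id]]]) simp_all
  from ot_comp[OF pt_make_ctx this]
  have otctx: "ot UNIV ctx (\<lambda>x. 1 + (1 + (2 ^ cover_number (fst x) + 1)))"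
    by (simp add: ctx_def)
  have fin: "finite (states c)" "\<And>st. st \<in> states c \<Longrightarrow> sz st \<le> 6 * (sz c + 3) + sz c * (2 * sz c + 9) + 9"
    if c: "c \<in> ctx ` ?C" for c
  proof -
    obtain G r k where G: "(G, r, k) \<in> I" "c = ctx (code_of (G, r, k))" using c by auto
    obtain n where gr: "graph_instance G n" "0 < r" using gds_instance_locale G(1) I by blast
    interpret machine "matrix G" "mc (matrix G)" "clique_order (matrix G) (mc (matrix G))"
      "min (n + 3) r" "min n k" n by (rule mach[OF gr])
    have c': "c = (matrix G, mc (matrix G), clique_order (matrix G) (mc (matrix G)), min (n + 3) r, min n k)"
      using ctx_eq[OF gr(1)] G(2) by simp
    have st: "states c = {st. reach (msucc (matrix G) (mc (matrix G)) (clique_order (matrix G) (mc (matrix G)))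
        (min (n + 3) r) (min n k)) (minit n) st}"
      using graph_instance.card_verts[OF gr(1)] by (simp add: c' states_def ctx_succ_def ctx_init_def)
    show "finite (states c)"
      unfolding st by (rule card_states(1)[OF _ _ card_general(1) labels_general]) auto
    have nc: "n \<le> sz c"
      using length_le_sz[of "matrix G"] graph_instance.card_verts[OF gr(1)] by (simp add: c')
    fix s assume "s \<in> states c"
    then have "sz s \<le> 6 * (n + 3) + n * (2 * n + 9) + 9"
      using sz_states[OF mach[OF gr], of "min n k" s] unfolding c' by simp
    also have "\<dots> \<le> 6 * (sz c + 3) + sz c * (2 * sz c + 9) + 9"
      using nc by (intro add_mono mult_le_mono) auto
    finally show "sz s \<le> 6 * (sz c + 3) + sz c * (2 * sz c + 9) + 9" .
  qed
  obtain srch :: "mctx \<Rightarrow> mstate list" where srch: "ot (ctx ` ?C) srch (\<lambda>c. card (states c))"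
    "\<And>c. c \<in> ctx ` ?C \<Longrightarrow> search_result (ctx_succ c) (ctx_final c) (ctx_init c) (srch c)"
  proof (rule ot_search[OF pt_ctx_init pt_ctx_succ pt_ctx_final, of "ctx ` ?C" states
        "\<lambda>c. 6 * (sz c + 3) + sz c * (2 * sz c + 9) + 9"])
    show "ctx_init c \<in> states c" for c by (simp add: states_def reach_def)
    show "set (ctx_succ c s) \<subseteq> states c" if "s \<in> states c" for c s
      using that unfolding states_def reach_def by (auto intro: rtranclp.rtrancl_into_rtrancl)
    show "pb (ctx ` ?C) (\<lambda>c. 6 * (sz c + 3) + sz c * (2 * sz c + 9) + 9)"
      by (intro pb_add pb_mult pb_sz pb_const)
  qed (use fin in auto)
  define yes where "yes = (\<lambda>x. srch (ctx x) \<noteq> [])"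
  have "ot ?C (\<lambda>x. srch (ctx x)) (\<lambda>x. card (states (ctx x)) + (1 + (1 + (2 ^ cover_number (fst x) + 1))))"
    by (rule ot_comp[OF srch(1) ot_subset[OF otctx]]) auto
  then have "ot ?C yes (\<lambda>x. 1 + (card (states (ctx x)) + (1 + (1 + (2 ^ cover_number (fst x) + 1)))))"
    unfolding yes_def
    by (rule ot_comp[OF pt_not[OF pt_null[OF pt_id]]]) auto
  then have "ot ?C yes T'"
  proof (rule ot_weaken)
    show "pb ?C (\<lambda>x. (sz x + 4) ^ 9 * 4 + 5)" by (intro pb_add pb_mult pb_power pb_sz pb_const)
    fix x assume "x \<in> ?C"
    then obtain G r k where G: "(G, r, k) \<in> I" "x = code_of (G, r, k)" by auto
    obtain n where gr: "graph_instance G n" "0 < r" using gds_instance_locale G(1) I by blast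
    have fx: "fst x = matrix G" by (simp add: G(2) code_of_def)
    have cn: "cover_number (matrix G) = twin_cover_number G" by (rule graph_instance.cover_number_matrix[OF gr(1)])
    have "card (set (mc (matrix G))) \<le> twin_cover_number G"
      using mc(2)[of "matrix G"] card_length[of "mc (matrix G)"] cn by simp
    note c = card[OF G(1) gr(1) mach[OF gr] this]
    have st: "states (ctx x) = {st. reach (msucc (matrix G) (mc (matrix G)) (clique_order (matrix G) (mc (matrix G)))
        (min (n + 3) r) (min n k)) (minit n) st}"
      using graph_instance.card_verts[OF gr(1)]
      by (simp add: ctx_eq[OF gr(1)] G(2) states_def ctx_succ_def ctx_init_def)
    have nx: "n \<le> sz x"
      using length_le_sz[of "matrix G"] graph_instance.card_verts[OF gr(1)]
      by (simp add: G(2) code_of_def)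
    have t: "2 ^ cover_number (fst x) \<le> T' x" "T' x = T (G, r, k)"
      using T2[OF G(1)] T'[OF G(1)] G(2) cn fx by simp_all
    have one: "1 \<le> T' x" using t(1) by (metis one_le_numeral one_le_power order_trans)
    have "card (states (ctx x)) \<le> (n + 4) ^ 9 * 4 * T' x" using c unfolding st t(2) .
    also have "\<dots> \<le> (sz x + 4) ^ 9 * 4 * T' x"
      using nx by (intro mult_le_mono power_mono) auto
    finally have "1 + (card (states (ctx x)) + (1 + (1 + (2 ^ cover_number (fst x) + 1))))
        \<le> 4 * T' x + ((sz x + 4) ^ 9 * 4 * T' x + T' x)"
      using t(1) one by linarith
    also have "\<dots> = ((sz x + 4) ^ 9 * 4 + 5) * T' x" by (simp add: algebra_simps)
    finally show "1 + (card (states (ctx x)) + (1 + (1 + (2 ^ cover_number (fst x) + 1))))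
        \<le> ((sz x + 4) ^ 9 * 4 + 5) * T' x" .
  qed auto
  then show ?thesis
  proof (rule solvableI)
    fix x assume x: "x \<in> I"
    obtain G r k where xs: "x = (G, r, k)" by (cases x)
    obtain n where gr: "graph_instance G n" "0 < r" using gds_instance_locale x xs I by blast
    interpret machine "matrix G" "mc (matrix G)" "clique_order (matrix G) (mc (matrix G))"
      "min (n + 3) r" "min n k" n by (rule mach[OF gr])
    let ?c = "ctx (code_of x)"
    have "search_result (ctx_succ ?c) (ctx_final ?c) (ctx_init ?c) (srch ?c)"
      using srch(2) x by blast
    then have "yes (code_of x) \<longleftrightarrow> (\<exists>st. reach (ctx_succ ?c) (ctx_init ?c) st \<and> ctx_final ?c st)"
      unfolding yes_def search_result_def by (elim disjE exE) (blast, metis list.distinct(1))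
    also have "\<dots> \<longleftrightarrow> (\<exists>\<D>. gds \<D>)"
      using search_iff graph_instance.card_verts[OF gr(1)]
      by (simp add: xs ctx_eq[OF gr(1)] ctx_succ_def ctx_init_def ctx_final_def)
    also have "\<dots> \<longleftrightarrow> gds_yes x"
      using graph_instance.gds_iff[OF gr(1) conjunct1[OF mc(2)] gr(2)] by (simp add: xs)
    finally show "yes (code_of x) = gds_yes x" .
  qed (rule T')
qed

theorem theorem7:
  shows "solvable_in_O_star gds_instances gds_encode gds_yes
           (\<lambda>(G, r, k). (2 * twin_cover_number G * (r + 1)) ^ twin_cover_number G)
       \<and> solvable_in_O_star {(G, r, k) \<in> gds_instances. r \<in> {2, 3}} gds_encode gds_yes
           (\<lambda>(G, r, k). (r + 1) ^ twin_cover_number G)"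
proof (rule conjI)
  show "solvable_in_O_star gds_instances gds_encode gds_yes
           (\<lambda>(G, r, k). (2 * twin_cover_number G * (r + 1)) ^ twin_cover_number G)"
  proof (rule solvable_if_few_states)
    fix G r k assume x: "(G, r, k) \<in> gds_instances"
    show "2 ^ twin_cover_number G \<le> (case (G, r, k) of (G, r, k) \<Rightarrow>
        (2 * twin_cover_number G * (r + 1)) ^ twin_cover_number G)"
    \<comment> \<open>For cover number 0 the base vanishes, but the exponent does too, so both sides
      are 1.\<close>
    proof (cases "twin_cover_number G = 0")
      case False
      then have "2 \<le> 2 * twin_cover_number G * (r + 1)" by (cases "twin_cover_number G") auto
      then show ?thesis unfolding prod.case by (rule power_mono) simp
    qed simp
    fix n S
    assume G: "graph_instance G n"
      and mach: "machine (matrix G) S (clique_order (matrix G) S) (min (n + 3) r) n"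
      and le: "card (set S) \<le> twin_cover_number G"
    interpret machine "matrix G" S "clique_order (matrix G) S" "min (n + 3) r" "min n k" n by fact
    have r0: "0 < r" using x by (simp add: gds_instances_def)
    have "card {st. reach (msucc (matrix G) S (clique_order (matrix G) S) (min (n + 3) r) (min n k)) (minit n) st}
        \<le> (n + 4) ^ 6 * card (label_sets n (\<lambda>_. {vU, vD, vX, vC} \<union> pend_vals) (set S))"
      by (rule card_states(2)[OF _ _ card_general(1) labels_general]) auto
    also have "\<dots> \<le> (n + 4) ^ 9 * 4 * (2 * twin_cover_number G * (r + 1)) ^ twin_cover_number G"
    proof (rule mult_le_mono)
      have "(n + 4) ^ 6 \<le> (n + 4) ^ 9" by (rule power_increasing) auto
      then show "(n + 4) ^ 6 \<le> (n + 4) ^ 9 * 4" by linarith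
      show "card (label_sets n (\<lambda>_. {vU, vD, vX, vC} \<union> pend_vals) (set S))
          \<le> (2 * twin_cover_number G * (r + 1)) ^ twin_cover_number G"
        using card_general(2) general_bound[OF le r0, of "min (n + 3) r"] by simp
    qed
    finally show "card {st. reach (msucc (matrix G) S (clique_order (matrix G) S) (min (n + 3) r) (min n k)) (minit n) st}
        \<le> (n + 4) ^ 9 * 4 * (case (G, r, k) of (G, r, k) \<Rightarrow>
          (2 * twin_cover_number G * (r + 1)) ^ twin_cover_number G)"
      by simp
  qed simp
next
  show "solvable_in_O_star {(G, r, k) \<in> gds_instances. r \<in> {2, 3}} gds_encode gds_yes
           (\<lambda>(G, r, k). (r + 1) ^ twin_cover_number G)"
  proof (rule solvable_if_few_states)
    show "{(G, r, k) \<in> gds_instances. r \<in> {2, 3}} \<subseteq> gds_instances" by auto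
    fix G r k assume x: "(G, r, k) \<in> {(G, r, k) \<in> gds_instances. r \<in> {2, 3}}"
    then have r23: "r \<in> {2, 3}" by simp
    show "2 ^ twin_cover_number G \<le> (case (G, r, k) of (G, r, k) \<Rightarrow> (r + 1) ^ twin_cover_number G)"
      unfolding prod.case by (rule power_mono) (use r23 in auto)
    fix n S
    assume G: "graph_instance G n"
      and mach: "machine (matrix G) S (clique_order (matrix G) S) (min (n + 3) r) n"
      and le: "card (set S) \<le> twin_cover_number G"
    \<comment> \<open>The cap is at least 3 even for the empty graph.\<close>
    have mr: "min (n + 3) r = r" using r23 by auto
    interpret machine "matrix G" S "clique_order (matrix G) S" r "min n k" n using mach unfolding mr .
    have "card {st. reach (msucc (matrix G) S (clique_order (matrix G) S) r (min n k)) (minit n) st}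
        \<le> (n + 4) ^ 6 * card small_labels"
      by (rule card_states(2)[OF _ _ card_small(1)[OF r23] labels_small[OF r23]]) (use r23 in auto)
    also have "\<dots> \<le> (n + 4) ^ 6 * (4 * (n + 1) ^ 3 * (r + 1) ^ card (set S))"
      by (intro mult_le_mono2 card_small(2)[OF r23])
    also have "\<dots> \<le> (n + 4) ^ 6 * (4 * (n + 4) ^ 3 * (r + 1) ^ twin_cover_number G)"
      using le by (intro mult_le_mono power_mono power_increasing le_refl) auto
    also have "\<dots> = (n + 4) ^ 9 * 4 * (r + 1) ^ twin_cover_number G"
      using power_add[of "n + 4" 6 3] by simp
    finally show "card {st. reach (msucc (matrix G) S (clique_order (matrix G) S) (min (n + 3) r) (min n k)) (minit n) st}
        \<le> (n + 4) ^ 9 * 4 * (case (G, r, k) of (G, r, k) \<Rightarrow> (r + 1) ^ twin_cover_number G)"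
      unfolding mr by simp
  qed
qed

end
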